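(* The standard definition (S) and the categorical definition (C) of a finite-dimensional von Neumann algebra, recalled in the context, are equivalent, i.e. the data in one definition uniquely determines the data in the other.
   Context: An operator space is a complex vector space $X$ with a norm $\|\cdot\|_n$ on $\mathbb M_n(X)$ (the $n\times n$ matrices with entries in $X$) for every $n$, such that $\mathbb M_1(X)$ is a Banach space, $\|x\oplus y\|_{m+n}=\max\{\|x\|_m,\|y\|_n\}$ (block-diagonal sum), and $\|\alpha x\beta\|_m\le\|\alpha\|\,\|x\|_m\|\beta\|$ for $\alpha,\beta\in\mathbb M_m(\mathbb C)$ (operator norm). $M_n(X)$ denotes $\mathbb M_n(X)$ with the norm $\|\cdot\|_n$. $\mathbb C$ carries the operator norms on $\mathbb M_n(\mathbb C)$. A linear map $\varphi:X\to Y$ is a complete contraction (resp. complete isometry) if all of its entrywise amplifications $\varphi_n:M_n(X)\to M_n(Y)$ are contractions (resp. isometries). $\mathbf{FdOS}$ is the category of finite-dimensional (f.d.) operator spaces and complete contractions; its strong monomorphisms are exactly the complete isometries. Haagerup tensor: $X\otimes_h Y$ is $X\otimes Y$ with $\|v\|=\inf\{\|x\|\|y\| : v=x\odot y,\ x\in M_{n,r}(X),\ y\in M_{r,n}(Y),\ r\in\mathbb N\}$ for $v\in\mathbb M_n(X\otimes Y)$, where $(x\odot y)_{ij}=\sum_k x_{ik}\otimes y_{kj}$ and rectangular matrices are normed by padding with zeros to square ones. $(\mathbf{FdOS},\mathbb C,\otimes_h)$ is a monoidal category with the structure maps of vector spaces. $X_c$: the conjugate vector space of $X$ (same set and addition,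 scalar multiplication $\lambda * x=\overline\lambda x$) with the same matrix norms. $X_o$: the same vector space as $X$ with $\|[x_{ji}]\|_{M_n(X_o)}=\|[x_{ij}]\|_{M_n(X)}$. Both are functorial with $f_c=f$, $f_o=f$ as functions. One has $(X\otimes_h Y)_c=X_c\otimes_h Y_c$, and $\gamma: X_o\otimes_h Y_o\cong (Y\otimes_h X)_o$, $x\otimes y\mapsto y\otimes x$, is a completely isometric isomorphism. (S) A f.d. vN-algebra is a f.d. complex vector space $A$ together with (1) a bilinear binary multiplication which is associative, $a(bc)=(ab)c$; (2) an element $1\in A$, the unit, with $1a=a=a1$; (3) an anti-linear unary operation $(\cdot)^*$, the involution, with $(a^* )^*=a$ and $(ab)^*=b^*a^*$; (4) a (necessarily complete) norm with $\|ab\|\le\|a\|\|b\|$ and $\|a^*a\|=\|a\|^2$. Such an $A$ is regarded as an operator space via its canonical operator space structure: each $\mathbb M_n(A)$, with the obvious multiplication, unit and involution, has a unique norm making it a vN-algebra in the sense of (S), and these norms form the operator space structure. (C) A f.d. vN-algebra is a f.d. operator space $A$ together with complete contractions $\mu:A\otimes_h A\to A$ (multiplication), $\eta:\mathbb C\to A$ (unit), $i:A_c\to A_o$ (involution) such that: $(A,\eta,\mu)$ is a monoid object in $(\mathbf{FdOS},\mathbb C,\otimes_h)$; $i_o\circ i_c=\mathrm{id}_A$ (with $A_{cc}=A=A_{oo}$, $A_{oc}=A_{co}$); $i\circ\mu=\mu\circ\gamma\circ(i\otimes i)$ as maps $A_c\otimes_h A_c=(A\otimes_h A)_c\to A_o$;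 and for every complete isometry $a:\mathbb C\to A$ the composite $\mathbb C\cong\mathbb C_o\otimes_h\mathbb C_c\xrightarrow{a\otimes a}A_o\otimes_h A_c\xrightarrow{\mathrm{id}\otimes i}A_o\otimes_h A_o\xrightarrow{\gamma}(A\otimes_h A)_o\xrightarrow{\mu}A_o$ is also a complete isometry. *)

theory Defs
  imports "HOL-Analysis.Analysis" "HOL-Library.Multiset" "HOL-Library.Function_Algebras"
begin

section \<open>Complex vector spaces\<close>

class complex_vector = ab_group_add +
  fixes scaleC :: "complex \<Rightarrow> 'a \<Rightarrow> 'a"  (infixr \<open>*\<^sub>C\<close> 75)
  assumes scaleC_add_right: "c *\<^sub>C (x + y) = c *\<^sub>C x + c *\<^sub>C y"
    and scaleC_add_left: "(c + d) *\<^sub>C x = c *\<^sub>C x + d *\<^sub>C x"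
    and scaleC_scaleC: "c *\<^sub>C d *\<^sub>C x = (c * d) *\<^sub>C x"
    and scaleC_one: "1 *\<^sub>C x = x"

global_interpretation cv: vector_space "scaleC :: complex \<Rightarrow> 'a \<Rightarrow> 'a::complex_vector"
  by standard (rule scaleC_add_right scaleC_add_left scaleC_scaleC scaleC_one)+

abbreviation clinear :: "('a::complex_vector \<Rightarrow> 'b::complex_vector) \<Rightarrow> bool"
  where "clinear \<equiv> Vector_Spaces.linear scaleC scaleC"

lemma clinear_iff:
  "clinear f \<longleftrightarrow> (\<forall>x y. f (x + y) = f x + f y) \<and> (\<forall>c x. f (c *\<^sub>C x) = c *\<^sub>C f x)"
  by (simp add: Vector_Spaces.linear_iff cv.vector_space_axioms)

lemma clinearD:
  assumes "clinear f"
  shows "f (x + y) = f x + f y" "f (c *\<^sub>C x) = c *\<^sub>C f x" "f 0 = 0"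
proof -
  show add: "f (x + y) = f x + f y" "f (c *\<^sub>C x) = c *\<^sub>C f x" for x y
    using assms by (simp_all add: clinear_iff)
  show "f 0 = 0" using add(1)[of 0 0] by simp
qed

definition fin_dim :: "'a::complex_vector set \<Rightarrow> bool"
  where "fin_dim V \<longleftrightarrow> cv.subspace V \<and> (\<exists>B. finite B \<and> cv.span B = V)"

definition cbilinear ::
    "('a::complex_vector \<Rightarrow> 'b::complex_vector \<Rightarrow> 'c::complex_vector) \<Rightarrow> bool"
  where "cbilinear \<beta> \<longleftrightarrow> (\<forall>x. clinear (\<beta> x)) \<and> (\<forall>y. clinear (\<lambda>x. \<beta> x y))"

instantiation complex :: complex_vector
begin
definition "scaleC_complex = ((*) :: complex \<Rightarrow> complex \<Rightarrow> complex)"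
instance by standard (simp_all add: scaleC_complex_def algebra_simps)
end

instantiation "fun" :: (type, complex_vector) complex_vector
begin
definition "scaleC_fun c f = (\<lambda>x. c *\<^sub>C f x)"
instance
  by standard (simp_all add: scaleC_fun_def fun_eq_iff scaleC_add_right scaleC_add_left
      scaleC_scaleC scaleC_one)
end


section \<open>The conjugate vector space\<close>

typedef 'a conj = "UNIV :: 'a set" morphisms of_conj to_conj ..

setup_lifting type_definition_conj

instantiation conj :: (complex_vector) complex_vector
begin
lift_definition zero_conj :: "'a conj" is 0 .
lift_definition plus_conj :: "'a conj \<Rightarrow> 'a conj \<Rightarrow> 'a conj" is "(+)" .
lift_definition minus_conj :: "'a conj \<Rightarrow> 'a conj \<Rightarrow> 'a conj" is "(-)" .
lift_definition uminus_conj :: "'a conj \<Rightarrow> 'a conj" is uminus .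
lift_definition scaleC_conj :: "complex \<Rightarrow> 'a conj \<Rightarrow> 'a conj" is "\<lambda>c x. cnj c *\<^sub>C x" .
instance
  by standard (transfer, simp add: algebra_simps scaleC_add_right scaleC_add_left
      scaleC_scaleC scaleC_one)+
end

definition conj_map :: "('a \<Rightarrow> 'b) \<Rightarrow> 'a conj \<Rightarrow> 'b conj"
  where "conj_map f x = to_conj (f (of_conj x))"


section \<open>The algebraic tensor product\<close>

text \<open>A multiset of pairs stands for the corresponding formal sum of elementary tensors;
  scalars are absorbed into the factors.\<close>

inductive tensor_eq :: "('a::complex_vector \<times> 'b::complex_vector) multiset \<Rightarrow>
    ('a \<times> 'b) multiset \<Rightarrow> bool" where
  refl: "tensor_eq s s"
| sym: "tensor_eq s t \<Longrightarrow> tensor_eq t s"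
| trans: "tensor_eq s t \<Longrightarrow> tensor_eq t u \<Longrightarrow> tensor_eq s u"
| cong: "tensor_eq s t \<Longrightarrow> tensor_eq (s + u) (t + u)"
| add_left: "tensor_eq {#(x + x', y)#} {#(x, y), (x', y)#}"
| add_right: "tensor_eq {#(x, y + y')#} {#(x, y), (x, y')#}"
| scale: "tensor_eq {#(c *\<^sub>C x, y)#} {#(x, c *\<^sub>C y)#}"
| zero: "tensor_eq {#(0, y)#} {#}"

lemma equivp_tensor_eq: "equivp tensor_eq"
  by (rule equivpI)
    (auto intro!: reflpI sympI transpI intro: tensor_eq.refl tensor_eq.sym tensor_eq.trans)

quotient_type (overloaded) ('a, 'b) tensor = "('a::complex_vector \<times> 'b::complex_vector) multiset" / tensor_eq
  by (rule equivp_tensor_eq)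

lemma tensor_eq_add:
  assumes "tensor_eq s s'" "tensor_eq t t'"
  shows "tensor_eq (s + t) (s' + t')"
  by (metis assms tensor_eq.cong tensor_eq.trans add.commute)

lemma tensor_eq_image:
  assumes "tensor_eq s t"
    and "\<And>x x'. f (x + x') = f x + f x'" "\<And>c x. f (c *\<^sub>C x) = c *\<^sub>C f x"
  shows "tensor_eq (image_mset (map_prod f id) s) (image_mset (map_prod f id) t)"
  using assms(1)
proof induction
  case (zero y)
  have "f 0 = 0" using assms(2)[of 0 0] by simp
  then show ?case by (simp add: tensor_eq.zero)
qed (auto intro: tensor_eq.intros simp: assms(2,3) simp del: add_mset_add_single)

lemma tensor_eq_inverse: "tensor_eq (image_mset (map_prod uminus id) s + s) {#}"
proof (induction s)
  case empty
  show ?case by (simp add: tensor_eq.refl)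
next
  case (add p s)
  obtain x y where p: "p = (x, y)" by force
  have "tensor_eq {#(- x, y), (x, y)#} {#(- x + x, y)#}"
    by (rule tensor_eq.sym, rule tensor_eq.add_left)
  moreover have "tensor_eq {#(- x + x, y)#} {#}"
    using tensor_eq.zero by simp
  ultimately have "tensor_eq {#(- x, y), (x, y)#} {#}"
    by (rule tensor_eq.trans)
  from tensor_eq_add[OF this add.IH] show ?case by (simp add: p add_mset_commute)
qed

instantiation tensor :: (complex_vector, complex_vector) complex_vector
begin
lift_definition zero_tensor :: "('a, 'b) tensor" is "{#}" .
lift_definition plus_tensor :: "('a, 'b) tensor \<Rightarrow> ('a, 'b) tensor \<Rightarrow> ('a, 'b) tensor" is "(+)"
  by (rule tensor_eq_add)
lift_definition uminus_tensor :: "('a, 'b) tensor \<Rightarrow> ('a, 'b) tensor"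
  is "image_mset (map_prod uminus id)"
  by (rule tensor_eq_image) (auto simp: cv.scale_minus_right)
definition minus_tensor :: "('a, 'b) tensor \<Rightarrow> ('a, 'b) tensor \<Rightarrow> ('a, 'b) tensor"
  where "minus_tensor s t = s + - t"
lift_definition scaleC_tensor :: "complex \<Rightarrow> ('a, 'b) tensor \<Rightarrow> ('a, 'b) tensor"
  is "\<lambda>c. image_mset (map_prod (scaleC c) id)"
  by (rule tensor_eq_image) (auto simp: scaleC_add_right scaleC_scaleC mult.commute)
instance
proof
  fix s t u :: "('a, 'b) tensor" and c d :: complex
  show "s + t + u = s + (t + u)" by transfer (simp add: add.assoc tensor_eq.refl)
  show "s + t = t + s" by transfer (simp add: add.commute tensor_eq.refl)
  show "0 + s = s" by transfer (simp add: tensor_eq.refl)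
  show "- s + s = 0" by transfer (rule tensor_eq_inverse)
  show "s - t = s + - t" by (rule minus_tensor_def)
  show "c *\<^sub>C (s + t) = c *\<^sub>C s + c *\<^sub>C t" by transfer (simp add: tensor_eq.refl)
  show "c *\<^sub>C d *\<^sub>C s = (c * d) *\<^sub>C s"
    by transfer (simp add: multiset.map_comp comp_def map_prod_def case_prod_unfold
        scaleC_scaleC tensor_eq.refl)
  show "1 *\<^sub>C s = s"
    by transfer (simp add: map_prod_def scaleC_one tensor_eq.refl)
  show "(c + d) *\<^sub>C s = c *\<^sub>C s + d *\<^sub>C s"
  proof transfer
    fix c d and s :: "('a \<times> 'b) multiset"
    show "tensor_eq (image_mset (map_prod (scaleC (c + d)) id) s)
      (image_mset (map_prod (scaleC c) id) s + image_mset (map_prod (scaleC d) id) s)"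
    proof (induction s)
      case empty
      show ?case by (simp add: tensor_eq.refl)
    next
      case (add p s)
      obtain x y where p: "p = (x, y)" by force
      have "tensor_eq {#((c + d) *\<^sub>C x, y)#} {#(c *\<^sub>C x, y), (d *\<^sub>C x, y)#}"
        by (simp add: scaleC_add_left tensor_eq.add_left)
      from tensor_eq_add[OF this add.IH] show ?case by (simp add: p add_mset_commute)
    qed
  qed
qed
end

lift_definition tensor :: "'a::complex_vector \<Rightarrow> 'b::complex_vector \<Rightarrow> ('a, 'b) tensor"
    (infixl \<open>\<otimes>\<close> 70)
  is "\<lambda>x y. {#(x, y)#}" .

lemma tensor_simps:
  "(x + x') \<otimes> y = x \<otimes> y + x' \<otimes> y" "x \<otimes> (y + y') = x \<otimes> y + x \<otimes> y'"
  "(c *\<^sub>C x) \<otimes> y = c *\<^sub>C (x \<otimes> y)" "x \<otimes> (c *\<^sub>C y) = c *\<^sub>C (x \<otimes> y)"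
  subgoal by transfer (use tensor_eq.add_left in \<open>simp add: add_mset_commute\<close>)
  subgoal by transfer (use tensor_eq.add_right in \<open>simp add: add_mset_commute\<close>)
  subgoal by transfer (simp add: tensor_eq.refl)
  subgoal by transfer (simp add: tensor_eq.sym[OF tensor_eq.scale])
  done

lemma cbilinear_tensor: "cbilinear (\<lambda>x y. x \<otimes> y)"
  by (simp add: cbilinear_def clinear_iff tensor_simps)

lemma tensor_induct [case_names zero add]:
  assumes "P 0" and "\<And>x y t. P t \<Longrightarrow> P (x \<otimes> y + t)"
  shows "P t"
proof -
  have "P (abs_tensor s)" for s
  proof (induction s)
    case empty
    then show ?case using assms(1) by (simp add: zero_tensor.abs_eq)
  next
    case (add p s)
    have "abs_tensor (add_mset p s) = fst p \<otimes> snd p + abs_tensor s"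
      by (simp add: tensor.abs_eq plus_tensor.abs_eq)
    then show ?case using assms(2)[OF add.IH] by simp
  qed
  from this[of "rep_tensor t"] show ?thesis by (simp add: Quotient3_abs_rep[OF Quotient3_tensor])
qed

text \<open>For bilinear \<open>\<beta>\<close> this is the induced linear map, by the two lemmas below; for other
  \<open>\<beta>\<close> it has no meaning.\<close>

definition tensor_lift :: "('a::complex_vector \<Rightarrow> 'b::complex_vector \<Rightarrow> 'c::complex_vector)
    \<Rightarrow> ('a, 'b) tensor \<Rightarrow> 'c"
  where "tensor_lift \<beta> t = (\<Sum>(x, y)\<in>#rep_tensor t. \<beta> x y)"

lemma
  assumes "cbilinear \<beta>"
  shows tensor_lift_tensor: "tensor_lift \<beta> (x \<otimes> y) = \<beta> x y"
    and linear_tensor_lift: "clinear (tensor_lift \<beta>)"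
proof -
  have add: "\<beta> (x + x') y = \<beta> x y + \<beta> x' y" "\<beta> x (y + y') = \<beta> x y + \<beta> x y'"
    and sc: "\<beta> (c *\<^sub>C x) y = c *\<^sub>C \<beta> x y" "\<beta> x (c *\<^sub>C y) = c *\<^sub>C \<beta> x y" for x x' y y' c
    using assms by (simp_all add: cbilinear_def clinear_iff)
  have zero: "\<beta> 0 y = 0" for y using add(1)[of 0 0 y] by simp
  have resp: "(\<Sum>(x, y)\<in>#s. \<beta> x y) = (\<Sum>(x, y)\<in>#t. \<beta> x y)" if "tensor_eq s t" for s t
    using that by induction (simp_all add: add sc zero)
  have abs: "tensor_lift \<beta> (abs_tensor s) = (\<Sum>(x, y)\<in>#s. \<beta> x y)" for s
    unfolding tensor_lift_def
    by (rule resp) (rule rep_abs_rsp_left[OF Quotient3_tensor tensor_eq.refl])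
  show "tensor_lift \<beta> (x \<otimes> y) = \<beta> x y"
    by (simp add: tensor.abs_eq abs)
  have "tensor_lift \<beta> (abs_tensor s + abs_tensor t)
      = tensor_lift \<beta> (abs_tensor s) + tensor_lift \<beta> (abs_tensor t)" for s t
    by (simp add: plus_tensor.abs_eq abs)
  moreover have "tensor_lift \<beta> (c *\<^sub>C abs_tensor s) = c *\<^sub>C tensor_lift \<beta> (abs_tensor s)" for c s
    by (simp add: scaleC_tensor.abs_eq abs multiset.map_comp comp_def case_prod_unfold sc)
      (induction s, simp_all add: scaleC_add_right cv.scale_zero_right)
  ultimately show "clinear (tensor_lift \<beta>)"
    unfolding clinear_iff by (metis Quotient3_abs_rep[OF Quotient3_tensor])
qed

definition tensor_map :: "('a::complex_vector \<Rightarrow> 'c::complex_vector) \<Rightarrow>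
    ('b::complex_vector \<Rightarrow> 'd::complex_vector) \<Rightarrow> ('a, 'b) tensor \<Rightarrow> ('c, 'd) tensor"
  where "tensor_map f g = tensor_lift (\<lambda>x y. f x \<otimes> g y)"

definition tensor_flip ::
    "('a::complex_vector, 'b::complex_vector) tensor \<Rightarrow> ('b, 'a) tensor"
  where "tensor_flip = tensor_lift (\<lambda>x y. y \<otimes> x)"

definition tensor_assoc ::
    "(('a::complex_vector, 'b::complex_vector) tensor, 'c::complex_vector) tensor
      \<Rightarrow> ('a, ('b, 'c) tensor) tensor"
  where "tensor_assoc = tensor_lift (\<lambda>t z. tensor_lift (\<lambda>x y. x \<otimes> (y \<otimes> z)) t)"

definition tensor_lunit :: "(complex, 'a::complex_vector) tensor \<Rightarrow> 'a"
  where "tensor_lunit = tensor_lift (\<lambda>c x. c *\<^sub>C x)"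

definition tensor_runit :: "('a::complex_vector, complex) tensor \<Rightarrow> 'a"
  where "tensor_runit = tensor_lift (\<lambda>x c. c *\<^sub>C x)"

lemma tensor_map_tensor:
  "clinear f \<Longrightarrow> clinear g \<Longrightarrow> tensor_map f g (x \<otimes> y) = f x \<otimes> g y"
  unfolding tensor_map_def
  by (rule tensor_lift_tensor) (simp add: cbilinear_def clinear_iff tensor_simps)

lemma tensor_flip_tensor: "tensor_flip (x \<otimes> y) = y \<otimes> x"
  unfolding tensor_flip_def
  by (rule tensor_lift_tensor) (simp add: cbilinear_def clinear_iff tensor_simps)

lemma tensor_assoc_tensor: "tensor_assoc (x \<otimes> y \<otimes> z) = x \<otimes> (y \<otimes> z)"
  for x :: "'a::complex_vector" and y :: "'b::complex_vector" and z :: "'c::complex_vector"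
proof -
  have bil: "cbilinear (\<lambda>x y. x \<otimes> (y \<otimes> z))" for z :: 'c
    by (simp add: cbilinear_def clinear_iff tensor_simps)
  define g :: "('a, 'b) tensor \<Rightarrow> 'c \<Rightarrow> ('a, ('b, 'c) tensor) tensor"
    where "g t z = tensor_lift (\<lambda>x y. x \<otimes> (y \<otimes> z)) t" for t z
  have lin: "clinear (\<lambda>t. g t z)" for z
    unfolding g_def using linear_tensor_lift[OF bil] .
  have g: "g (x \<otimes> y) z = x \<otimes> (y \<otimes> z)" for x y z
    unfolding g_def by (rule tensor_lift_tensor[OF bil])
  have "g t (z + z') = g t z + g t z'" for t z z'
    by (induction t rule: tensor_induct) (simp_all add: g clinearD[OF lin] tensor_simps)
  moreover have "g t (c *\<^sub>C z) = c *\<^sub>C g t z" for t c z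
    by (induction t rule: tensor_induct)
      (simp_all add: g clinearD[OF lin] tensor_simps scaleC_add_right cv.scale_zero_right)
  ultimately have "cbilinear g"
    using lin by (simp add: cbilinear_def clinear_iff)
  then have "tensor_lift g (x \<otimes> y \<otimes> z) = x \<otimes> (y \<otimes> z)"
    by (simp add: tensor_lift_tensor g)
  then show ?thesis by (simp add: tensor_assoc_def g_def[abs_def])
qed

text \<open>The identification of \<open>X\<^sub>c \<otimes> Y\<^sub>c\<close> with \<open>(X \<otimes> Y)\<^sub>c\<close>.\<close>

definition tensor_conj ::
    "('a::complex_vector conj, 'b::complex_vector conj) tensor \<Rightarrow> ('a, 'b) tensor conj"
  where "tensor_conj = tensor_lift (\<lambda>x y. to_conj (of_conj x \<otimes> of_conj y))"

lemma tensor_conj_tensor: "tensor_conj (x \<otimes> y) = to_conj (of_conj x \<otimes> of_conj y)"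
  unfolding tensor_conj_def
  by (rule tensor_lift_tensor)
    (simp add: cbilinear_def clinear_iff tensor_simps plus_conj.rep_eq scaleC_conj.rep_eq
      plus_conj.abs_eq scaleC_conj.abs_eq)


section \<open>Operator spaces\<close>

text \<open>An \<open>n \<times> r\<close> matrix is a doubly indexed family vanishing outside \<open>{..<n} \<times> {..<r}\<close>. Hence
  the entrywise vector space operations on families restrict to matrices, and padding a
  rectangular matrix with zeros leaves the family unchanged.\<close>

type_synonym 'a matrix = "nat \<Rightarrow> nat \<Rightarrow> 'a"

definition mats :: "nat \<Rightarrow> nat \<Rightarrow> 'a::zero matrix set"
  where "mats n r = {x. \<forall>i j. x i j \<noteq> 0 \<longrightarrow> i < n \<and> j < r}"

definition mat1 :: "'a::zero \<Rightarrow> 'a matrix"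
  where "mat1 a = (\<lambda>i j. if i = 0 \<and> j = 0 then a else 0)"

definition direct_sum :: "nat \<Rightarrow> 'a::zero matrix \<Rightarrow> 'a matrix \<Rightarrow> 'a matrix"
  where "direct_sum m x y = (\<lambda>i j. if i < m \<and> j < m then x i j
      else if m \<le> i \<and> m \<le> j then y (i - m) (j - m) else 0)"

definition sandwich :: "nat \<Rightarrow> complex matrix \<Rightarrow> 'a::complex_vector matrix \<Rightarrow> complex matrix
    \<Rightarrow> 'a matrix"
  where "sandwich m \<alpha> x \<beta> = (\<lambda>i j. \<Sum>k<m. \<Sum>l<m. (\<alpha> i k * \<beta> l j) *\<^sub>C x k l)"

definition amplify :: "('a \<Rightarrow> 'b) \<Rightarrow> 'a matrix \<Rightarrow> 'b matrix"
  where "amplify \<phi> x = (\<lambda>i j. \<phi> (x i j))"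

definition norm_on :: "'a::complex_vector set \<Rightarrow> ('a \<Rightarrow> real) \<Rightarrow> bool"
  where "norm_on V \<nu> \<longleftrightarrow>
    (\<forall>x\<in>V. 0 \<le> \<nu> x) \<and> (\<forall>x\<in>V. \<nu> x = 0 \<longleftrightarrow> x = 0) \<and>
    (\<forall>x\<in>V. \<forall>y\<in>V. \<nu> (x + y) \<le> \<nu> x + \<nu> y) \<and>
    (\<forall>x\<in>V. \<forall>c. \<nu> (c *\<^sub>C x) = cmod c * \<nu> x)"

text \<open>A family of matrix norms: \<open>N n\<close> is the norm on \<open>n \<times> n\<close> matrices. The only \<open>0 \<times> 0\<close> matrix is
  \<open>0\<close>, so including \<open>n = 0\<close> carries no information.\<close>

type_synonym 'a mnorm = "nat \<Rightarrow> 'a matrix \<Rightarrow> real"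

definition scalar_mnorm :: "complex mnorm"
  where "scalar_mnorm n = restrict
    (\<lambda>\<alpha>. SUP \<xi>\<in>{\<xi>. L2_set (\<lambda>j. cmod (\<xi> j)) {..<n} \<le> 1}.
      L2_set (\<lambda>i. cmod (\<Sum>j<n. \<alpha> i j * \<xi> j)) {..<n})
    (mats n n)"

text \<open>Extensionality fixes the irrelevant values of \<open>N n\<close> outside the \<open>n \<times> n\<close> matrices, so that
  equal operator space structures are equal as functions.\<close>

definition operator_space :: "'a::complex_vector mnorm \<Rightarrow> bool"
  where "operator_space N \<longleftrightarrow>
    (\<forall>n. N n \<in> extensional (mats n n) \<and> norm_on (mats n n) (N n)) \<and>
    Metric_space.mcomplete UNIV (\<lambda>a b. N 1 (mat1 (a - b))) \<and>
    (\<forall>m n. \<forall>x\<in>mats m m. \<forall>y\<in>mats n n. N (m + n) (direct_sum m x y) = max (N m x) (N n y)) \<and>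
    (\<forall>m. \<forall>\<alpha>\<in>mats m m. \<forall>x\<in>mats m m. \<forall>\<beta>\<in>mats m m.
      N m (sandwich m \<alpha> x \<beta>) \<le> scalar_mnorm m \<alpha> * N m x * scalar_mnorm m \<beta>)"

definition complete_contraction ::
    "'a::complex_vector mnorm \<Rightarrow> 'b::complex_vector mnorm \<Rightarrow> ('a \<Rightarrow> 'b) \<Rightarrow> bool"
  where "complete_contraction N M \<phi> \<longleftrightarrow>
    clinear \<phi> \<and> (\<forall>n. \<forall>x\<in>mats n n. M n (amplify \<phi> x) \<le> N n x)"

definition complete_isometry ::
    "'a::complex_vector mnorm \<Rightarrow> 'b::complex_vector mnorm \<Rightarrow> ('a \<Rightarrow> 'b) \<Rightarrow> bool"
  where "complete_isometry N M \<phi> \<longleftrightarrow>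
    clinear \<phi> \<and> (\<forall>n. \<forall>x\<in>mats n n. M n (amplify \<phi> x) = N n x)"

definition conj_mnorm :: "'a mnorm \<Rightarrow> 'a conj mnorm"
  where "conj_mnorm N n x = N n (amplify of_conj x)"

definition op_mnorm :: "'a mnorm \<Rightarrow> 'a mnorm"
  where "op_mnorm N n x = N n (\<lambda>i j. x j i)"

definition odot :: "nat \<Rightarrow> 'a::complex_vector matrix \<Rightarrow> 'b::complex_vector matrix
    \<Rightarrow> ('a, 'b) tensor matrix"
  where "odot r x y = (\<lambda>i j. \<Sum>k<r. x i k \<otimes> y k j)"

definition haagerup ::
    "'a::complex_vector mnorm \<Rightarrow> 'b::complex_vector mnorm \<Rightarrow> ('a, 'b) tensor mnorm"
  where "haagerup N M n = restrict
    (\<lambda>v. Inf {N (max n r) x * M (max n r) y | r x y.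
      x \<in> mats n r \<and> y \<in> mats r n \<and> v = odot r x y})
    (mats n n)"


section \<open>Finite-dimensional von Neumann algebras, standard definition\<close>

text \<open>Stated on a linear subspace \<open>V\<close> of the ambient type, so that it applies both to a whole type
  and to the \<open>n \<times> n\<close> matrices over it. Completeness of the norm is automatic in finite dimension.\<close>

definition vN_algebra_on :: "'a::complex_vector set \<Rightarrow> ('a \<Rightarrow> 'a \<Rightarrow> 'a) \<Rightarrow> 'a \<Rightarrow> ('a \<Rightarrow> 'a)
    \<Rightarrow> ('a \<Rightarrow> real) \<Rightarrow> bool"
  where "vN_algebra_on V mul e star \<nu> \<longleftrightarrow>
    fin_dim V \<and>
    (\<forall>a\<in>V. \<forall>b\<in>V. mul a b \<in> V) \<and>
    (\<forall>a\<in>V. \<forall>b\<in>V. \<forall>c\<in>V. mul (a + b) c = mul a c + mul b c \<and>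
      mul a (b + c) = mul a b + mul a c) \<and>
    (\<forall>a\<in>V. \<forall>b\<in>V. \<forall>z. mul (z *\<^sub>C a) b = z *\<^sub>C mul a b \<and> mul a (z *\<^sub>C b) = z *\<^sub>C mul a b) \<and>
    (\<forall>a\<in>V. \<forall>b\<in>V. \<forall>c\<in>V. mul a (mul b c) = mul (mul a b) c) \<and>
    e \<in> V \<and> (\<forall>a\<in>V. mul e a = a \<and> mul a e = a) \<and>
    (\<forall>a\<in>V. star a \<in> V) \<and>
    (\<forall>a\<in>V. \<forall>b\<in>V. star (a + b) = star a + star b) \<and>
    (\<forall>a\<in>V. \<forall>z. star (z *\<^sub>C a) = cnj z *\<^sub>C star a) \<and>
    (\<forall>a\<in>V. star (star a) = a) \<and>
    (\<forall>a\<in>V. \<forall>b\<in>V. star (mul a b) = mul (star b) (star a)) \<and>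
    norm_on V \<nu> \<and>
    (\<forall>a\<in>V. \<forall>b\<in>V. \<nu> (mul a b) \<le> \<nu> a * \<nu> b) \<and>
    (\<forall>a\<in>V. \<nu> (mul (star a) a) = (\<nu> a)\<^sup>2)"

record 'a std_data =
  std_mult :: "'a \<Rightarrow> 'a \<Rightarrow> 'a"
  std_unit :: 'a
  std_star :: "'a \<Rightarrow> 'a"
  std_norm :: "'a \<Rightarrow> real"

definition std_vN_algebra :: "'a::complex_vector std_data \<Rightarrow> bool"
  where "std_vN_algebra S \<longleftrightarrow>
    vN_algebra_on UNIV (std_mult S) (std_unit S) (std_star S) (std_norm S)"

definition mat_mult :: "('a \<Rightarrow> 'a \<Rightarrow> 'a::comm_monoid_add) \<Rightarrow> nat \<Rightarrow> 'a matrix \<Rightarrow> 'a matrix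
    \<Rightarrow> 'a matrix"
  where "mat_mult mul n x y = (\<lambda>i j. \<Sum>k<n. mul (x i k) (y k j))"

definition mat_unit :: "'a::zero \<Rightarrow> nat \<Rightarrow> 'a matrix"
  where "mat_unit e n = (\<lambda>i j. if i = j \<and> i < n then e else 0)"

definition mat_star :: "('a \<Rightarrow> 'a) \<Rightarrow> 'a matrix \<Rightarrow> 'a matrix"
  where "mat_star star x = (\<lambda>i j. star (x j i))"

definition vN_matrix_norm :: "'a::complex_vector std_data \<Rightarrow> nat \<Rightarrow> ('a matrix \<Rightarrow> real) \<Rightarrow> bool"
  where "vN_matrix_norm S n \<nu> \<longleftrightarrow> \<nu> \<in> extensional (mats n n) \<and>
    vN_algebra_on (mats n n) (mat_mult (std_mult S) n) (mat_unit (std_unit S) n)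
      (mat_star (std_star S)) \<nu>"

definition canonical_mnorm :: "'a::complex_vector std_data \<Rightarrow> 'a mnorm"
  where "canonical_mnorm S n = (THE \<nu>. vN_matrix_norm S n \<nu>)"


section \<open>Finite-dimensional von Neumann algebras, categorical definition\<close>

record (overloaded) 'a cat_data =
  cat_mnorm :: "'a mnorm"
  cat_mult :: "('a, 'a) tensor \<Rightarrow> 'a"
  cat_unit :: "complex \<Rightarrow> 'a"
  cat_inv :: "'a conj \<Rightarrow> 'a"

definition monoid_object ::
    "'a::complex_vector mnorm \<Rightarrow> (complex \<Rightarrow> 'a) \<Rightarrow> (('a, 'a) tensor \<Rightarrow> 'a) \<Rightarrow> bool"
  where "monoid_object N \<eta> \<mu> \<longleftrightarrow>
    complete_contraction (haagerup N N) N \<mu> \<and>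
    complete_contraction scalar_mnorm N \<eta> \<and>
    \<mu> \<circ> tensor_map \<mu> id = \<mu> \<circ> tensor_map id \<mu> \<circ> tensor_assoc \<and>
    \<mu> \<circ> tensor_map \<eta> id = tensor_lunit \<and>
    \<mu> \<circ> tensor_map id \<eta> = tensor_runit"

text \<open>The functor \<open>(\<cdot>)\<^sub>o\<close> is the identity on underlying vector spaces and maps, so it leaves no
  trace in composites. \<open>X\<^sub>c\<^sub>c = X\<close> is witnessed by \<open>to_conj \<circ> to_conj\<close>, and
  \<open>\<complex> \<cong> \<complex>\<^sub>o \<otimes> \<complex>\<^sub>c\<close> by \<open>z \<mapsto> z \<otimes> 1\<close>.\<close>

definition cat_vN_algebra :: "'a::complex_vector cat_data \<Rightarrow> bool"
  where "cat_vN_algebra C \<longleftrightarrow> (let N = cat_mnorm C; \<mu> = cat_mult C; \<eta> = cat_unit C; \<iota> = cat_inv C in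
    fin_dim (UNIV :: 'a set) \<and> operator_space N \<and>
    monoid_object N \<eta> \<mu> \<and>
    complete_contraction (conj_mnorm N) (op_mnorm N) \<iota> \<and>
    \<iota> \<circ> conj_map \<iota> \<circ> (to_conj \<circ> to_conj) = id \<and>
    \<iota> \<circ> conj_map \<mu> \<circ> tensor_conj = \<mu> \<circ> tensor_flip \<circ> tensor_map \<iota> \<iota> \<and>
    (\<forall>a. complete_isometry scalar_mnorm N a \<longrightarrow>
      complete_isometry scalar_mnorm (op_mnorm N)
        (\<mu> \<circ> tensor_flip \<circ> tensor_map id \<iota> \<circ> tensor_map a (conj_map a)
          \<circ> (\<lambda>z. z \<otimes> to_conj 1))))"


section \<open>Passing between the two kinds of data\<close>

definition std_to_cat :: "'a::complex_vector std_data \<Rightarrow> 'a cat_data"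
  where "std_to_cat S =
    \<lparr>cat_mnorm = canonical_mnorm S,
     cat_mult = tensor_lift (std_mult S),
     cat_unit = (\<lambda>z. z *\<^sub>C std_unit S),
     cat_inv = (\<lambda>x. std_star S (of_conj x))\<rparr>"

definition cat_to_std :: "'a::complex_vector cat_data \<Rightarrow> 'a std_data"
  where "cat_to_std C =
    \<lparr>std_mult = (\<lambda>a b. cat_mult C (a \<otimes> b)),
     std_unit = cat_unit C 1,
     std_star = (\<lambda>a. cat_inv C (to_conj a)),
     std_norm = (\<lambda>a. cat_mnorm C 1 (mat1 a))\<rparr>"

end

theory Submission
  imports Defs "HOL-Computational_Algebra.Fundamental_Theorem_Algebra"
begin

text \<open>A C*-norm on a finite-dimensional star algebra satisfies \<open>\<nu> (h\<^sup>* h) = (\<nu> h)\<^sup>2\<close>; iterating this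
  and comparing with any submultiplicative star-invariant norm, equivalent up to a constant by finite
  dimensionality, removes the constant. This gives uniqueness of C*-norms and that star homomorphisms
  are contractive. For existence on matrices, the spectral theorem shows that the trace \<open>\<tau>\<close> of the left
  regular representation of \<open>A\<close> is a faithful positive functional; the functional \<open>\<Sum> \<tau> (x\<^sub>i\<^sub>i)\<close> then
  makes \<open>M\<^sub>n(A)\<close> act on itself as an algebra of operators on a Hilbert space.

  Conversely, let \<open>N\<close> be the matrix norms of a categorical algebra. A complete isometry \<open>\<complex> \<rightarrow> A\<close> is
  an element of norm one, so \<open>N\<^sub>1\<close> is a C*-norm on \<open>A\<close>. The comparison above shows that \<open>N\<^sub>n\<close>
  dominates the canonical norm. For the other inequality it suffices, by the \<open>2 \<times> 2\<close> trick, to treat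
  self-adjoint \<open>H \<in> M\<^sub>n(A)\<close>. These are real combinations of elements \<open>p \<otimes> h\<close>
  with \<open>p\<close> a rank-one projection and \<open>h\<close> self-adjoint, hence \<open>N\<^sub>n (1 + i t H) \<le> 1 + O(t\<^sup>2)\<close>.
  Consequently \<open>N\<^sub>n (exp (i H)) \<le> 1\<close>, and a self-adjoint contraction is the real part of such an
  exponential.\<close>

section \<open>Norms on finite-dimensional spaces\<close>

text \<open>The isometry condition of the categorical definition speaks only of elements of
  \<open>A\<close>: it yields the C*-identity at level one and nothing directly at level
  \<open>n\<close>. There one merely knows that products, the unit map and the involution are
  contractive. A norm with these properties may exceed the C*-norm, so the missing inequality must
  come from the operator space axioms. They bound
  \<open>\<alpha> (1 \<oplus> a) \<alpha>\<^sup>*\<close> for scalar \<open>\<alpha>\<close>, which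
  with \<open>a = 1 + i t h\<close> reaches the rank-one elements. A plain norm bound on these would
  not survive sums, but an estimate \<open>1 + O(t\<^sup>2)\<close> does, since the product of
  \<open>1 + i t H\<close> and \<open>1 + i t L\<close> is \<open>1 + i t (H + L)\<close> up to
  \<open>O(t\<^sup>2)\<close>. In the end the error disappears, because the \<open>m\<close>-th
  power of the estimate at \<open>t = 1 / m\<close> is \<open>1 + O(1 / m)\<close>. The existence
  half starts without any positivity: that \<open>a\<^sup>* a\<close> has nonnegative spectrum is
  not an axiom. The trace supplies it, because nonzero idempotents have positive integer
  traces.\<close>

lemma scaleC_minus1: "(-1) *\<^sub>C x = - (x::'a::complex_vector)"
  by (metis cv.scale_minus_left scaleC_one)

lemma norm_onD:
  assumes "norm_on V \<nu>" "x \<in> V"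
  shows "0 \<le> \<nu> x" "\<nu> x = 0 \<longleftrightarrow> x = 0" "y \<in> V \<Longrightarrow> \<nu> (x + y) \<le> \<nu> x + \<nu> y" "\<nu> (c *\<^sub>C x) = cmod c * \<nu> x"
  using assms by (auto simp: norm_on_def)

lemma fin_dim_basis:
  assumes "fin_dim V"
  obtains B where "finite B" "cv.independent B" "cv.span B = V"
proof -
  obtain B0 where B0: "finite B0" "cv.span B0 = V" using assms by (auto simp: fin_dim_def)
  obtain B where B: "B \<subseteq> B0" "cv.independent B" "B0 \<subseteq> cv.span B"
    using cv.maximal_independent_subset[of B0] by auto
  have "cv.span B = V"
    using B B0 cv.span_mono[of B B0] cv.span_minimal[of B0 "cv.span B"] by (auto simp: cv.subspace_span)
  then show thesis using that B B0 finite_subset by blast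
qed

lemma seminorm_sum_le:
  assumes V: "cv.subspace V" and "finite B" "\<And>b. b \<in> B \<Longrightarrow> f b \<in> V"
    and "s 0 = 0" and "\<And>x y. x \<in> V \<Longrightarrow> y \<in> V \<Longrightarrow> s (x + y) \<le> s x + s y"
  shows "s (\<Sum>b\<in>B. f b) \<le> (\<Sum>b\<in>B. s (f b :: 'a::complex_vector) :: real)"
  using assms(2,3)
proof (induction B rule: finite_induct)
  case empty
  then show ?case using assms(4) by simp
next
  case (insert b B)
  have "s (f b + (\<Sum>b\<in>B. f b)) \<le> s (f b) + s (\<Sum>b\<in>B. f b)"
    by (rule assms(5)) (auto intro: insert cv.subspace_sum[OF V])
  then show ?case using insert by fastforce
qed

text \<open>The function \<open>g\<close> is continuous on the compact set of coefficient families
  with \<open>l1\<close>-norm one, and independence of \<open>B\<close> keeps it away from zero. Its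
  minimum \<open>g d\<close> gives the constant, and homogeneity does the rest.\<close>

lemma coordinates_bound:
  assumes B: "finite B" "cv.independent B" and \<nu>: "norm_on (cv.span B) \<nu>"
  obtains C where "0 \<le> C"
    "\<And>x. x \<in> cv.span B \<Longrightarrow> (\<Sum>b\<in>B. cmod (cv.representation B x b)) \<le> C * \<nu> x"
proof -
  define g where "g c = \<nu> (\<Sum>b\<in>B. c b *\<^sub>C b)" for c
  define l where "l c = (\<Sum>b\<in>B. cmod (c b))" for c :: "'a \<Rightarrow> complex"
  \<comment> \<open>The families are functions on the whole type. Forcing the value \<open>0\<close>
    off \<open>B\<close> makes the box a product of compact sets, hence compact by the theorem of
    Tychonoff.\<close>
  define K where "K = {c. (\<forall>b. c b \<in> (if b \<in> B then cball 0 1 else {0}))} \<inter> {c. l c = 1}"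
  have inS: "(\<Sum>b\<in>B. c b *\<^sub>C b) \<in> cv.span B" for c
    by (intro cv.span_sum cv.span_scale cv.span_base)
  have \<nu>0: "\<nu> 0 = 0" using norm_onD(2)[OF \<nu> cv.span_zero] by simp
  have g_diff: "g c - g d \<le> (\<Sum>b\<in>B. cmod (c b - d b) * \<nu> b)" for c d
  proof -
    have "(\<Sum>b\<in>B. c b *\<^sub>C b) = (\<Sum>b\<in>B. d b *\<^sub>C b) + (\<Sum>b\<in>B. (c b - d b) *\<^sub>C b)"
      by (simp add: sum.distrib[symmetric] scaleC_add_left[symmetric])
    then have "g c \<le> g d + \<nu> (\<Sum>b\<in>B. (c b - d b) *\<^sub>C b)"
      unfolding g_def using norm_onD(3)[OF \<nu> inS inS, of d "\<lambda>b. c b - d b"] by simp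
    also have "\<nu> (\<Sum>b\<in>B. (c b - d b) *\<^sub>C b) \<le> (\<Sum>b\<in>B. \<nu> ((c b - d b) *\<^sub>C b))"
      by (rule seminorm_sum_le[OF cv.subspace_span[of B]])
        (simp_all add: cv.span_scale cv.span_base B \<nu>0 norm_onD(3)[OF \<nu>])
    also have "\<dots> = (\<Sum>b\<in>B. cmod (c b - d b) * \<nu> b)"
      by (auto intro!: sum.cong norm_onD(4)[OF \<nu>] cv.span_base)
    finally show ?thesis by simp
  qed
  have "compact {c :: 'a \<Rightarrow> complex. \<forall>b. c b \<in> (if b \<in> B then cball 0 1 else {0})}"
  proof -
    have "compactin (product_topology (\<lambda>b. euclidean) UNIV)
        (PiE UNIV (\<lambda>b. if b \<in> B then cball 0 1 else {0} :: complex set))"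
      by (subst compactin_PiE) auto
    then show ?thesis by (simp add: euclidean_product_topology PiE_UNIV_domain Pi_def)
  qed
  moreover have cl: "continuous_on UNIV l"
    unfolding l_def by (auto intro!: continuous_intros simp: continuous_on_product_coordinates)
  then have "closed {c. l c = 1}"
    using closed_Collect_eq[of l "\<lambda>_. 1"] continuous_on_const by blast
  ultimately have K: "compact K" unfolding K_def by (rule compact_Int_closed)
  have gcont: "continuous_on K g"
    unfolding continuous_on_def
  proof
    fix d assume "d \<in> K"
    have "continuous_on K (\<lambda>c. \<Sum>b\<in>B. cmod (c b - d b) * \<nu> b)"
      by (auto intro!: continuous_intros continuous_on_subset[OF continuous_on_product_coordinates])
    then have "((\<lambda>c. \<Sum>b\<in>B. cmod (c b - d b) * \<nu> b) \<longlongrightarrow> (\<Sum>b\<in>B. cmod (d b - d b) * \<nu> b)) (at d within K)"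
      using \<open>d \<in> K\<close> by (auto simp: continuous_on_def)
    then have lim: "((\<lambda>c. \<Sum>b\<in>B. cmod (c b - d b) * \<nu> b) \<longlongrightarrow> 0) (at d within K)" by simp
    have "norm (g c - g d) \<le> (\<Sum>b\<in>B. cmod (c b - d b) * \<nu> b)" for c
      using g_diff[of c d] g_diff[of d c] by (simp add: norm_minus_commute)
    then have "((\<lambda>c. g c - g d) \<longlongrightarrow> 0) (at d within K)"
      by (intro Lim_null_comparison[OF _ lim]) auto
    then show "(g \<longlongrightarrow> g d) (at d within K)" using LIM_zero_cancel by blast
  qed
  show thesis
  proof (cases "B = {}")
    case True
    then show thesis using that[of 0] by simp
  next
    case False
    then obtain b0 where b0: "b0 \<in> B" by blast
    have "(\<lambda>b. if b = b0 then 1 else 0) \<in> K"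
      using b0 B by (auto simp: K_def l_def if_distrib[of cmod] cong: if_cong)
    then have "K \<noteq> {}" by blast
    then obtain d where d: "d \<in> K" "\<And>c. c \<in> K \<Longrightarrow> g d \<le> g c"
      using continuous_attains_inf[OF K _ gcont] by blast
    have "g d \<noteq> 0"
    proof
      assume "g d = 0"
      then have "(\<Sum>b\<in>B. d b *\<^sub>C b) = 0" using norm_onD(2)[OF \<nu> inS] by (simp add: g_def)
      then have "\<forall>b\<in>B. d b = 0" using B cv.dependent_finite by blast
      then show False using d(1) by (simp add: K_def l_def)
    qed
    then have gd: "0 < g d" using norm_onD(1)[OF \<nu> inS, of d] by (simp add: g_def)
    have main: "l c * g d \<le> g c" if c0: "\<And>b. b \<notin> B \<Longrightarrow> c b = 0" for c
    proof (cases "l c = 0")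
      case True
      then show ?thesis using norm_onD(1)[OF \<nu> inS] by (simp add: g_def)
    next
      case False
      then have lc: "0 < l c" by (simp add: l_def less_le sum_nonneg)
      let ?c = "\<lambda>b. c b / of_real (l c)"
      have "cmod (c b) \<le> l c" if "b \<in> B" for b
        unfolding l_def by (rule member_le_sum[OF that]) (auto simp: B)
      moreover have "l (\<lambda>b. c b / of_real r) = l c / \<bar>r\<bar>" for r
        by (simp add: l_def norm_divide sum_divide_distrib)
      then have "l ?c = 1" using lc by simp
      ultimately have "?c \<in> K" using c0 lc by (auto simp: K_def norm_divide)
      then have "g d \<le> g ?c" by (rule d)
      also have "g ?c = \<nu> ((1 / of_real (l c)) *\<^sub>C (\<Sum>b\<in>B. c b *\<^sub>C b))"
        by (simp add: g_def cv.scale_sum_right scaleC_scaleC)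
      also have "\<dots> = g c / l c"
        using norm_onD(4)[OF \<nu> inS] lc by (simp add: g_def norm_divide)
      finally show ?thesis using lc by (simp add: field_simps)
    qed
    show thesis
    proof (rule that)
      fix x assume x: "x \<in> cv.span B"
      have "l (cv.representation B x) * g d \<le> g (cv.representation B x)"
        by (rule main) (use cv.representation_ne_zero in blast)
      also have "g (cv.representation B x) = \<nu> x"
        by (simp add: g_def cv.sum_representation_eq[OF B(2) x B(1)])
      finally show "(\<Sum>b\<in>B. cmod (cv.representation B x b)) \<le> (1 / g d) * \<nu> x"
        using gd by (simp add: l_def field_simps)
    qed (use gd in simp)
  qed
qed

text \<open>The values of \<open>s\<close> on a basis, weighted by the coordinates, which
  \<open>\<nu>\<close> controls, bound \<open>s\<close>. The constant depends on the basis and has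
  no value in itself; it is mainly the input to \<open>star_semigroup_norm_le\<close>, which removes
  it.\<close>

lemma seminorm_bound:
  assumes V: "fin_dim V" "norm_on V \<nu>"
    and s: "\<And>x y. x \<in> V \<Longrightarrow> y \<in> V \<Longrightarrow> s (x + y) \<le> s x + s y"
      "\<And>c x. x \<in> V \<Longrightarrow> s (c *\<^sub>C x) = cmod c * s x"
  obtains C :: real where "0 \<le> C" "\<And>x. x \<in> V \<Longrightarrow> s x \<le> C * \<nu> x"
proof -
  obtain B where B: "finite B" "cv.independent B" "cv.span B = V"
    using fin_dim_basis[OF V(1)] .
  obtain C where C: "0 \<le> C" "\<And>x. x \<in> V \<Longrightarrow> (\<Sum>b\<in>B. cmod (cv.representation B x b)) \<le> C * \<nu> x"
    using coordinates_bound[OF B(1,2)] V(2) B(3) by metis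
  have sub: "cv.subspace V" using V(1) by (simp add: fin_dim_def)
  have s0: "s 0 = 0" using s(2)[of 0 0] cv.subspace_0[OF sub] by simp
  have BV: "b \<in> V" if "b \<in> B" for b using B(3) that cv.span_base by blast
  define M where "M = (\<Sum>b\<in>B. \<bar>s b\<bar>)"
  have M: "0 \<le> M" "s b \<le> M" if "b \<in> B" for b
    using member_le_sum[OF that, of "\<lambda>b. \<bar>s b\<bar>"] B(1) by (auto simp: M_def sum_nonneg)
  have "0 \<le> M" by (simp add: M_def sum_nonneg)
  show thesis
  proof (rule that)
    fix x assume x: "x \<in> V"
    let ?r = "cv.representation B x"
    have "s x = s (\<Sum>b\<in>B. ?r b *\<^sub>C b)"
      using cv.sum_representation_eq[OF B(2) _ B(1), of x] x B(3) by simp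
    also have "\<dots> \<le> (\<Sum>b\<in>B. s (?r b *\<^sub>C b))"
      by (rule seminorm_sum_le[OF sub B(1)]) (auto intro: cv.subspace_scale[OF sub] BV s s0)
    also have "\<dots> \<le> (\<Sum>b\<in>B. cmod (?r b) * M)"
      by (rule sum_mono) (auto simp: s(2) BV intro!: mult_left_mono M)
    also have "\<dots> \<le> M * (C * \<nu> x)"
      using mult_left_mono[OF C(2)[OF x] \<open>0 \<le> M\<close>] by (simp add: sum_distrib_left mult.commute)
    finally show "s x \<le> (M * C) * \<nu> x" by (simp add: mult.assoc)
  qed (use \<open>0 \<le> M\<close> C in simp)
qed

lemma norm_on_diff:
  assumes "norm_on V \<nu>" "cv.subspace V" "x \<in> V" "y \<in> V"
  shows "\<nu> (x - y) \<le> \<nu> x + \<nu> y" "\<nu> (x - y) = \<nu> (y - x)"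
proof -
  have m: "- z \<in> V \<and> \<nu> (- z) = \<nu> z" if "z \<in> V" for z
    using norm_onD(4)[OF assms(1) that, of "-1"] assms(2) that by (simp add: scaleC_minus1 cv.subspace_neg)
  show "\<nu> (x - y) \<le> \<nu> x + \<nu> y"
    using norm_onD(3)[OF assms(1,3), of "- y"] m[OF assms(4)] by simp
  show "\<nu> (x - y) = \<nu> (y - x)"
    using m[of "x - y"] assms cv.subspace_diff by fastforce
qed

text \<open>Needed for the completeness clause of \<open>operator_space\<close>. A Cauchy sequence
  has Cauchy coordinates, and the vector with the limiting coordinates is its limit.\<close>

lemma mcomplete_fin_dim:
  assumes V: "fin_dim (UNIV :: 'a::complex_vector set)" "norm_on UNIV (\<nu> :: 'a \<Rightarrow> real)"
  shows "Metric_space.mcomplete UNIV (\<lambda>a b. \<nu> (a - b))"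
proof -
  interpret Metric_space UNIV "\<lambda>a b. \<nu> (a - b)"
  proof
    fix x y z :: 'a
    show "0 \<le> \<nu> (x - y)" using norm_onD(1)[OF V(2)] by simp
    show "\<nu> (x - y) = \<nu> (y - x)" using norm_on_diff[OF V(2)] by (simp add: cv.subspace_UNIV)
    show "\<nu> (x - y) = 0 \<longleftrightarrow> x = y" using norm_onD(2)[OF V(2)] by simp
    show "\<nu> (x - z) \<le> \<nu> (x - y) + \<nu> (y - z)"
      using norm_onD(3)[OF V(2), of "x - y" "y - z"] by simp
  qed
  obtain B where B: "finite B" "cv.independent B" "cv.span B = (UNIV :: 'a set)"
    using fin_dim_basis[OF V(1)] .
  obtain C where C: "0 \<le> C" "\<And>x. (\<Sum>b\<in>B. cmod (cv.representation B x b)) \<le> C * \<nu> x"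
    using coordinates_bound[OF B(1,2)] V(2) B(3) by (metis UNIV_I)
  show ?thesis
    unfolding mcomplete_def
  proof safe
    fix \<sigma> assume \<sigma>: "MCauchy \<sigma>"
    have bound: "cmod (cv.representation B x b - cv.representation B y b) \<le> C * \<nu> (x - y)" if "b \<in> B" for x y b
    proof -
      have "cv.representation B (x - y) b = cv.representation B x b - cv.representation B y b"
        using cv.representation_diff[OF B(2)] B(3) by simp
      then show ?thesis
        using member_le_sum[OF that, of "\<lambda>b. cmod (cv.representation B (x - y) b)"] B(1) C(2)[of "x - y"]
        by (simp add: norm_minus_commute)
    qed
    have "\<exists>l. (\<lambda>n. cv.representation B (\<sigma> n) b) \<longlonglongrightarrow> l" if b: "b \<in> B" for b
    proof -
      have "Cauchy (\<lambda>n. cv.representation B (\<sigma> n) b)"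
      proof (rule metric_CauchyI)
        fix \<epsilon> :: real assume "0 < \<epsilon>"
        \<comment> \<open>The denominator is \<open>C + 1\<close> because \<open>C\<close> is only
          known to be nonnegative.\<close>
        then have "0 < \<epsilon> / (C + 1)" using C(1) by simp
        then obtain N where N: "\<And>n m. N \<le> n \<Longrightarrow> N \<le> m \<Longrightarrow> \<nu> (\<sigma> n - \<sigma> m) < \<epsilon> / (C + 1)"
          using \<sigma> unfolding MCauchy_def by blast
        show "\<exists>M. \<forall>m\<ge>M. \<forall>n\<ge>M. dist (cv.representation B (\<sigma> m) b) (cv.representation B (\<sigma> n) b) < \<epsilon>"
        proof (intro exI allI impI)
          fix m n assume "N \<le> m" "N \<le> n"
          then have "\<nu> (\<sigma> m - \<sigma> n) < \<epsilon> / (C + 1)" by (rule N)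
          then have "C * \<nu> (\<sigma> m - \<sigma> n) + \<nu> (\<sigma> m - \<sigma> n) < \<epsilon>" using C(1) by (simp add: field_simps)
          then have "C * \<nu> (\<sigma> m - \<sigma> n) < \<epsilon>"
            using norm_onD(1)[OF V(2) UNIV_I, of "\<sigma> m - \<sigma> n"] by linarith
          then show "dist (cv.representation B (\<sigma> m) b) (cv.representation B (\<sigma> n) b) < \<epsilon>"
            using bound[OF b, of "\<sigma> m" "\<sigma> n"] by (simp add: dist_norm)
        qed
      qed
      then show ?thesis using Cauchy_convergent_iff convergent_def by blast
    qed
    then obtain l where l: "\<And>b. b \<in> B \<Longrightarrow> (\<lambda>n. cv.representation B (\<sigma> n) b) \<longlonglongrightarrow> l b" by metis
    let ?L = "\<Sum>b\<in>B. l b *\<^sub>C b"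
    have le: "\<nu> (\<sigma> n - ?L) \<le> (\<Sum>b\<in>B. cmod (cv.representation B (\<sigma> n) b - l b) * \<nu> b)" for n
    proof -
      have "\<sigma> n - ?L = (\<Sum>b\<in>B. (cv.representation B (\<sigma> n) b - l b) *\<^sub>C b)"
        using cv.sum_representation_eq[OF B(2) _ B(1), of "\<sigma> n"] B(3)
        by (simp add: cv.scale_left_diff_distrib sum_subtractf)
      moreover have "\<nu> (\<Sum>b\<in>B. (cv.representation B (\<sigma> n) b - l b) *\<^sub>C b)
          \<le> (\<Sum>b\<in>B. \<nu> ((cv.representation B (\<sigma> n) b - l b) *\<^sub>C b))"
        by (rule seminorm_sum_le[OF cv.subspace_UNIV]) (use B(1) norm_onD[OF V(2)] in auto)
      ultimately show ?thesis using norm_onD(4)[OF V(2)] by simp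
    qed
    have "(\<lambda>n. \<Sum>b\<in>B. cmod (cv.representation B (\<sigma> n) b - l b) * \<nu> b) \<longlonglongrightarrow> (\<Sum>b\<in>B. cmod (l b - l b) * \<nu> b)"
      by (intro tendsto_intros l)
    then have "(\<lambda>n. \<nu> (\<sigma> n - ?L)) \<longlonglongrightarrow> 0"
      by (intro Lim_null_comparison[OF always_eventually[rule_format], of "\<lambda>n. \<nu> (\<sigma> n - ?L)"]) (use le in auto)
    then show "\<exists>x. limitin mtopology \<sigma> x sequentially"
      by (auto simp: limit_metric_sequentially LIMSEQ_iff intro!: exI[of _ ?L])
  qed
qed

section \<open>Finite-dimensional star algebras\<close>

text \<open>The norm is kept apart from the algebra, since several norms on the same algebra are
  compared below.\<close>

locale star_alg =
  fixes V :: "'a::complex_vector set" and mul :: "'a \<Rightarrow> 'a \<Rightarrow> 'a" and e :: 'a and star :: "'a \<Rightarrow> 'a"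
  assumes fin_dim: "fin_dim V"
    and mul_closed [simp]: "a \<in> V \<Longrightarrow> b \<in> V \<Longrightarrow> mul a b \<in> V"
    and mul_add_left: "a \<in> V \<Longrightarrow> b \<in> V \<Longrightarrow> c \<in> V \<Longrightarrow> mul (a + b) c = mul a c + mul b c"
    and mul_add_right: "a \<in> V \<Longrightarrow> b \<in> V \<Longrightarrow> c \<in> V \<Longrightarrow> mul a (b + c) = mul a b + mul a c"
    and mul_scale_left: "a \<in> V \<Longrightarrow> b \<in> V \<Longrightarrow> mul (z *\<^sub>C a) b = z *\<^sub>C mul a b"
    and mul_scale_right: "a \<in> V \<Longrightarrow> b \<in> V \<Longrightarrow> mul a (z *\<^sub>C b) = z *\<^sub>C mul a b"
    and mul_assoc: "a \<in> V \<Longrightarrow> b \<in> V \<Longrightarrow> c \<in> V \<Longrightarrow> mul a (mul b c) = mul (mul a b) c"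
    and unit_closed [simp]: "e \<in> V"
    and unit_left [simp]: "a \<in> V \<Longrightarrow> mul e a = a"
    and unit_right [simp]: "a \<in> V \<Longrightarrow> mul a e = a"
    and star_closed [simp]: "a \<in> V \<Longrightarrow> star a \<in> V"
    and star_add: "a \<in> V \<Longrightarrow> b \<in> V \<Longrightarrow> star (a + b) = star a + star b"
    and star_scale: "a \<in> V \<Longrightarrow> star (z *\<^sub>C a) = cnj z *\<^sub>C star a"
    and star_star [simp]: "a \<in> V \<Longrightarrow> star (star a) = a"
    and star_mul: "a \<in> V \<Longrightarrow> b \<in> V \<Longrightarrow> star (mul a b) = mul (star b) (star a)"
begin

lemma subspace: "cv.subspace V"
  using fin_dim by (simp add: fin_dim_def)

lemma closed [simp]:
  "0 \<in> V" "a \<in> V \<Longrightarrow> b \<in> V \<Longrightarrow> a + b \<in> V" "a \<in> V \<Longrightarrow> z *\<^sub>C a \<in> V"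
  "a \<in> V \<Longrightarrow> b \<in> V \<Longrightarrow> a - b \<in> V" "a \<in> V \<Longrightarrow> - a \<in> V"
  using cv.subspace_0[OF subspace] cv.subspace_add[OF subspace] cv.subspace_scale[OF subspace]
    cv.subspace_diff[OF subspace] cv.subspace_neg[OF subspace]
  by auto

lemma sum_closed [simp]: "(\<And>i. i \<in> I \<Longrightarrow> f i \<in> V) \<Longrightarrow> sum f I \<in> V"
  by (rule cv.subspace_sum[OF subspace])

lemma mul_zero [simp]: "a \<in> V \<Longrightarrow> mul 0 a = 0" "a \<in> V \<Longrightarrow> mul a 0 = 0"
  using mul_scale_left[of 0 a 0] mul_scale_right[of a 0 0] by simp_all

lemma star_zero [simp]: "star 0 = 0"
  using star_scale[of 0 0] by simp

lemma mul_diff: "a \<in> V \<Longrightarrow> b \<in> V \<Longrightarrow> c \<in> V \<Longrightarrow> mul (a - b) c = mul a c - mul b c"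
  "a \<in> V \<Longrightarrow> b \<in> V \<Longrightarrow> c \<in> V \<Longrightarrow> mul a (b - c) = mul a b - mul a c"
  using mul_add_left[of "a - b" b c] mul_add_right[of a "b - c" c] by (simp_all add: algebra_simps)

lemma star_diff: "a \<in> V \<Longrightarrow> b \<in> V \<Longrightarrow> star (a - b) = star a - star b"
  using star_add[of "a - b" b] by (simp add: algebra_simps)

lemma star_unit [simp]: "star e = e"
  using star_mul[of "star e" e] by simp

lemma mul_sum_left: "finite I \<Longrightarrow> (\<And>i. i \<in> I \<Longrightarrow> f i \<in> V) \<Longrightarrow> a \<in> V \<Longrightarrow> mul (sum f I) a = (\<Sum>i\<in>I. mul (f i) a)"
  by (induction I rule: finite_induct) (simp_all add: mul_add_left)

lemma mul_sum_right: "finite I \<Longrightarrow> (\<And>i. i \<in> I \<Longrightarrow> f i \<in> V) \<Longrightarrow> a \<in> V \<Longrightarrow> mul a (sum f I) = (\<Sum>i\<in>I. mul a (f i))"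
  by (induction I rule: finite_induct) (simp_all add: mul_add_right)

lemma star_sum: "finite I \<Longrightarrow> (\<And>i. i \<in> I \<Longrightarrow> f i \<in> V) \<Longrightarrow> star (sum f I) = (\<Sum>i\<in>I. star (f i))"
  by (induction I rule: finite_induct) (simp_all add: star_add)

lemma cartesian_decomposition:
  assumes "a \<in> V"
  obtains h k where "h \<in> V" "k \<in> V" "star h = h" "star k = k" "a = h + \<i> *\<^sub>C k" "star a = h - \<i> *\<^sub>C k"
proof
  let ?h = "(1/2) *\<^sub>C (a + star a)" and ?k = "(-\<i>/2) *\<^sub>C (a - star a)"
  show "?h \<in> V" "?k \<in> V" using assms by simp_all
  show "star ?h = ?h" using assms by (simp add: star_scale star_add add.commute)
  show "star ?k = ?k"
    using assms by (simp add: star_scale star_diff cv.scale_right_diff_distrib cv.scale_minus_left)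
  have half: "(1/2) *\<^sub>C x + (1/2) *\<^sub>C x = x" for x :: 'a
    by (simp add: scaleC_add_left[symmetric] scaleC_one)
  show "a = ?h + \<i> *\<^sub>C ?k"
    using half[of a] by (simp add: scaleC_scaleC scaleC_add_right cv.scale_right_diff_distrib)
  show "star a = ?h - \<i> *\<^sub>C ?k"
    using half[of "star a"] by (simp add: scaleC_scaleC scaleC_add_right cv.scale_right_diff_distrib)
qed

end

locale cstar_alg = star_alg V mul e star
  for V :: "'a::complex_vector set" and mul e star +
  fixes \<nu> :: "'a \<Rightarrow> real"
  assumes norm: "norm_on V \<nu>"
    and norm_mul: "a \<in> V \<Longrightarrow> b \<in> V \<Longrightarrow> \<nu> (mul a b) \<le> \<nu> a * \<nu> b"
    and norm_star_mul: "a \<in> V \<Longrightarrow> \<nu> (mul (star a) a) = (\<nu> a)\<^sup>2"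

lemma vN_algebra_on_iff: "vN_algebra_on V mul e star \<nu> \<longleftrightarrow> cstar_alg V mul e star \<nu>"
  unfolding vN_algebra_on_def cstar_alg_def cstar_alg_axioms_def star_alg_def Ball_def
  by (rule iffI; elim conjE; intro conjI allI impI; simp)

context cstar_alg
begin

lemma norm_nonneg [simp]: "a \<in> V \<Longrightarrow> 0 \<le> \<nu> a"
  and norm_eq_0 [simp]: "a \<in> V \<Longrightarrow> \<nu> a = 0 \<longleftrightarrow> a = 0"
  and norm_add: "a \<in> V \<Longrightarrow> b \<in> V \<Longrightarrow> \<nu> (a + b) \<le> \<nu> a + \<nu> b"
  and norm_scale: "a \<in> V \<Longrightarrow> \<nu> (z *\<^sub>C a) = cmod z * \<nu> a"
  using norm_onD[OF norm] by auto

lemma star_mul_eq_0: "a \<in> V \<Longrightarrow> mul (star a) a = 0 \<longleftrightarrow> a = 0"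
  by (metis norm_eq_0 mul_closed star_closed norm_star_mul zero_eq_power2)

text \<open>The C*-identity and submultiplicativity give
  \<open>\<nu> b * \<nu> b \<le> \<nu> (star b) * \<nu> b\<close>; cancel, and exchange
  \<open>b\<close> with its adjoint.\<close>

lemma norm_star [simp]:
  assumes "a \<in> V" shows "\<nu> (star a) = \<nu> a"
proof -
  have "\<nu> b \<le> \<nu> (star b)" if "b \<in> V" for b
  proof (cases "b = 0")
    case False
    then have "0 < \<nu> b" using that by (simp add: less_le)
    moreover have "\<nu> b * \<nu> b \<le> \<nu> (star b) * \<nu> b"
      using norm_mul[of "star b" b] norm_star_mul[OF that] that by (simp add: power2_eq_square)
    ultimately show ?thesis by simp
  qed simp
  from this[of a] this[of "star a"] assms show ?thesis by simp
qed

text \<open>The norm equals its own square. Only an inequality holds in general, because the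
  projection may be \<open>0\<close>; even the unit is \<open>0\<close> in the zero algebra, for
  instance for \<open>0 \<times> 0\<close> matrices.\<close>

lemma norm_projection_le_1:
  assumes "p \<in> V" "star p = p" "mul p p = p" shows "\<nu> p \<le> 1"
proof -
  have "\<nu> p = (\<nu> p)\<^sup>2" using norm_star_mul[OF assms(1)] assms by simp
  then have "\<nu> p = 0 \<or> \<nu> p = 1" by (simp add: power2_eq_square)
  then show ?thesis by auto
qed

lemma norm_unit_le_1: "\<nu> e \<le> 1"
  by (rule norm_projection_le_1) simp_all

end

text \<open>Iterating \<open>h \<mapsto> h\<^sup>* h\<close> turns a bound up to a constant into a bound.\<close>

lemma star_semigroup_norm_le:
  fixes s \<nu> :: "'d \<Rightarrow> real"
  assumes clos: "\<And>x y. x \<in> D \<Longrightarrow> y \<in> D \<Longrightarrow> mul x y \<in> D" "\<And>x. x \<in> D \<Longrightarrow> star x \<in> D"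
    and s: "\<And>x. x \<in> D \<Longrightarrow> s (mul (star x) x) = (s x)\<^sup>2"
    and nn: "\<And>x. x \<in> D \<Longrightarrow> 0 \<le> \<nu> x"
    and mul: "\<And>x y. x \<in> D \<Longrightarrow> y \<in> D \<Longrightarrow> \<nu> (mul x y) \<le> \<nu> x * \<nu> y"
    and star: "\<And>x. x \<in> D \<Longrightarrow> \<nu> (star x) \<le> \<nu> x"
    and C: "\<And>x. x \<in> D \<Longrightarrow> s x \<le> C * \<nu> x"
    and x: "x \<in> D"
  shows "s x \<le> \<nu> x"
proof (rule ccontr)
  assume "\<not> s x \<le> \<nu> x"
  then have lt: "\<nu> x < s x" by simp
  define f where "f h = mul (star h) h" for h
  have it: "(f ^^ k) x \<in> D \<and> s ((f ^^ k) x) = s x ^ (2 ^ k) \<and> \<nu> ((f ^^ k) x) \<le> \<nu> x ^ (2 ^ k)" for k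
  proof (induction k)
    case (Suc k)
    let ?y = "(f ^^ k) x"
    have y: "?y \<in> D" using Suc by simp
    have "\<nu> (f ?y) \<le> \<nu> ?y * \<nu> ?y"
      using mul[OF clos(2)[OF y] y] mult_right_mono[OF star[OF y] nn[OF y]] f_def[of ?y] by simp
    also have "\<dots> \<le> \<nu> x ^ (2 ^ k) * \<nu> x ^ (2 ^ k)"
      using Suc nn[OF y] nn[OF x] by (intro mult_mono) auto
    finally show ?case
      using s[OF y] clos(1)[OF clos(2)[OF y] y] Suc f_def[of ?y]
      by (simp add: power_add power2_eq_square mult_2)
  qed (use x in simp)
  have sx: "0 < s x" using lt nn[OF x] by linarith
  define r where "r = \<nu> x / s x"
  have r: "0 \<le> r" "r < 1" using lt nn[OF x] sx by (simp_all add: r_def)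
  have C1: "1 \<le> C * r ^ (2 ^ k)" for k
  proof -
    have C0: "0 \<le> C"
    proof (rule ccontr)
      assume "\<not> 0 \<le> C"
      then have "C * \<nu> x \<le> 0" using nn[OF x] by (simp add: mult_nonpos_nonneg)
      then show False using C[OF x] sx by linarith
    qed
    have "s x ^ (2 ^ k) \<le> C * \<nu> ((f ^^ k) x)" using C it by metis
    also have "\<dots> \<le> C * \<nu> x ^ (2 ^ k)" using it C0 by (simp add: mult_left_mono)
    finally show ?thesis using sx by (simp add: r_def power_divide field_simps)
  qed
  have "(\<lambda>k. r ^ (2 ^ k)) \<longlonglongrightarrow> 0"
    using LIMSEQ_subseq_LIMSEQ[OF LIMSEQ_realpow_zero[OF r], of "\<lambda>k. 2 ^ k"] by (simp add: strict_mono_def o_def)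
  then have "(\<lambda>k. C * r ^ (2 ^ k)) \<longlonglongrightarrow> C * 0" by (intro tendsto_intros)
  then have "1 \<le> C * 0" by (rule LIMSEQ_le_const) (use C1 in auto)
  then show False by simp
qed

text \<open>Meant for \<open>s\<close> the pullback of a C*-norm along a star homomorphism: finite
  dimension supplies some constant and the iteration removes it. This is the form in which star
  homomorphisms are shown to be contractive.\<close>

lemma (in cstar_alg) cstar_seminorm_le:
  assumes add: "\<And>x y. x \<in> V \<Longrightarrow> y \<in> V \<Longrightarrow> s (x + y) \<le> s x + s y"
    and scale: "\<And>c x. x \<in> V \<Longrightarrow> s (c *\<^sub>C x) = cmod c * s x"
    and cs: "\<And>x. x \<in> V \<Longrightarrow> s (mul (star x) x) = (s x)\<^sup>2"
    and x: "x \<in> V"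
  shows "s x \<le> \<nu> x"
proof -
  obtain C where C: "0 \<le> C" "\<And>x. x \<in> V \<Longrightarrow> s x \<le> C * \<nu> x"
    using seminorm_bound[OF fin_dim norm add scale] by metis
  show ?thesis
    by (rule star_semigroup_norm_le[where D = V and mul = mul and star = star and C = C])
      (use cs x C in \<open>simp_all add: norm_mul\<close>)
qed

lemma cstar_norm_unique:
  assumes "cstar_alg V mul e star \<nu>" "cstar_alg V mul e star \<nu>'" "x \<in> V"
  shows "\<nu> x = \<nu>' x"
proof -
  interpret A: cstar_alg V mul e star \<nu> by fact
  interpret B: cstar_alg V mul e star \<nu>' by fact
  show ?thesis
    using A.cstar_seminorm_le[of \<nu>' x] B.cstar_seminorm_le[of \<nu> x] assms(3)
    by (simp add: A.norm_add B.norm_add A.norm_scale B.norm_scale A.norm_star_mul B.norm_star_mul)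
qed

section \<open>Spectral decomposition of self-adjoint elements\<close>

context star_alg
begin

text \<open>The vector \<open>p(h) x\<close>, with \<open>h\<close> acting by left multiplication.
  Spectral theory is done on vectors; the projections are obtained at the end from
  \<open>x = e\<close>.\<close>

definition poly_act :: "complex poly \<Rightarrow> 'a \<Rightarrow> 'a \<Rightarrow> 'a"
  where "poly_act p h x = (\<Sum>k\<le>degree p. coeff p k *\<^sub>C (mul h ^^ k) x)"

lemma mul_pow_closed [simp]: "h \<in> V \<Longrightarrow> x \<in> V \<Longrightarrow> (mul h ^^ k) x \<in> V"
  by (induction k) auto

lemma mul_pow_linear:
  assumes "h \<in> V" "x \<in> V" "y \<in> V"
  shows "(mul h ^^ k) (x - z *\<^sub>C y) = (mul h ^^ k) x - z *\<^sub>C (mul h ^^ k) y"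
  by (induction k) (use assms in \<open>simp_all add: mul_diff mul_scale_right\<close>)

text \<open>Serves to split off one root at a time: an index shift in the coefficients of
  \<open>(X - z) q\<close> lets \<open>h - z\<close> act first and \<open>q(h)\<close> after
  it.\<close>

lemma poly_act_root_factor:
  assumes "h \<in> V" "x \<in> V" "q \<noteq> 0"
  shows "poly_act ([:- z, 1:] * q) h x = poly_act q h (mul h x - z *\<^sub>C x)"
proof -
  let ?n = "degree q"
  have co: "coeff ([:- z, 1:] * q) k = (case k of 0 \<Rightarrow> 0 | Suc j \<Rightarrow> coeff q j) - z * coeff q k" for k
    by (cases k) simp_all
  have deg: "degree ([:- z, 1:] * q) = Suc ?n"
    using assms(3) by (subst degree_mult_eq) auto
  have "poly_act q h (mul h x - z *\<^sub>C x)
      = (\<Sum>k\<le>?n. coeff q k *\<^sub>C (mul h ^^ Suc k) x) - (\<Sum>k\<le>?n. (z * coeff q k) *\<^sub>C (mul h ^^ k) x)"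
    using assms by (simp add: poly_act_def mul_pow_linear funpow_swap1 cv.scale_right_diff_distrib
        sum_subtractf scaleC_scaleC mult.commute)
  also have "(\<Sum>k\<le>?n. (z * coeff q k) *\<^sub>C (mul h ^^ k) x) = (\<Sum>k\<le>Suc ?n. (z * coeff q k) *\<^sub>C (mul h ^^ k) x)"
    by (simp add: coeff_eq_0)
  also have "(\<Sum>k\<le>?n. coeff q k *\<^sub>C (mul h ^^ Suc k) x)
      = (\<Sum>k\<le>Suc ?n. (case k of 0 \<Rightarrow> 0 | Suc j \<Rightarrow> coeff q j) *\<^sub>C (mul h ^^ k) x)"
    by (simp only: sum.atMost_Suc_shift) simp
  finally show ?thesis
    unfolding poly_act_def deg co by (simp only: cv.scale_left_diff_distrib sum_subtractf)
qed

text \<open>Among \<open>card B + 1\<close> iterates of \<open>x\<close> there is a linear relation.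
  Dependence is a notion about sets of vectors, so two coinciding iterates, whose difference is
  already such a relation, form a case of their own.\<close>

lemma annihilating_poly:
  assumes "h \<in> V" "x \<in> V"
  obtains p where "p \<noteq> 0" "poly_act p h x = 0"
proof -
  obtain B where B: "finite B" "cv.span B = V" using fin_dim by (auto simp: fin_dim_def)
  let ?f = "\<lambda>k. (mul h ^^ k) x" and ?n = "card B"
  have "\<exists>c. (\<exists>k\<le>?n. c k \<noteq> 0) \<and> (\<Sum>k\<le>?n. c k *\<^sub>C ?f k) = 0"
  proof (cases "inj_on ?f {..?n}")
    case True
    have "\<not> card (?f ` {..?n}) \<le> card B" using True by (simp add: card_image)
    moreover have "?f ` {..?n} \<subseteq> V" using assms by auto
    then have "?f ` {..?n} \<subseteq> cv.span B" unfolding B(2) .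
    ultimately have "cv.dependent (?f ` {..?n})"
      using cv.independent_span_bound[OF B(1)] by blast
    then obtain u where u: "\<exists>v\<in>?f ` {..?n}. u v \<noteq> 0" "(\<Sum>v\<in>?f ` {..?n}. u v *\<^sub>C v) = 0"
      using cv.dependent_finite[of "?f ` {..?n}"] by auto
    then show ?thesis
      by (intro exI[of _ "\<lambda>k. u (?f k)"]) (auto simp: sum.reindex[OF True])
  next
    case False
    then obtain i j where ij: "i \<le> ?n" "j \<le> ?n" "i \<noteq> j" "?f i = ?f j" by (auto simp: inj_on_def)
    let ?c = "\<lambda>k. if k = i then 1 else if k = j then -1 else (0::complex)"
    have "(\<Sum>k\<le>?n. ?c k *\<^sub>C ?f k) = (\<Sum>k\<in>{i,j}. ?c k *\<^sub>C ?f k)"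
      by (rule sum.mono_neutral_right) (use ij in auto)
    also have "\<dots> = 0" using ij by (simp add: scaleC_one scaleC_minus1)
    finally show ?thesis using ij(1) by (intro exI[of _ ?c]) auto
  qed
  then obtain c k where c: "k \<le> ?n" "c k \<noteq> 0" "(\<Sum>k\<le>?n. c k *\<^sub>C ?f k) = 0" by blast
  define p where "p = Poly (map c [0..<Suc ?n])"
  have co: "coeff p k = (if k \<le> ?n then c k else 0)" for k
    by (auto simp: p_def nth_default_def nth_append)
  have "p \<noteq> 0" using co[of k] c by auto
  moreover have "degree p \<le> ?n" by (rule degree_le) (simp add: co)
  then have "poly_act p h x = (\<Sum>k\<le>?n. coeff p k *\<^sub>C ?f k)"
    unfolding poly_act_def by (intro sum.mono_neutral_left) (auto simp: coeff_eq_0)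
  then have "poly_act p h x = 0" using c(3) by (simp add: co)
  ultimately show thesis by (rule that)
qed

end

context cstar_alg
begin

text \<open>Two effects of self-adjointness. An eigenvector \<open>y\<close> for a non-real
  \<open>z\<close> satisfies \<open>z y\<^sup>* y = cnj z y\<^sup>* y\<close>, hence vanishes by the
  C*-identity. For real \<open>z\<close> there are no proper generalized eigenvectors:
  \<open>y = (h - z) x\<close> with \<open>(h - z) y = 0\<close> gives
  \<open>y\<^sup>* y = x\<^sup>* (h - z) y = 0\<close>.\<close>

lemma self_adjoint_eigen_aux:
  assumes h: "h \<in> V" "star h = h" and x: "x \<in> V" "mul h (mul h x - z *\<^sub>C x) = z *\<^sub>C (mul h x - z *\<^sub>C x)"
  shows "mul h x = z *\<^sub>C x" "z \<notin> \<real> \<Longrightarrow> x = 0"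
proof -
  have nonreal: "y = 0" if "y \<in> V" "mul h y = z *\<^sub>C y" "z \<notin> \<real>" for y
  proof -
    have "z *\<^sub>C mul (star y) y = mul (star y) (mul h y)" using that by (simp add: mul_scale_right)
    also have "\<dots> = mul (star (mul h y)) y"
      using mul_assoc[of "star y" h y] star_mul[of h y] that(1) h by simp
    also have "\<dots> = cnj z *\<^sub>C mul (star y) y" using that by (simp add: star_scale mul_scale_left)
    finally have "(z - cnj z) *\<^sub>C mul (star y) y = 0" by (simp add: cv.scale_left_diff_distrib)
    moreover have "z - cnj z \<noteq> 0" using that(3) by (simp add: Reals_cnj_iff)
    ultimately show ?thesis using star_mul_eq_0[OF that(1)] by simp
  qed
  let ?y = "mul h x - z *\<^sub>C x"
  have y: "?y \<in> V" using h x by simp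
  show *: "mul h x = z *\<^sub>C x"
  proof (cases "z \<in> \<real>")
    case True
    then have "star ?y = mul (star x) h - z *\<^sub>C star x"
      using h x by (simp add: star_diff star_mul star_scale Reals_cnj_iff)
    then have "mul (star ?y) ?y = mul (mul (star x) h) ?y - z *\<^sub>C mul (star x) ?y"
      using h(1) x(1) y by (simp add: mul_diff(1)[of _ _ ?y] mul_scale_left)
    also have "mul (mul (star x) h) ?y = mul (star x) (mul h ?y)"
      using h(1) x(1) y by (simp add: mul_assoc)
    also note x(2)
    also have "mul (star x) (z *\<^sub>C ?y) - z *\<^sub>C mul (star x) ?y = 0"
      using x(1) y by (simp add: mul_scale_right)
    finally show ?thesis using star_mul_eq_0[OF y] by simp
  next
    case False
    then show ?thesis using nonreal[OF y x(2)] by simp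
  qed
  show "x = 0" if "z \<notin> \<real>" using nonreal[OF x(1) * that] .
qed

text \<open>By induction \<open>(h - z) x\<close> is a sum of eigenvectors. Its components for
  eigenvalues other than \<open>z\<close> can be divided by \<open>h - z\<close>; what remains of
  \<open>x\<close> after subtracting the quotients is a generalized eigenvector for
  \<open>z\<close>, hence an eigenvector.\<close>

lemma eigenvector_decomposition:
  assumes h: "h \<in> V" "star h = h"
  shows "degree p = n \<Longrightarrow> p \<noteq> 0 \<Longrightarrow> x \<in> V \<Longrightarrow> poly_act p h x = 0 \<Longrightarrow>
    \<exists>\<Lambda> y. finite \<Lambda> \<and> x = (\<Sum>t\<in>\<Lambda>. y t) \<and> (\<forall>t\<in>\<Lambda>. y t \<in> V \<and> mul h (y t) = of_real t *\<^sub>C y t)"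
proof (induction n arbitrary: p x)
  case 0
  then obtain c where "p = [:c:]" "c \<noteq> 0" by (metis degree_eq_zeroE pCons_0_0)
  then have "x = 0" using 0 by (simp add: poly_act_def)
  then show ?case by (intro exI[of _ "{}"]) simp
next
  case (Suc n)
  have "\<not> constant (poly p)" using Suc.prems(1) by (simp add: constant_degree)
  then obtain z where "poly p z = 0" using fundamental_theorem_of_algebra by blast
  then obtain q where q: "p = [:- z, 1:] * q" by (metis poly_eq_0_iff_dvd dvdE)
  have q0: "q \<noteq> 0" using q Suc.prems by auto
  have "degree p = degree [:- z, 1:] + degree q" unfolding q by (rule degree_mult_eq) (use q0 in auto)
  then have "degree q = n" using Suc.prems by simp
  moreover have "poly_act q h (mul h x - z *\<^sub>C x) = 0"
    using Suc.prems poly_act_root_factor[OF h(1) _ q0] by (simp add: q)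
  ultimately obtain \<Lambda> y where y: "finite \<Lambda>" "mul h x - z *\<^sub>C x = (\<Sum>t\<in>\<Lambda>. y t)"
      "\<And>t. t \<in> \<Lambda> \<Longrightarrow> y t \<in> V" "\<And>t. t \<in> \<Lambda> \<Longrightarrow> mul h (y t) = of_real t *\<^sub>C y t"
    using Suc.IH[OF _ q0, of "mul h x - z *\<^sub>C x"] Suc.prems h by auto
  define \<Lambda>' where "\<Lambda>' = {t \<in> \<Lambda>. of_real t \<noteq> z}"
  \<comment> \<open>On the eigenspace of \<open>t\<close> the operator \<open>h - z\<close> is the
    scalar \<open>t - z\<close>, so \<open>g t\<close> is the preimage of
    \<open>y t\<close>.\<close>
  define g where "g t = (1 / (of_real t - z)) *\<^sub>C y t" for t
  define u where "u = x - (\<Sum>t\<in>\<Lambda>'. g t)"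
  have fin': "finite \<Lambda>'" using y by (simp add: \<Lambda>'_def)
  have gV: "g t \<in> V" if "t \<in> \<Lambda>'" for t using that y by (simp add: g_def \<Lambda>'_def)
  have gh: "mul h (g t) - z *\<^sub>C g t = y t" if "t \<in> \<Lambda>'" for t
  proof -
    have "mul h (g t) - z *\<^sub>C g t = ((of_real t - z) * (1 / (of_real t - z))) *\<^sub>C y t"
      using that y h by (simp add: g_def \<Lambda>'_def mul_scale_right scaleC_scaleC cv.scale_left_diff_distrib[symmetric]
          diff_divide_distrib[symmetric])
    then show ?thesis using that by (simp add: \<Lambda>'_def scaleC_one)
  qed
  have gh': "mul h (g t) = of_real t *\<^sub>C g t" if "t \<in> \<Lambda>'" for t
    using that y h by (simp add: g_def \<Lambda>'_def mul_scale_right scaleC_scaleC mult.commute)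
  have uV: "u \<in> V" using Suc.prems gV by (simp add: u_def)
  have "mul h u - z *\<^sub>C u = (mul h x - z *\<^sub>C x) - (\<Sum>t\<in>\<Lambda>'. mul h (g t) - z *\<^sub>C g t)"
    using h gV Suc.prems fin' by (simp add: u_def mul_diff mul_sum_right cv.scale_right_diff_distrib
        cv.scale_sum_right sum_subtractf)
  also have "\<dots> = (\<Sum>t\<in>\<Lambda> - \<Lambda>'. y t)"
    using y(1,2) by (simp add: gh sum_diff \<Lambda>'_def)
  finally have hu: "mul h u - z *\<^sub>C u = (\<Sum>t\<in>\<Lambda> - \<Lambda>'. y t)" .
  \<comment> \<open>Only a component with eigenvalue \<open>z\<close> is left in the sum over
    \<open>\<Lambda> - \<Lambda>'\<close>.\<close>
  have "mul h (mul h u - z *\<^sub>C u) = z *\<^sub>C (mul h u - z *\<^sub>C u)"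
  proof -
    have "mul h (\<Sum>t\<in>\<Lambda> - \<Lambda>'. y t) = (\<Sum>t\<in>\<Lambda> - \<Lambda>'. mul h (y t))"
      by (rule mul_sum_right) (use y h in auto)
    also have "\<dots> = (\<Sum>t\<in>\<Lambda> - \<Lambda>'. z *\<^sub>C y t)"
      by (rule sum.cong) (use y in \<open>auto simp: \<Lambda>'_def\<close>)
    finally show ?thesis unfolding hu by (simp add: cv.scale_sum_right)
  qed
  from self_adjoint_eigen_aux[OF h uV this]
  have eig: "mul h u = z *\<^sub>C u" "z \<notin> \<real> \<Longrightarrow> u = 0" by auto
  have xu: "x = u + (\<Sum>t\<in>\<Lambda>'. g t)" by (simp add: u_def)
  show ?case
  proof (cases "z \<in> \<real>")
    case True
    then obtain r where r: "z = of_real r" by (auto simp: Reals_def)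
    then have "r \<notin> \<Lambda>'" by (simp add: \<Lambda>'_def)
    then show ?thesis
      using xu uV eig r gV gh' fin'
      by (intro exI[of _ "insert r \<Lambda>'"] exI[of _ "\<lambda>t. if t = r then u else g t"])
        (auto intro!: sum.cong)
  next
    case False
    then show ?thesis using xu eig gV gh' fin' by (intro exI[of _ \<Lambda>'] exI[of _ g]) auto
  qed
qed

text \<open>The eigencomponents of the unit are the spectral projections. Components for different
  eigenvalues are orthogonal, so multiplying \<open>e = \<Sum> P t\<close> by the adjoint of
  \<open>P t\<close> leaves \<open>star (P t) = mul (star (P t)) (P t)\<close>, whose right side is
  self-adjoint. The eigenvalues are bounded by \<open>\<nu> h\<close> because
  \<open>mul h (P t)\<close> is \<open>P t\<close> scaled by \<open>t\<close>.\<close>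

theorem spectral_decomposition:
  assumes h: "h \<in> V" "star h = h"
  obtains \<Lambda> P where "finite \<Lambda>" "\<And>t. t \<in> \<Lambda> \<Longrightarrow> P t \<in> V" "\<And>t. t \<in> \<Lambda> \<Longrightarrow> P t \<noteq> 0"
    "\<And>t. t \<in> \<Lambda> \<Longrightarrow> star (P t) = P t"
    "\<And>t u. t \<in> \<Lambda> \<Longrightarrow> u \<in> \<Lambda> \<Longrightarrow> mul (P t) (P u) = (if t = u then P t else 0)"
    "e = (\<Sum>t\<in>\<Lambda>. P t)" "h = (\<Sum>t\<in>\<Lambda>. of_real t *\<^sub>C P t)" "\<And>t. t \<in> \<Lambda> \<Longrightarrow> \<bar>t\<bar> \<le> \<nu> h"
proof -
  obtain p where "p \<noteq> 0" "poly_act p h e = 0" using annihilating_poly[OF h(1) unit_closed] .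
  then obtain \<Lambda>0 P where P0: "finite \<Lambda>0" "e = (\<Sum>t\<in>\<Lambda>0. P t)"
      "\<And>t. t \<in> \<Lambda>0 \<Longrightarrow> P t \<in> V" "\<And>t. t \<in> \<Lambda>0 \<Longrightarrow> mul h (P t) = of_real t *\<^sub>C P t"
    using eigenvector_decomposition[OF h HOL.refl _ unit_closed] by blast
  define \<Lambda> where "\<Lambda> = {t \<in> \<Lambda>0. P t \<noteq> 0}"
  have fin: "finite \<Lambda>" and PV: "\<And>t. t \<in> \<Lambda> \<Longrightarrow> P t \<in> V" and P0': "\<And>t. t \<in> \<Lambda> \<Longrightarrow> P t \<noteq> 0"
    and hP: "\<And>t. t \<in> \<Lambda> \<Longrightarrow> mul h (P t) = of_real t *\<^sub>C P t"
    using P0 by (auto simp: \<Lambda>_def)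
  have eP: "e = (\<Sum>t\<in>\<Lambda>. P t)"
    unfolding P0(2) by (rule sum.mono_neutral_right) (use P0 in \<open>auto simp: \<Lambda>_def\<close>)
  have orth: "mul (star (P t)) (P u) = 0" if tu: "t \<in> \<Lambda>" "u \<in> \<Lambda>" "t \<noteq> u" for t u
  proof -
    have "of_real u *\<^sub>C mul (star (P t)) (P u) = mul (star (P t)) (mul h (P u))"
      using tu PV hP by (simp add: mul_scale_right)
    also have "\<dots> = mul (star (mul h (P t))) (P u)" using tu PV h by (simp add: star_mul mul_assoc)
    also have "\<dots> = of_real t *\<^sub>C mul (star (P t)) (P u)"
      using tu PV hP by (simp add: star_scale mul_scale_left)
    finally have "(of_real u - of_real t) *\<^sub>C mul (star (P t)) (P u) = 0"
      by (simp add: cv.scale_left_diff_distrib)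
    moreover have "complex_of_real u - of_real t \<noteq> 0" using tu by simp
    ultimately show ?thesis by simp
  qed
  have sq: "star (P t) = mul (star (P t)) (P t)" if t: "t \<in> \<Lambda>" for t
  proof -
    have "star (P t) = mul (star (P t)) e" using t PV by simp
    also have "\<dots> = (\<Sum>u\<in>\<Lambda>. mul (star (P t)) (P u))"
      unfolding eP using t PV fin by (simp add: mul_sum_right)
    also have "\<dots> = (\<Sum>u\<in>\<Lambda>. if u = t then mul (star (P t)) (P t) else 0)"
      by (rule sum.cong) (use t orth in auto)
    finally show ?thesis using fin t by simp
  qed
  have sa: "star (P t) = P t" if t: "t \<in> \<Lambda>" for t
  proof -
    have "P t = star (star (P t))" using t PV by simp
    also have "\<dots> = star (mul (star (P t)) (P t))" using sq[OF t] by (rule arg_cong)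
    also have "\<dots> = mul (star (P t)) (P t)" using t PV by (simp add: star_mul)
    finally show ?thesis using sq[OF t] by simp
  qed
  show thesis
  proof (rule that[of \<Lambda> P])
    show "mul (P t) (P u) = (if t = u then P t else 0)" if "t \<in> \<Lambda>" "u \<in> \<Lambda>" for t u
      using orth[OF that] sq sa that by auto
    have "h = mul h e" using h by simp
    also have "\<dots> = (\<Sum>t\<in>\<Lambda>. mul h (P t))" unfolding eP using h PV fin by (simp add: mul_sum_right)
    finally show "h = (\<Sum>t\<in>\<Lambda>. of_real t *\<^sub>C P t)" using hP by simp
    show "\<bar>t\<bar> \<le> \<nu> h" if t: "t \<in> \<Lambda>" for t
    proof -
      have "\<bar>t\<bar> * \<nu> (P t) = \<nu> (mul h (P t))" using t hP PV by (simp add: norm_scale)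
      also have "\<dots> \<le> \<nu> h * \<nu> (P t)" using t PV h by (simp add: norm_mul)
      finally show ?thesis using PV[OF t] P0'[OF t] by (simp add: less_le)
    qed
  qed (use fin PV P0' sa eP in auto)
qed

end

section \<open>Operator norms are C*-norms\<close>

text \<open>Semidefinite, because vectors of \<open>\<complex>^n\<close> will be represented by
  arbitrary functions on the naturals, of which the form sees only the first \<open>n\<close>
  values.\<close>

locale semi_inner =
  fixes \<Xi> :: "'b::complex_vector set" and ip :: "'b \<Rightarrow> 'b \<Rightarrow> complex"
  assumes sub: "cv.subspace \<Xi>"
    and ip_add: "\<xi> \<in> \<Xi> \<Longrightarrow> \<eta> \<in> \<Xi> \<Longrightarrow> \<zeta> \<in> \<Xi> \<Longrightarrow> ip \<xi> (\<eta> + \<zeta>) = ip \<xi> \<eta> + ip \<xi> \<zeta>"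
    and ip_scale: "\<xi> \<in> \<Xi> \<Longrightarrow> \<eta> \<in> \<Xi> \<Longrightarrow> ip \<xi> (c *\<^sub>C \<eta>) = c * ip \<xi> \<eta>"
    and ip_cnj: "\<xi> \<in> \<Xi> \<Longrightarrow> \<eta> \<in> \<Xi> \<Longrightarrow> ip \<eta> \<xi> = cnj (ip \<xi> \<eta>)"
    and ip_ge0: "\<xi> \<in> \<Xi> \<Longrightarrow> 0 \<le> Re (ip \<xi> \<xi>)"
begin

definition nrm :: "'b \<Rightarrow> real" where "nrm \<xi> = sqrt (Re (ip \<xi> \<xi>))"

lemma closed_vec [simp]: "0 \<in> \<Xi>" "\<xi> \<in> \<Xi> \<Longrightarrow> \<eta> \<in> \<Xi> \<Longrightarrow> \<xi> + \<eta> \<in> \<Xi>" "\<xi> \<in> \<Xi> \<Longrightarrow> c *\<^sub>C \<xi> \<in> \<Xi>"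
  using cv.subspace_0[OF sub] cv.subspace_add[OF sub] cv.subspace_scale[OF sub] by auto

lemma ip_add_left: "\<xi> \<in> \<Xi> \<Longrightarrow> \<eta> \<in> \<Xi> \<Longrightarrow> \<zeta> \<in> \<Xi> \<Longrightarrow> ip (\<xi> + \<eta>) \<zeta> = ip \<xi> \<zeta> + ip \<eta> \<zeta>"
  using ip_cnj[of \<zeta> "\<xi> + \<eta>"] ip_cnj[of \<zeta> \<xi>] ip_cnj[of \<zeta> \<eta>] by (simp add: ip_add)

lemma ip_scale_left: "\<xi> \<in> \<Xi> \<Longrightarrow> \<eta> \<in> \<Xi> \<Longrightarrow> ip (c *\<^sub>C \<xi>) \<eta> = cnj c * ip \<xi> \<eta>"
  using ip_cnj[of \<eta> "c *\<^sub>C \<xi>"] ip_cnj[of \<eta> \<xi>] by (simp add: ip_scale)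

lemma ip_self: "\<xi> \<in> \<Xi> \<Longrightarrow> ip \<xi> \<xi> = of_real ((nrm \<xi>)\<^sup>2)"
  using ip_cnj[of \<xi> \<xi>] ip_ge0[of \<xi>] by (auto simp: nrm_def complex_eq_iff)

lemma nrm_nonneg [simp]: "\<xi> \<in> \<Xi> \<Longrightarrow> 0 \<le> nrm \<xi>"
  by (simp add: nrm_def ip_ge0)

lemma nrm_scale: "\<xi> \<in> \<Xi> \<Longrightarrow> nrm (c *\<^sub>C \<xi>) = cmod c * nrm \<xi>"
proof -
  assume \<xi>: "\<xi> \<in> \<Xi>"
  have "of_real ((nrm (c *\<^sub>C \<xi>))\<^sup>2) = ip (c *\<^sub>C \<xi>) (c *\<^sub>C \<xi>)" using \<xi> by (simp only: ip_self closed_vec)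
  also have "\<dots> = (cnj c * c) * ip \<xi> \<xi>" using \<xi> by (simp add: ip_scale ip_scale_left mult.assoc mult.left_commute)
  also have "\<dots> = of_real ((cmod c * nrm \<xi>)\<^sup>2)"
    by (simp only: ip_self[OF \<xi>] power_mult_distrib of_real_mult complex_norm_square mult.commute)
  finally have "(nrm (c *\<^sub>C \<xi>))\<^sup>2 = (cmod c * nrm \<xi>)\<^sup>2" using of_real_eq_iff by blast
  then show ?thesis using \<xi> by (simp add: power2_eq_iff_nonneg)
qed

text \<open>Expand the nonnegative square of \<open>\<eta> - t (ip \<xi> \<eta>) \<xi>\<close>. With
  \<open>t = 1 / (nrm \<xi>)\<^sup>2\<close> this is the inequality; if
  \<open>nrm \<xi> = 0\<close>, which does not force \<open>\<xi> = 0\<close>, a large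
  \<open>t\<close> makes the expression negative unless \<open>ip \<xi> \<eta> = 0\<close>.\<close>

lemma cauchy_schwarz:
  assumes "\<xi> \<in> \<Xi>" "\<eta> \<in> \<Xi>"
  shows "cmod (ip \<xi> \<eta>) \<le> nrm \<xi> * nrm \<eta>"
proof -
  let ?K = "(cmod (ip \<xi> \<eta>))\<^sup>2" and ?X = "(nrm \<xi>)\<^sup>2" and ?Y = "(nrm \<eta>)\<^sup>2"
  have f: "0 \<le> ?Y - 2 * t * ?K + t\<^sup>2 * ?K * ?X" for t :: real
  proof -
    let ?w = "ip \<xi> \<eta>"
    define c where "c = - (of_real t * ip \<xi> \<eta>)"
    have w: "?w * cnj ?w = of_real ?K" by (simp only: complex_norm_square)
    have "ip (\<eta> + c *\<^sub>C \<xi>) (\<eta> + c *\<^sub>C \<xi>)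
        = ip \<eta> \<eta> + c * cnj ?w + cnj c * ?w + cnj c * c * ip \<xi> \<xi>"
      using assms ip_cnj[OF assms] by (simp add: ip_add ip_scale ip_add_left ip_scale_left algebra_simps)
    also have "\<dots> = of_real ?Y - 2 * of_real t * (?w * cnj ?w) + (of_real t)\<^sup>2 * (?w * cnj ?w) * of_real ?X"
      using assms by (simp add: c_def ip_self power2_eq_square algebra_simps)
    also have "\<dots> = of_real (?Y - 2 * t * ?K + t\<^sup>2 * ?K * ?X)"
      unfolding w by simp
    finally show ?thesis using ip_ge0[of "\<eta> + c *\<^sub>C \<xi>"] assms by simp
  qed
  have "?K \<le> ?X * ?Y"
  proof (cases "?X = 0")
    case True
    have "?K = 0"
    proof (rule ccontr)
      assume K: "?K \<noteq> 0"
      have "0 \<le> ?Y - 2 * ((?Y + 1) / (2 * ?K)) * ?K" using f[of "(?Y + 1) / (2 * ?K)"] True by simp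
      also have "\<dots> = -1" using K by (simp add: field_simps)
      finally show False by simp
    qed
    then show ?thesis by simp
  next
    case False
    then have X: "0 < ?X" by simp
    have "0 \<le> ?Y - 2 * (1 / ?X) * ?K + (1 / ?X)\<^sup>2 * ?K * ?X" by (rule f)
    also have "\<dots> = ?Y - ?K / ?X" using X by (simp add: field_simps power2_eq_square)
    finally show ?thesis using X by (simp add: field_simps)
  qed
  then have "?K \<le> (nrm \<xi> * nrm \<eta>)\<^sup>2" by (simp add: power_mult_distrib)
  then show ?thesis by (rule power2_le_imp_le) (use assms in simp)
qed

lemma nrm_triangle:
  assumes "\<xi> \<in> \<Xi>" "\<eta> \<in> \<Xi>"
  shows "nrm (\<xi> + \<eta>) \<le> nrm \<xi> + nrm \<eta>"
proof (rule power2_le_imp_le)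
  have "of_real ((nrm (\<xi> + \<eta>))\<^sup>2) = ip (\<xi> + \<eta>) (\<xi> + \<eta>)" using assms by (simp only: ip_self closed_vec)
  also have "\<dots> = of_real ((nrm \<xi>)\<^sup>2) + of_real ((nrm \<eta>)\<^sup>2) + (ip \<xi> \<eta> + cnj (ip \<xi> \<eta>))"
    using assms ip_cnj[OF assms] by (simp add: ip_add ip_add_left ip_self[symmetric] del: of_real_power)
  also have "\<dots> = of_real ((nrm \<xi>)\<^sup>2 + (nrm \<eta>)\<^sup>2 + 2 * Re (ip \<xi> \<eta>))" by (simp add: complex_add_cnj)
  finally have "(nrm (\<xi> + \<eta>))\<^sup>2 = (nrm \<xi>)\<^sup>2 + (nrm \<eta>)\<^sup>2 + 2 * Re (ip \<xi> \<eta>)"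
    using of_real_eq_iff by blast
  also have "\<dots> \<le> (nrm \<xi>)\<^sup>2 + (nrm \<eta>)\<^sup>2 + 2 * (nrm \<xi> * nrm \<eta>)"
    using cauchy_schwarz[OF assms] complex_Re_le_cmod[of "ip \<xi> \<eta>"] by linarith
  finally show "(nrm (\<xi> + \<eta>))\<^sup>2 \<le> (nrm \<xi> + nrm \<eta>)\<^sup>2" by (simp add: power2_sum)
qed (use assms in simp)

end

text \<open>A faithful star representation. Faithfulness is stated through \<open>nrm\<close>, since
  null vectors need not be zero, and \<open>bounded\<close> makes the supremum in
  \<open>op_norm\<close> finite.\<close>

locale star_action = star_alg V mul e star + semi_inner \<Xi> ip
  for V :: "'a::complex_vector set" and mul e star and \<Xi> :: "'b::complex_vector set" and ip +
  fixes act :: "'a \<Rightarrow> 'b \<Rightarrow> 'b"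
  assumes act_closed [simp]: "x \<in> V \<Longrightarrow> \<xi> \<in> \<Xi> \<Longrightarrow> act x \<xi> \<in> \<Xi>"
    and act_add: "x \<in> V \<Longrightarrow> y \<in> V \<Longrightarrow> \<xi> \<in> \<Xi> \<Longrightarrow> act (x + y) \<xi> = act x \<xi> + act y \<xi>"
    and act_scale: "x \<in> V \<Longrightarrow> \<xi> \<in> \<Xi> \<Longrightarrow> act (c *\<^sub>C x) \<xi> = c *\<^sub>C act x \<xi>"
    and act_scale_vec: "x \<in> V \<Longrightarrow> \<xi> \<in> \<Xi> \<Longrightarrow> act x (c *\<^sub>C \<xi>) = c *\<^sub>C act x \<xi>"
    and act_mul: "x \<in> V \<Longrightarrow> y \<in> V \<Longrightarrow> \<xi> \<in> \<Xi> \<Longrightarrow> act (mul x y) \<xi> = act x (act y \<xi>)"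
    and adjoint: "x \<in> V \<Longrightarrow> \<xi> \<in> \<Xi> \<Longrightarrow> \<eta> \<in> \<Xi> \<Longrightarrow> ip (act x \<xi>) \<eta> = ip \<xi> (act (star x) \<eta>)"
    and bounded: "x \<in> V \<Longrightarrow> \<exists>C. \<forall>\<xi>\<in>\<Xi>. nrm (act x \<xi>) \<le> C * nrm \<xi>"
    and faithful: "x \<in> V \<Longrightarrow> (\<And>\<xi>. \<xi> \<in> \<Xi> \<Longrightarrow> nrm (act x \<xi>) = 0) \<Longrightarrow> x = 0"
begin

definition op_norm :: "'a \<Rightarrow> real"
  where "op_norm x = (SUP \<xi>\<in>{\<xi>\<in>\<Xi>. nrm \<xi> \<le> 1}. nrm (act x \<xi>))"

lemma bdd_op_norm: "x \<in> V \<Longrightarrow> bdd_above ((\<lambda>\<xi>. nrm (act x \<xi>)) ` {\<xi>\<in>\<Xi>. nrm \<xi> \<le> 1})"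
proof -
  assume "x \<in> V"
  then obtain C where C: "\<And>\<xi>. \<xi> \<in> \<Xi> \<Longrightarrow> nrm (act x \<xi>) \<le> C * nrm \<xi>" using bounded by blast
  have "nrm (act x \<xi>) \<le> \<bar>C\<bar>" if "\<xi> \<in> \<Xi>" "nrm \<xi> \<le> 1" for \<xi>
  proof -
    have "C * nrm \<xi> \<le> \<bar>C\<bar> * 1" using that by (intro mult_mono) auto
    then show ?thesis using C[OF that(1)] by simp
  qed
  then show ?thesis by (intro bdd_aboveI[of _ "\<bar>C\<bar>"]) auto
qed

lemma nrm_zero [simp]: "nrm 0 = 0"
  using nrm_scale[of 0 0] by simp

lemma op_norm_nonneg: "x \<in> V \<Longrightarrow> 0 \<le> op_norm x"
  unfolding op_norm_def
  by (rule order_trans[OF _ cSUP_upper[OF _ bdd_op_norm, of 0]]) simp_all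

lemma op_norm_least: "(\<And>\<xi>. \<xi> \<in> \<Xi> \<Longrightarrow> nrm \<xi> \<le> 1 \<Longrightarrow> nrm (act x \<xi>) \<le> M) \<Longrightarrow> op_norm x \<le> M"
  unfolding op_norm_def by (rule cSUP_least) (auto intro!: exI[of _ 0])

lemma op_norm_upper: assumes "x \<in> V" "\<xi> \<in> \<Xi>" shows "nrm (act x \<xi>) \<le> op_norm x * nrm \<xi>"
proof (cases "nrm \<xi> = 0")
  case True
  \<comment> \<open>A null vector cannot be normalized; boundedness sends it to a null
    vector.\<close>
  then show ?thesis using bounded[OF assms(1)] assms by fastforce
next
  case False
  then have p: "0 < nrm \<xi>" using assms(2) by (simp add: less_le)
  let ?\<eta> = "complex_of_real (1 / nrm \<xi>) *\<^sub>C \<xi>"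
  have "nrm (act x ?\<eta>) \<le> op_norm x"
    unfolding op_norm_def
    by (rule cSUP_upper[OF _ bdd_op_norm[OF assms(1)]]) (use assms p in \<open>simp add: nrm_scale norm_divide\<close>)
  then show ?thesis using assms p by (simp add: act_scale_vec nrm_scale norm_divide field_simps)
qed

lemma op_norm_bound:
  assumes "0 \<le> M" "\<And>\<xi>. \<xi> \<in> \<Xi> \<Longrightarrow> nrm (act x \<xi>) \<le> M * nrm \<xi>"
  shows "op_norm x \<le> M"
proof (rule op_norm_least)
  fix \<xi> assume "\<xi> \<in> \<Xi>" "nrm \<xi> \<le> 1"
  then show "nrm (act x \<xi>) \<le> M"
    using assms(2)[of \<xi>] mult_left_le[of "nrm \<xi>" M] assms(1) by linarith
qed

theorem cstar_op_norm: "cstar_alg V mul e star op_norm"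
proof
  show "norm_on V op_norm"
    unfolding norm_on_def
  proof (intro conjI ballI allI)
    fix x assume x: "x \<in> V"
    show "0 \<le> op_norm x" using x by (rule op_norm_nonneg)
    show "op_norm x = 0 \<longleftrightarrow> x = 0"
    proof
      assume "op_norm x = 0"
      then have "nrm (act x \<xi>) = 0" if "\<xi> \<in> \<Xi>" for \<xi>
        using op_norm_upper[OF x that] x that by (simp add: antisym)
      then show "x = 0" using faithful x by blast
    next
      assume "x = 0"
      then have "nrm (act x \<xi>) = 0" if "\<xi> \<in> \<Xi>" for \<xi>
        using act_scale[OF closed(1) that, of 0] by simp
      then have "op_norm x \<le> 0" by (intro op_norm_least) simp
      then show "op_norm x = 0" using op_norm_nonneg[OF x] by simp
    qed
    fix y assume y: "y \<in> V"
    show "op_norm (x + y) \<le> op_norm x + op_norm y"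
    proof (rule op_norm_bound)
      fix \<xi> assume \<xi>: "\<xi> \<in> \<Xi>"
      have "nrm (act (x + y) \<xi>) \<le> nrm (act x \<xi>) + nrm (act y \<xi>)"
        using x y \<xi> by (simp add: act_add nrm_triangle)
      then show "nrm (act (x + y) \<xi>) \<le> (op_norm x + op_norm y) * nrm \<xi>"
        using op_norm_upper[OF x \<xi>] op_norm_upper[OF y \<xi>] by (simp add: distrib_right)
    qed (use x y op_norm_nonneg in simp_all)
  next
    fix x c assume x: "x \<in> V"
    have le: "op_norm (c *\<^sub>C x) \<le> cmod c * op_norm x" if "x \<in> V" for c x
      by (rule op_norm_bound)
        (use that op_norm_upper[OF that] in \<open>simp_all add: op_norm_nonneg act_scale nrm_scale mult.assoc mult_left_mono\<close>)
    show "op_norm (c *\<^sub>C x) = cmod c * op_norm x"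
    proof (cases "c = 0")
      case True
      then show ?thesis using le[OF x, of 0] op_norm_nonneg[of "c *\<^sub>C x"] x by simp
    next
      case False
      have "op_norm x \<le> cmod (1/c) * op_norm (c *\<^sub>C x)"
        using le[of "c *\<^sub>C x" "1/c"] x False by (simp add: scaleC_scaleC scaleC_one)
      then show ?thesis using le[OF x, of c] False by (simp add: norm_divide field_simps)
    qed
  qed
  show mul_le: "op_norm (mul a b) \<le> op_norm a * op_norm b" if "a \<in> V" "b \<in> V" for a b
  proof (rule op_norm_bound)
    fix \<xi> assume \<xi>: "\<xi> \<in> \<Xi>"
    have "nrm (act (mul a b) \<xi>) \<le> op_norm a * nrm (act b \<xi>)"
      using that \<xi> op_norm_upper by (simp add: act_mul)
    also have "\<dots> \<le> op_norm a * (op_norm b * nrm \<xi>)"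
      using that \<xi> op_norm_upper op_norm_nonneg by (intro mult_left_mono) auto
    finally show "nrm (act (mul a b) \<xi>) \<le> op_norm a * op_norm b * nrm \<xi>" by (simp add: mult.assoc)
  qed (use that op_norm_nonneg in simp_all)
  fix a assume a: "a \<in> V"
  \<comment> \<open>The square of \<open>nrm (act a \<xi>)\<close> is
    \<open>ip \<xi> (act (mul (star a) a) \<xi>)\<close>, so Cauchy-Schwarz gives the nontrivial
    half of the C*-identity. The other half uses that the star preserves \<open>op_norm\<close>,
    which is a consequence of this one.\<close>
  have le: "(op_norm a)\<^sup>2 \<le> op_norm (mul (star a) a)" if a: "a \<in> V" for a
  proof -
    let ?M = "op_norm (mul (star a) a)"
    have M: "0 \<le> ?M" using a op_norm_nonneg by simp
    have "op_norm a \<le> sqrt ?M"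
    proof (rule op_norm_bound)
      fix \<xi> assume \<xi>: "\<xi> \<in> \<Xi>"
      have "ip (act a \<xi>) (act a \<xi>) = ip \<xi> (act (mul (star a) a) \<xi>)"
        using a \<xi> by (simp add: adjoint act_mul)
      then have "of_real ((nrm (act a \<xi>))\<^sup>2) = ip \<xi> (act (mul (star a) a) \<xi>)"
        using ip_self[of "act a \<xi>"] a \<xi> by simp
      from arg_cong[OF this, of cmod]
      have "(nrm (act a \<xi>))\<^sup>2 = cmod (ip \<xi> (act (mul (star a) a) \<xi>))"
        by (simp del: of_real_power)
      also have "\<dots> \<le> nrm \<xi> * nrm (act (mul (star a) a) \<xi>)" using a \<xi> by (simp add: cauchy_schwarz)
      also have "\<dots> \<le> nrm \<xi> * (?M * nrm \<xi>)"
        using a \<xi> op_norm_upper by (intro mult_left_mono) auto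
      also have "\<dots> = (sqrt ?M * nrm \<xi>)\<^sup>2"
        unfolding power_mult_distrib real_sqrt_pow2[OF M] by (simp add: power2_eq_square)
      finally show "nrm (act a \<xi>) \<le> sqrt ?M * nrm \<xi>"
        by (rule power2_le_imp_le) (use M \<xi> in simp)
    qed (use a M in simp_all)
    from power_mono[OF this op_norm_nonneg[OF a], of 2] show ?thesis using M by simp
  qed
  have st: "op_norm a \<le> op_norm (star a)" if a: "a \<in> V" for a
  proof (cases "op_norm a = 0")
    case False
    then have p: "0 < op_norm a" using op_norm_nonneg[OF a] by simp
    have "op_norm a * op_norm a \<le> op_norm (star a) * op_norm a"
      using le[OF a] mul_le[of "star a" a] a by (simp add: power2_eq_square)
    then show ?thesis using p by simp
  qed (use a op_norm_nonneg in simp)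
  have "op_norm (star a) = op_norm a" using st[OF a] st[of "star a"] a by simp
  then show "op_norm (mul (star a) a) = (op_norm a)\<^sup>2"
    using le[OF a] mul_le[of "star a" a] a by (simp add: power2_eq_square)
qed

end

section \<open>Traces\<close>

lemma representation_map:
  assumes "finite B" "cv.independent B" "finite C" "cv.independent C" "cv.span B = UNIV" "cv.span C = UNIV"
    "clinear S"
  shows "cv.representation B (S x) b = (\<Sum>c\<in>C. cv.representation C x c * cv.representation B (S c) b)"
proof -
  have "S x = S (\<Sum>c\<in>C. cv.representation C x c *\<^sub>C c)"
    using cv.sum_representation_eq[OF assms(4) _ assms(3)] assms(6) by simp
  also have "\<dots> = (\<Sum>c\<in>C. cv.representation C x c *\<^sub>C S c)"
  proof -
    have "S (\<Sum>c\<in>C. f c *\<^sub>C c) = (\<Sum>c\<in>C. f c *\<^sub>C S c)" for f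
      using assms(3) by (induction C rule: finite_induct) (simp_all add: clinearD[OF assms(7)])
    then show ?thesis .
  qed
  finally show ?thesis
    using cv.representation_sum[OF assms(2), of C] cv.representation_scale[OF assms(2)] assms(5) by simp
qed

text \<open>Both sides are the double sum of products of matrix entries of \<open>S\<close> and
  \<open>T\<close>. Two bases are allowed: for \<open>S\<close> the identity this is independence of
  the trace from the basis, for \<open>B = C\<close> it is the usual commutation rule.\<close>

lemma trace_commute:
  assumes "finite B" "cv.independent B" "finite C" "cv.independent C" "cv.span B = UNIV" "cv.span C = UNIV"
    "clinear S" "clinear T"
  shows "(\<Sum>b\<in>B. cv.representation B (S (T b)) b) = (\<Sum>c\<in>C. cv.representation C (T (S c)) c)"
proof -
  have "(\<Sum>b\<in>B. cv.representation B (S (T b)) b)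
      = (\<Sum>b\<in>B. \<Sum>c\<in>C. cv.representation C (T b) c * cv.representation B (S c) b)"
    by (intro sum.cong HOL.refl representation_map[OF assms(1-7)])
  also have "\<dots> = (\<Sum>c\<in>C. \<Sum>b\<in>B. cv.representation B (S c) b * cv.representation C (T b) c)"
    by (subst sum.swap) (simp add: mult.commute)
  also have "\<dots> = (\<Sum>c\<in>C. cv.representation C (T (S c)) c)"
    by (intro sum.cong HOL.refl representation_map[OF assms(3,4,1,2,6,5,8), symmetric])
  finally show ?thesis .
qed

text \<open>The trace of an idempotent is its rank: extend a basis \<open>B1\<close> of the range to
  a basis \<open>C\<close> of the space. \<open>P\<close> fixes \<open>B1\<close>, and the images of
  the remaining vectors of \<open>C\<close> have no component outside \<open>B1\<close>.\<close>

lemma trace_projection: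
  assumes B: "finite B" "cv.independent B" "cv.span B = UNIV" and P: "clinear P" "\<And>x. P (P x) = P x"
    and ne: "P x \<noteq> 0"
  obtains k :: nat where "0 < k" "(\<Sum>b\<in>B. cv.representation B (P b) b) = of_nat k"
proof -
  obtain B1 where B1: "B1 \<subseteq> range P" "cv.independent B1" "range P \<subseteq> cv.span B1"
    using cv.maximal_independent_subset[of "range P"] by auto
  obtain C where C: "B1 \<subseteq> C" "cv.independent C" "UNIV \<subseteq> cv.span C"
    using cv.maximal_independent_subset_extend[of B1 UNIV] B1 by auto
  have fC: "finite C" using cv.independent_span_bound[OF B(1) C(2)] B(3) by simp
  have sC: "cv.span C = UNIV" using C(3) by auto
  have fB1: "finite B1" using C(1) fC finite_subset by blast
  have id: "clinear (\<lambda>x. x)" by (simp add: clinear_iff)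
  have "(\<Sum>b\<in>B. cv.representation B (P b) b) = (\<Sum>c\<in>C. cv.representation C (P c) c)"
    using trace_commute[where S = "\<lambda>x. x" and T = P and B = B and C = C] B(1,2,3) fC C(2) sC id P(1) by blast
  also have "\<dots> = (\<Sum>c\<in>C. if c \<in> B1 then 1 else 0)"
  proof (rule sum.cong[OF HOL.refl])
    fix c assume c: "c \<in> C"
    show "cv.representation C (P c) c = (if c \<in> B1 then 1 else 0)"
    proof (cases "c \<in> B1")
      case True
      then have "P c = c" using B1(1) P(2) by auto
      then show ?thesis using True cv.representation_basis[OF C(2) c] by simp
    next
      case False
      have "cv.representation C (P c) = cv.representation B1 (P c)"
        using cv.representation_extend[OF C(2) _ C(1)] B1(3) by auto
      then show ?thesis using False cv.representation_ne_zero by fastforce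
    qed
  qed
  also have "\<dots> = of_nat (card B1)" using fC C(1) by (simp add: sum.If_cases Int_absorb1)
  finally have tr: "(\<Sum>b\<in>B. cv.representation B (P b) b) = of_nat (card B1)" .
  have "P x \<in> cv.span B1" using B1(3) by blast
  then have "B1 \<noteq> {}" using ne by auto
  then have "0 < card B1" using fB1 by (simp add: card_gt_0_iff)
  then show thesis using that tr by blast
qed

text \<open>The trace of the left regular representation. If \<open>a\<^sup>* a\<close> had a spectral projection \<open>p\<close> with
  eigenvalue \<open>t < 0\<close>, then \<open>x = a p = u + i v\<close> would satisfy \<open>x\<^sup>* x = t p\<close> and
  \<open>x\<^sup>* x + x x\<^sup>* = 2 (u\<^sup>2 + v\<^sup>2)\<close>, whose traces have opposite signs.\<close>

lemma (in cstar_alg) faithful_trace: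
  assumes V: "V = UNIV"
  obtains \<tau> :: "'a \<Rightarrow> complex" where "\<And>a b. \<tau> (a + b) = \<tau> a + \<tau> b" "\<And>c a. \<tau> (c *\<^sub>C a) = c * \<tau> a"
    "\<And>a. \<tau> (star a) = cnj (\<tau> a)" "\<And>a. 0 \<le> Re (\<tau> (mul (star a) a))"
    "\<And>a. a \<noteq> 0 \<Longrightarrow> 0 < Re (\<tau> (mul (star a) a))"
proof -
  have fd: "fin_dim (UNIV :: 'a set)" using fin_dim V by simp
  obtain B where B: "finite B" "cv.independent B" "cv.span B = (UNIV :: 'a set)"
    using fin_dim_basis[OF fd] .
  define \<tau> where "\<tau> a = (\<Sum>b\<in>B. cv.representation B (mul a b) b)" for a
  have lin: "clinear (mul a)" for a
    using V by (simp add: clinear_iff mul_add_right mul_scale_right)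
  have add: "\<tau> (a + b) = \<tau> a + \<tau> b" for a b
    using V B(3) by (simp add: \<tau>_def mul_add_left cv.representation_add[OF B(2)] sum.distrib)
  have scale: "\<tau> (c *\<^sub>C a) = c * \<tau> a" for c a
    using V B(3) by (simp add: \<tau>_def mul_scale_left cv.representation_scale[OF B(2)] sum_distrib_left)
  have comm: "\<tau> (mul a b) = \<tau> (mul b a)" for a b
    using trace_commute[OF B(1,2) B(1,2) B(3,3) lin lin, of a b] V by (simp add: \<tau>_def mul_assoc)
  have \<tau>0: "\<tau> 0 = 0" using scale[of 0 0] by simp
  have sum: "\<tau> (\<Sum>i\<in>I. f i) = (\<Sum>i\<in>I. \<tau> (f i))" if "finite I" for I :: "real set" and f
    using that by (induction I rule: finite_induct) (simp_all add: add \<tau>0)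
  \<comment> \<open>Left multiplication by \<open>p\<close> is an idempotent linear map, and it is
    nonzero because it sends \<open>e\<close> to \<open>p\<close>.\<close>
  have proj: "\<exists>k::nat. 0 < k \<and> \<tau> p = of_nat k" if "mul p p = p" "p \<noteq> 0" for p
  proof -
    have "mul p (mul p x) = mul p x" for x using that V mul_assoc[of p p x] by simp
    moreover have "mul p e \<noteq> 0" using that V by simp
    ultimately show ?thesis
      using trace_projection[OF B lin, of p e] unfolding \<tau>_def by metis
  qed
  \<comment> \<open>On self-adjoint \<open>h\<close> the spectral decomposition gives the values
    \<open>\<Sum> t \<tau> (P t)\<close> and \<open>\<Sum> t\<^sup>2 \<tau> (P t)\<close>, where
    each \<open>\<tau> (P t)\<close> is a positive integer.\<close>
  have real: "Im (\<tau> h) = 0" and sq: "0 \<le> Re (\<tau> (mul h h))" if h: "star h = h" for h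
  proof -
    have hV: "h \<in> V" using V by simp
    obtain \<Lambda> P where P: "finite \<Lambda>" "\<And>t. t \<in> \<Lambda> \<Longrightarrow> P t \<noteq> 0"
      "\<And>t u. t \<in> \<Lambda> \<Longrightarrow> u \<in> \<Lambda> \<Longrightarrow> mul (P t) (P u) = (if t = u then P t else 0)"
      "h = (\<Sum>t\<in>\<Lambda>. of_real t *\<^sub>C P t)"
      by (rule spectral_decomposition[OF hV h]) blast
    have PI: "Im (\<tau> (P t)) = 0 \<and> 0 \<le> Re (\<tau> (P t))" if "t \<in> \<Lambda>" for t
      using proj[of "P t"] P that by force
    show "Im (\<tau> h) = 0"
      unfolding P(4) using P(1) PI by (simp add: sum scale)
    have "mul h h = (\<Sum>t\<in>\<Lambda>. \<Sum>u\<in>\<Lambda>. mul (of_real u *\<^sub>C P u) (of_real t *\<^sub>C P t))"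
      unfolding P(4) using P(1) V by (simp add: mul_sum_left mul_sum_right)
    also have "\<dots> = (\<Sum>t\<in>\<Lambda>. \<Sum>u\<in>\<Lambda>. if u = t then of_real (t\<^sup>2) *\<^sub>C P t else 0)"
      using V by (intro sum.cong) (auto simp: mul_scale_left mul_scale_right P(3) scaleC_scaleC power2_eq_square)
    also have "\<dots> = (\<Sum>t\<in>\<Lambda>. of_real (t\<^sup>2) *\<^sub>C P t)" using P(1) by simp
    finally show "0 \<le> Re (\<tau> (mul h h))"
      using P(1) PI by (simp add: sum scale sum_nonneg del: of_real_power)
  qed
  have star: "\<tau> (star a) = cnj (\<tau> a)" for a
  proof -
    have aV: "a \<in> V" using V by simp
    obtain h k where hk: "star h = h" "star k = k" "a = h + \<i> *\<^sub>C k" "star a = h + (- \<i>) *\<^sub>C k"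
      by (rule cartesian_decomposition[OF aV]) (simp add: cv.scale_minus_left)
    show ?thesis
      unfolding hk(4) unfolding hk(3) add scale using real[OF hk(1)] real[OF hk(2)] by (simp add: complex_eq_iff)
  qed
  have pos: "0 < Re (\<tau> (mul (star a) a))" if a: "a \<noteq> 0" for a
  proof -
    let ?h = "mul (star a) a"
    have hV: "?h \<in> V" using V by simp
    have h: "star ?h = ?h" "?h \<noteq> 0" using V a by (simp_all add: star_mul star_mul_eq_0)
    obtain \<Lambda> P where P: "finite \<Lambda>" "\<And>t. t \<in> \<Lambda> \<Longrightarrow> P t \<noteq> 0" "\<And>t. t \<in> \<Lambda> \<Longrightarrow> star (P t) = P t"
      "\<And>t u. t \<in> \<Lambda> \<Longrightarrow> u \<in> \<Lambda> \<Longrightarrow> mul (P t) (P u) = (if t = u then P t else 0)"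
      "?h = (\<Sum>t\<in>\<Lambda>. of_real t *\<^sub>C P t)"
      by (rule spectral_decomposition[OF hV h(1)]) blast
    have PI: "0 < Re (\<tau> (P t))" if "t \<in> \<Lambda>" for t
      using proj[of "P t"] P that by force
    have nn: "0 \<le> t" if t: "t \<in> \<Lambda>" for t
    proof -
      let ?x = "mul a (P t)"
      have "mul (star ?x) ?x = mul (P t) (mul ?h (P t))"
        using V P(3)[OF t] by (simp add: star_mul mul_assoc)
      also have "mul ?h (P t) = (\<Sum>u\<in>\<Lambda>. mul (of_real u *\<^sub>C P u) (P t))"
        unfolding P(5) using V P(1) by (simp add: mul_sum_left)
      also have "\<dots> = (\<Sum>u\<in>\<Lambda>. if u = t then of_real t *\<^sub>C P t else 0)"
        using V by (intro sum.cong) (auto simp: mul_scale_left P(4) t)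
      also have "\<dots> = of_real t *\<^sub>C P t" using P(1) t by simp
      also have "mul (P t) (of_real t *\<^sub>C P t) = of_real t *\<^sub>C P t"
        using V by (simp add: mul_scale_right P(4) t)
      finally have xx: "mul (star ?x) ?x = of_real t *\<^sub>C P t" .
      obtain u v where uv: "star u = u" "star v = v" "?x = u + \<i> *\<^sub>C v" "star ?x = u + (- \<i>) *\<^sub>C v"
        by (rule cartesian_decomposition[of ?x]) (simp_all add: V cv.scale_minus_left)
      have "mul (star ?x) ?x + mul ?x (star ?x) = 2 *\<^sub>C (mul u u) + 2 *\<^sub>C (mul v v)"
      proof -
        have two: "2 *\<^sub>C y = y + y" for y :: 'a
          using scaleC_add_left[of 1 1 y] by (simp add: scaleC_one)
        show ?thesis
          unfolding uv(4) unfolding uv(3) using V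
          by (simp add: mul_add_left mul_add_right mul_diff mul_scale_left mul_scale_right scaleC_add_right
              cv.scale_right_diff_distrib scaleC_scaleC two scaleC_one cv.scale_minus_left)
      qed
      from arg_cong[OF this, of \<tau>]
      have "\<tau> (mul (star ?x) ?x) + \<tau> (mul ?x (star ?x)) = 2 * \<tau> (mul u u) + 2 * \<tau> (mul v v)"
        by (simp only: add scale)
      then have "2 * Re (\<tau> (mul (star ?x) ?x)) = 2 * Re (\<tau> (mul u u)) + 2 * Re (\<tau> (mul v v))"
        unfolding comm[of ?x "star ?x"] complex_eq_iff by simp
      then have "0 \<le> Re (\<tau> (mul (star ?x) ?x))"
        using sq[OF uv(1)] sq[OF uv(2)] by linarith
      then have "0 \<le> t * Re (\<tau> (P t))" by (simp add: xx scale)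
      then show ?thesis using PI[OF t] by (simp add: zero_le_mult_iff)
    qed
    have "\<exists>t\<in>\<Lambda>. t \<noteq> 0"
    proof (rule ccontr)
      assume "\<not> ?thesis"
      then have "?h = 0" unfolding P(5) by (intro sum.neutral) auto
      then show False using h by simp
    qed
    then obtain t where t: "t \<in> \<Lambda>" "t \<noteq> 0" by blast
    have "0 < (\<Sum>t\<in>\<Lambda>. t * Re (\<tau> (P t)))"
      by (rule sum_pos2[OF P(1) t(1)]) (use t nn PI in \<open>auto simp: less_le\<close>)
    also have "\<dots> = Re (\<tau> ?h)" unfolding P(5) using P(1) by (simp add: sum scale)
    finally show ?thesis .
  qed
  have "0 \<le> Re (\<tau> (mul (star a) a))" for a
    using pos[of a] V \<tau>0 by (cases "a = 0") auto
  then show thesis using that add scale star pos by blast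
qed

section \<open>Matrix algebras\<close>

lemma mats_iff: "x \<in> mats n r \<longleftrightarrow> (\<forall>i j. \<not> (i < n \<and> j < r) \<longrightarrow> x i j = 0)"
  by (auto simp: mats_def)

lemma mats_outside: "x \<in> mats n r \<Longrightarrow> \<not> (i < n \<and> j < r) \<Longrightarrow> x i j = 0"
  by (simp add: mats_iff)

lemma mats_mono: "x \<in> mats n r \<Longrightarrow> n \<le> m \<Longrightarrow> r \<le> s \<Longrightarrow> x \<in> mats m s"
  by (force simp: mats_def)

lemma mats_eqI: "x \<in> mats n r \<Longrightarrow> y \<in> mats n r \<Longrightarrow> (\<And>i j. i < n \<Longrightarrow> j < r \<Longrightarrow> x i j = y i j) \<Longrightarrow> x = y"
  by (intro ext) (metis mats_outside)

lemma subspace_mats: "cv.subspace (mats n r :: 'a::complex_vector matrix set)"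
  by (rule cv.subspaceI) (auto simp: mats_iff scaleC_fun_def cv.scale_zero_right)

lemma sum_fun_apply: "(\<Sum>i\<in>I. f i) x = (\<Sum>i\<in>I. f i x)"
  by (induction I rule: infinite_finite_induct) simp_all

text \<open>The elementary tensor of a matrix unit with \<open>a\<close>.\<close>

definition mat_entry :: "nat \<Rightarrow> nat \<Rightarrow> 'a::zero \<Rightarrow> 'a matrix"
  where "mat_entry i j a = (\<lambda>k l. if k = i \<and> l = j then a else 0)"

lemma mats_expand:
  assumes "x \<in> mats n r"
  shows "x = (\<Sum>i<n. \<Sum>j<r. mat_entry i j (x i j))"
proof (intro ext)
  fix k l
  have "(\<Sum>i<n. \<Sum>j<r. mat_entry i j (x i j)) k l = (\<Sum>i<n. \<Sum>j<r. if l = j then if k = i then x i j else 0 else 0)"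
    unfolding sum_fun_apply by (intro sum.cong HOL.refl) (auto simp: mat_entry_def)
  also have "\<dots> = (\<Sum>i<n. if k = i then if l < r then x i l else 0 else 0)"
    by (intro sum.cong HOL.refl) (auto simp: sum.delta)
  also have "\<dots> = x k l" using assms by (auto simp: sum.delta mats_outside)
  finally show "x k l = (\<Sum>i<n. \<Sum>j<r. mat_entry i j (x i j)) k l" by simp
qed

lemma fin_dim_mats:
  assumes "fin_dim (UNIV :: 'a::complex_vector set)"
  shows "fin_dim (mats n r :: 'a matrix set)"
proof -
  obtain B where B: "finite B" "cv.span B = (UNIV :: 'a set)" using assms by (auto simp: fin_dim_def)
  let ?S = "\<Union>i<n. \<Union>j<r. mat_entry i j ` B"
  have "mat_entry i j a \<in> cv.span ?S" if ij: "i < n" "j < r" for i j a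
  proof -
    have "a \<in> cv.span B" using B by simp
    then show ?thesis
    proof (induction rule: cv.span_induct_alt)
      case base
      have "mat_entry i j (0::'a) = 0" by (auto simp: mat_entry_def fun_eq_iff)
      then show ?case by (simp only: cv.span_zero)
    next
      case (step c x y)
      have "mat_entry i j (c *\<^sub>C x + y) = c *\<^sub>C mat_entry i j x + mat_entry i j y"
        by (auto simp: mat_entry_def fun_eq_iff scaleC_fun_def cv.scale_zero_right)
      moreover have "mat_entry i j x \<in> ?S" using step ij by blast
      ultimately show ?case using step by (metis cv.span_add cv.span_base cv.span_scale)
    qed
  qed
  then have "x \<in> cv.span ?S" if "x \<in> mats n r" for x
    by (subst mats_expand[OF that]) (intro cv.span_sum, auto)
  moreover have "?S \<subseteq> mats n r" by (auto simp: mats_def mat_entry_def split: if_splits)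
  then have "cv.span ?S \<subseteq> mats n r" using subspace_mats by (rule cv.span_minimal)
  ultimately show ?thesis
    unfolding fin_dim_def using subspace_mats B(1) by (intro conjI exI[of _ ?S]) auto
qed

locale full_star_alg = star_alg "UNIV :: 'a::complex_vector set" mul e star for mul e star
begin

lemma mat_mult_closed: "x \<in> mats n n \<Longrightarrow> y \<in> mats n n \<Longrightarrow> mat_mult mul n x y \<in> mats n n"
  by (auto simp: mats_iff mat_mult_def)

lemma mat_unit_mult: "x \<in> mats n n \<Longrightarrow> mat_mult mul n (mat_unit e n) x = x"
proof (intro ext)
  fix i j assume x: "x \<in> mats n n"
  have "mat_mult mul n (mat_unit e n) x i j = (\<Sum>k<n. if i = k then x i j else 0)"
    unfolding mat_mult_def by (rule sum.cong) (auto simp: mat_unit_def)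
  then show "mat_mult mul n (mat_unit e n) x i j = x i j" using x by (simp add: mats_outside)
qed

lemma mat_mult_unit: "x \<in> mats n n \<Longrightarrow> mat_mult mul n x (mat_unit e n) = x"
proof (intro ext)
  fix i j assume x: "x \<in> mats n n"
  have "mat_mult mul n x (mat_unit e n) i j = (\<Sum>k<n. if j = k then x i j else 0)"
    unfolding mat_mult_def by (rule sum.cong) (auto simp: mat_unit_def)
  then show "mat_mult mul n x (mat_unit e n) i j = x i j" using x by (simp add: mats_outside)
qed

lemma mat_mult_assoc: "mat_mult mul n a (mat_mult mul n b c) = mat_mult mul n (mat_mult mul n a b) c"
proof (intro ext)
  fix i j
  have "mat_mult mul n a (mat_mult mul n b c) i j = (\<Sum>k<n. \<Sum>l<n. mul (mul (a i k) (b k l)) (c l j))"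
    by (simp add: mat_mult_def mul_sum_right mul_assoc)
  also have "\<dots> = mat_mult mul n (mat_mult mul n a b) c i j"
    by (subst sum.swap) (simp add: mat_mult_def mul_sum_left)
  finally show "mat_mult mul n a (mat_mult mul n b c) i j = mat_mult mul n (mat_mult mul n a b) c i j" .
qed

lemma mats_star_alg: "star_alg (mats n n) (mat_mult mul n) (mat_unit e n) (mat_star star)"
proof
  show "fin_dim (mats n n :: 'a matrix set)" by (rule fin_dim_mats[OF fin_dim])
  show "mat_unit e n \<in> mats n n" by (auto simp: mat_unit_def mats_def split: if_splits)
  fix a b c :: "'a matrix" and z :: complex assume a: "a \<in> mats n n"
  show "mat_mult mul n (mat_unit e n) a = a" "mat_mult mul n a (mat_unit e n) = a"
    using a by (rule mat_unit_mult mat_mult_unit)+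
  show "mat_star star a \<in> mats n n" using a by (auto simp: mat_star_def mats_iff)
  show "mat_star star (z *\<^sub>C a) = cnj z *\<^sub>C mat_star star a"
    by (simp add: mat_star_def scaleC_fun_def star_scale)
  show "mat_star star (mat_star star a) = a" by (simp add: mat_star_def)
  assume b: "b \<in> mats n n"
  show "mat_mult mul n a b \<in> mats n n" using a b by (rule mat_mult_closed)
  show "mat_mult mul n (z *\<^sub>C a) b = z *\<^sub>C mat_mult mul n a b"
    "mat_mult mul n a (z *\<^sub>C b) = z *\<^sub>C mat_mult mul n a b"
    by (simp_all add: mat_mult_def scaleC_fun_def mul_scale_left mul_scale_right cv.scale_sum_right)
  show "mat_star star (a + b) = mat_star star a + mat_star star b"
    by (simp add: mat_star_def fun_eq_iff star_add)
  show "mat_star star (mat_mult mul n a b) = mat_mult mul n (mat_star star b) (mat_star star a)"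
    by (simp add: mat_star_def mat_mult_def star_sum star_mul)
  show "mat_mult mul n (a + b) c = mat_mult mul n a c + mat_mult mul n b c"
    "mat_mult mul n a (b + c) = mat_mult mul n a b + mat_mult mul n a c"
    by (simp_all add: mat_mult_def fun_eq_iff mul_add_left mul_add_right sum.distrib)
  show "mat_mult mul n a (mat_mult mul n b c) = mat_mult mul n (mat_mult mul n a b) c"
    by (rule mat_mult_assoc)
qed

end

lemma matrix_cstar_norm_exists:
  assumes "cstar_alg (UNIV :: 'a::complex_vector set) mul e star \<nu>"
  shows "\<exists>\<nu>'. cstar_alg (mats n n) (mat_mult mul n) (mat_unit e n) (mat_star star) \<nu>'"
proof -
  interpret A: cstar_alg UNIV mul e star \<nu> by fact
  interpret A: full_star_alg mul e star ..
  interpret M: star_alg "mats n n" "mat_mult mul n" "mat_unit e n" "mat_star star"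
    by (rule A.mats_star_alg)
  obtain \<tau> where \<tau>: "\<And>a b. \<tau> (a + b) = \<tau> a + \<tau> b" "\<And>c a. \<tau> (c *\<^sub>C a) = c * \<tau> a"
    "\<And>a. \<tau> (star a) = cnj (\<tau> a)" "\<And>a. 0 \<le> Re (\<tau> (mul (star a) a))"
    "\<And>a. a \<noteq> 0 \<Longrightarrow> 0 < Re (\<tau> (mul (star a) a))"
    using A.faithful_trace[OF HOL.refl] by blast
  define \<phi> where "\<phi> x = (\<Sum>i<n. \<tau> (x i i))" for x :: "'a matrix"
  define ip where "ip x y = \<phi> (mat_mult mul n (mat_star star x) y)" for x y
  have \<tau>0: "\<tau> 0 = 0" using \<tau>(2)[of 0 0] by simp
  have \<tau>sum: "\<tau> (sum f I) = (\<Sum>i\<in>I. \<tau> (f i))" for f and I :: "nat set"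
    by (induction I rule: infinite_finite_induct) (simp_all add: \<tau>0 \<tau>(1))
  have \<phi>: "\<phi> (x + y) = \<phi> x + \<phi> y" "\<phi> (c *\<^sub>C x) = c * \<phi> x" "\<phi> (mat_star star x) = cnj (\<phi> x)" for x y c
    by (simp_all add: \<phi>_def \<tau> scaleC_fun_def sum.distrib sum_distrib_left mat_star_def)
  have ip_self: "Re (ip x x) = (\<Sum>i<n. \<Sum>k<n. Re (\<tau> (mul (star (x k i)) (x k i))))" for x
    by (simp add: ip_def \<phi>_def mat_mult_def mat_star_def \<tau>sum)
  interpret S: semi_inner "mats n n" ip
  proof
    fix \<xi> \<eta> \<zeta> :: "'a matrix" and c :: complex
    show "cv.subspace (mats n n :: 'a matrix set)" by (rule subspace_mats)
    assume \<xi>: "\<xi> \<in> mats n n"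
    show "0 \<le> Re (ip \<xi> \<xi>)" unfolding ip_self by (intro sum_nonneg \<tau>(4))
    assume \<eta>: "\<eta> \<in> mats n n"
    show "ip \<xi> (c *\<^sub>C \<eta>) = c * ip \<xi> \<eta>" using \<xi> \<eta> by (simp add: ip_def M.mul_scale_right \<phi>)
    show "ip \<eta> \<xi> = cnj (ip \<xi> \<eta>)" using \<xi> \<eta> by (simp add: ip_def \<phi>(3)[symmetric] M.star_mul)
    assume "\<zeta> \<in> mats n n"
    then show "ip \<xi> (\<eta> + \<zeta>) = ip \<xi> \<eta> + ip \<xi> \<zeta>" using \<xi> \<eta> by (simp add: ip_def M.mul_add_right \<phi>)
  qed
  \<comment> \<open>\<open>Re (ip x x)\<close> sums the values
    \<open>Re (\<tau> (mul (star (x k i)) (x k i)))\<close> over all entries; they are nonnegative,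
    and positive at a nonzero entry.\<close>
  have definite: "x = 0" if x: "x \<in> mats n n" "S.nrm x = 0" for x
  proof (rule ccontr)
    assume "x \<noteq> 0"
    then obtain k i where ki: "x k i \<noteq> 0" by (auto simp: fun_eq_iff)
    then have "k < n" "i < n" using x(1) by (auto simp: mats_def)
    have "0 < Re (\<tau> (mul (star (x k i)) (x k i)))" using \<tau>(5)[OF ki] .
    also have "\<dots> \<le> (\<Sum>k<n. Re (\<tau> (mul (star (x k i)) (x k i))))"
      using \<open>k < n\<close> \<tau>(4) member_le_sum[of k "{..<n}" "\<lambda>k. Re (\<tau> (mul (star (x k i)) (x k i)))"] by simp
    also have "\<dots> \<le> Re (ip x x)"
      unfolding ip_self using \<open>i < n\<close> \<tau>(4)
        member_le_sum[of i "{..<n}" "\<lambda>i. \<Sum>k<n. Re (\<tau> (mul (star (x k i)) (x k i)))"]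
      by (simp add: sum_nonneg)
    finally show False using x(2) by (simp add: S.nrm_def)
  qed
  have S0: "S.nrm 0 = 0" using S.nrm_scale[of 0 0] by simp
  have norm: "norm_on (mats n n) S.nrm"
    unfolding norm_on_def using definite S0 S.nrm_triangle S.nrm_scale by auto
  interpret star_action "mats n n" "mat_mult mul n" "mat_unit e n" "mat_star star" "mats n n" ip "mat_mult mul n"
  proof
    fix x y \<xi> \<eta> :: "'a matrix" and c :: complex assume x: "x \<in> mats n n"
    \<comment> \<open>The unit matrix is itself a vector, and \<open>x\<close> sends it to
      \<open>x\<close>.\<close>
    show "x = 0" if "\<And>\<xi>. \<xi> \<in> mats n n \<Longrightarrow> S.nrm (mat_mult mul n x \<xi>) = 0"
      using definite[OF x] that[OF M.unit_closed] x by simp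
    show "\<exists>C. \<forall>\<xi>\<in>mats n n. S.nrm (mat_mult mul n x \<xi>) \<le> C * S.nrm \<xi>"
      by (rule seminorm_bound[OF M.fin_dim norm, of "\<lambda>\<xi>. S.nrm (mat_mult mul n x \<xi>)"])
        (use x in \<open>auto simp: M.mul_add_right M.mul_scale_right S.nrm_triangle S.nrm_scale\<close>)
    assume \<xi>: "\<xi> \<in> mats n n"
    show "mat_mult mul n x \<xi> \<in> mats n n" "mat_mult mul n (c *\<^sub>C x) \<xi> = c *\<^sub>C mat_mult mul n x \<xi>"
      "mat_mult mul n x (c *\<^sub>C \<xi>) = c *\<^sub>C mat_mult mul n x \<xi>"
      using x \<xi> by (simp_all add: M.mul_scale_left M.mul_scale_right)
    show "ip (mat_mult mul n x \<xi>) \<eta> = ip \<xi> (mat_mult mul n (mat_star star x) \<eta>)" if "\<eta> \<in> mats n n"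
      using x \<xi> that by (simp add: ip_def M.star_mul M.mul_assoc)
    assume "y \<in> mats n n"
    then show "mat_mult mul n (x + y) \<xi> = mat_mult mul n x \<xi> + mat_mult mul n y \<xi>"
      "mat_mult mul n (mat_mult mul n x y) \<xi> = mat_mult mul n x (mat_mult mul n y \<xi>)"
      using x \<xi> by (simp_all add: M.mul_add_left M.mul_assoc)
  qed
  show ?thesis using cstar_op_norm by blast
qed

lemma cstar_alg_cong:
  assumes "cstar_alg V mul e star \<nu>" "\<And>x. x \<in> V \<Longrightarrow> \<nu>' x = \<nu> x"
  shows "cstar_alg V mul e star \<nu>'"
proof -
  interpret cstar_alg V mul e star \<nu> by fact
  show ?thesis
    by unfold_locales (auto simp: assms(2) norm_on_def norm_add norm_scale norm_mul norm_star_mul)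
qed

text \<open>The C*-norm is determined on matrices only; restricting it fixes the values elsewhere,
  which makes the function itself unique.\<close>

lemma ex1_vN_matrix_norm:
  assumes "std_vN_algebra S"
  shows "\<exists>!\<nu>. vN_matrix_norm S n \<nu>"
proof -
  have A: "cstar_alg UNIV (std_mult S) (std_unit S) (std_star S) (std_norm S)"
    using assms by (simp add: std_vN_algebra_def vN_algebra_on_iff)
  obtain \<nu> where \<nu>: "cstar_alg (mats n n) (mat_mult (std_mult S) n) (mat_unit (std_unit S) n) (mat_star (std_star S)) \<nu>"
    using matrix_cstar_norm_exists[OF A] by blast
  have "vN_matrix_norm S n (restrict \<nu> (mats n n))"
    unfolding vN_matrix_norm_def vN_algebra_on_iff by (simp add: cstar_alg_cong[OF \<nu>])
  moreover have "\<nu>1 = \<nu>2" if "vN_matrix_norm S n \<nu>1" "vN_matrix_norm S n \<nu>2" for \<nu>1 \<nu>2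
  proof (rule extensionalityI[of _ "mats n n"])
    show "\<nu>1 x = \<nu>2 x" if "x \<in> mats n n" for x
      using cstar_norm_unique[OF _ _ that] \<open>vN_matrix_norm S n \<nu>1\<close> \<open>vN_matrix_norm S n \<nu>2\<close>
      unfolding vN_matrix_norm_def vN_algebra_on_iff by metis
  qed (use that in \<open>simp_all add: vN_matrix_norm_def\<close>)
  ultimately show ?thesis
    by blast
qed

lemma canonical_mnorm:
  assumes "std_vN_algebra S"
  shows "cstar_alg (mats n n) (mat_mult (std_mult S) n) (mat_unit (std_unit S) n) (mat_star (std_star S))
      (canonical_mnorm S n)" (is ?cstar)
    and "canonical_mnorm S n \<in> extensional (mats n n)" (is ?ext)
proof -
  have "vN_matrix_norm S n (canonical_mnorm S n)"
    unfolding canonical_mnorm_def by (rule theI'[OF ex1_vN_matrix_norm[OF assms]])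
  then show ?cstar ?ext
    by (simp_all add: vN_matrix_norm_def vN_algebra_on_iff)
qed

section \<open>Scalar matrices\<close>

abbreviation scalar_mult :: "nat \<Rightarrow> complex matrix \<Rightarrow> complex matrix \<Rightarrow> complex matrix"
  where "scalar_mult \<equiv> mat_mult (*)"

lemma full_star_alg_complex: "full_star_alg ((*) :: complex \<Rightarrow> complex \<Rightarrow> complex) 1 cnj"
proof
  have "cv.span {1} = (UNIV :: complex set)"
  proof -
    have "z \<in> cv.span {1}" for z :: complex
    proof -
      have "z *\<^sub>C 1 \<in> cv.span {1::complex}" by (intro cv.span_scale cv.span_base) simp
      moreover have "z *\<^sub>C 1 = z" by (simp add: scaleC_complex_def)
      ultimately show ?thesis by (simp only:)
    qed
    then show ?thesis by auto
  qed
  then show "fin_dim (UNIV :: complex set)"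
    unfolding fin_dim_def using cv.subspace_UNIV by blast
qed (simp_all add: scaleC_complex_def algebra_simps)

text \<open>The supremum in \<open>scalar_mnorm\<close> is \<open>op_norm\<close> for the action of
  matrices on vectors, taken to be functions on all naturals that are evaluated at indices below
  \<open>n\<close>.\<close>

lemma scalar_cstar: "cstar_alg (mats n n) (scalar_mult n) (mat_unit 1 n) (mat_star cnj) (scalar_mnorm n)"
proof -
  interpret A: full_star_alg "(*) :: complex \<Rightarrow> complex \<Rightarrow> complex" 1 cnj by (rule full_star_alg_complex)
  interpret M: star_alg "mats n n" "scalar_mult n" "mat_unit 1 n" "mat_star cnj"
    by (rule A.mats_star_alg)
  define ip where "ip \<xi> \<eta> = (\<Sum>i<n. cnj (\<xi> i) * \<eta> i)" for \<xi> \<eta> :: "nat \<Rightarrow> complex"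
  define act where "act \<alpha> \<xi> = (\<lambda>i. \<Sum>j<n. \<alpha> i j * \<xi> j)" for \<alpha> :: "complex matrix" and \<xi>
  have ip_self: "Re (ip \<xi> \<xi>) = (\<Sum>i<n. (cmod (\<xi> i))\<^sup>2)" for \<xi>
    by (simp add: ip_def cmod_def power2_eq_square[symmetric])
  interpret S: semi_inner UNIV ip
  proof
    show "0 \<le> Re (ip \<xi> \<xi>)" for \<xi> unfolding ip_self by (simp add: sum_nonneg)
  qed (simp_all add: ip_def scaleC_fun_def scaleC_complex_def sum.distrib sum_distrib_left algebra_simps)
  have nrm: "S.nrm \<xi> = L2_set (\<lambda>i. cmod (\<xi> i)) {..<n}" for \<xi>
    by (simp add: S.nrm_def ip_self L2_set_def)
  have nrm_le: "cmod (\<xi> i) \<le> S.nrm \<xi>" if "i < n" for \<xi> i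
    unfolding nrm using that by (intro member_le_L2_set) auto
  interpret star_action "mats n n" "scalar_mult n" "mat_unit 1 n" "mat_star cnj" UNIV ip act
  proof
    fix x y :: "complex matrix" and \<xi> \<eta> :: "nat \<Rightarrow> complex" and c :: complex assume x: "x \<in> mats n n"
    show "act x \<xi> \<in> UNIV" "act (c *\<^sub>C x) \<xi> = c *\<^sub>C act x \<xi>" "act x (c *\<^sub>C \<xi>) = c *\<^sub>C act x \<xi>"
      "act (x + y) \<xi> = act x \<xi> + act y \<xi>"
      by (simp_all add: act_def scaleC_fun_def scaleC_complex_def sum_distrib_left sum.distrib fun_eq_iff algebra_simps)
    show "act (scalar_mult n x y) \<xi> = act x (act y \<xi>)"
    proof
      fix i
      have "act (scalar_mult n x y) \<xi> i = (\<Sum>j<n. \<Sum>k<n. x i k * y k j * \<xi> j)"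
        by (simp add: act_def mat_mult_def sum_distrib_right)
      also have "\<dots> = act x (act y \<xi>) i"
        by (subst sum.swap) (simp add: act_def sum_distrib_left mult.assoc)
      finally show "act (scalar_mult n x y) \<xi> i = act x (act y \<xi>) i" .
    qed
    show "ip (act x \<xi>) \<eta> = ip \<xi> (act (mat_star cnj x) \<eta>)"
    proof -
      have "ip (act x \<xi>) \<eta> = (\<Sum>i<n. \<Sum>j<n. cnj (x i j) * cnj (\<xi> j) * \<eta> i)"
        by (simp add: ip_def act_def sum_distrib_right)
      also have "\<dots> = ip \<xi> (act (mat_star cnj x) \<eta>)"
        by (subst sum.swap) (simp add: ip_def act_def mat_star_def sum_distrib_left mult_ac)
      finally show ?thesis .
    qed
    show "\<exists>C. \<forall>\<xi>\<in>UNIV. S.nrm (act x \<xi>) \<le> C * S.nrm \<xi>"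
    proof (intro exI ballI)
      fix \<xi> :: "nat \<Rightarrow> complex"
      have "S.nrm (act x \<xi>) \<le> (\<Sum>i<n. cmod (act x \<xi> i))" unfolding nrm by (rule L2_set_le_sum) simp
      also have "\<dots> \<le> (\<Sum>i<n. \<Sum>j<n. cmod (x i j) * S.nrm \<xi>)"
        unfolding act_def by (intro sum_mono order_trans[OF norm_sum])
          (auto simp: norm_mult intro!: sum_mono mult_left_mono nrm_le)
      finally show "S.nrm (act x \<xi>) \<le> (\<Sum>i<n. \<Sum>j<n. cmod (x i j)) * S.nrm \<xi>"
        by (simp add: sum_distrib_right)
    qed
    show "x = 0" if z: "\<And>\<xi>. \<xi> \<in> UNIV \<Longrightarrow> S.nrm (act x \<xi>) = 0"
    proof (rule mats_eqI[OF x M.closed(1)])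
      fix i j assume ij: "i < n" "j < n"
      have "act x (\<lambda>k. if k = j then 1 else 0) i = x i j" using ij by (simp add: act_def if_distrib cong: if_cong)
      then have "cmod (x i j) \<le> S.nrm (act x (\<lambda>k. if k = j then 1 else 0))" using nrm_le[OF ij(1)] by metis
      then show "x i j = 0 i j" using z by simp
    qed
  qed
  show ?thesis
    by (rule cstar_alg_cong[OF cstar_op_norm]) (simp add: scalar_mnorm_def op_norm_def nrm act_def)
qed

section \<open>Operator spaces\<close>

lemma direct_sum_zero: "x \<in> mats m m \<Longrightarrow> direct_sum m x 0 = x"
  by (intro ext) (auto simp: direct_sum_def mats_iff)

lemma direct_sum_simps:
  "i < m \<Longrightarrow> j < m \<Longrightarrow> direct_sum m x y i j = x i j"
  "i < m \<Longrightarrow> direct_sum m x y i (m + j) = 0"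
  "j < m \<Longrightarrow> direct_sum m x y (m + i) j = 0"
  "direct_sum m x y (m + i) (m + j) = y i j"
  by (simp_all add: direct_sum_def)

text \<open>Separates the blocks of a direct sum; an index in the second block appears as
  \<open>m + k\<close>, the form that \<open>direct_sum_simps\<close> matches.\<close>

lemma less_or_add_cases:
  fixes i m :: nat
  obtains "i < m" | k where "i = m + k"
  using le_Suc_ex linorder_not_less by blast

lemma direct_sum_mats:
  assumes "x \<in> mats m m" "y \<in> mats n n"
  shows "direct_sum m x y \<in> mats (m + n) (m + n)"
proof -
  have "y (i - m) (j - m) = 0" if "m \<le> i" "m \<le> j" "\<not> (i < m + n \<and> j < m + n)" for i j
    by (rule mats_outside[OF assms(2)]) (use that in linarith)
  then show ?thesis by (auto simp: direct_sum_def mats_iff)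
qed

lemma mat1_mats: "mat1 a \<in> mats 1 1"
  by (auto simp: mat1_def mats_def split: if_splits)

lemma mat_unit_mats: "mat_unit e n \<in> mats n n"
  by (auto simp: mat_unit_def mats_def split: if_splits)

lemma zero_mats: "0 \<in> mats n r"
  by (simp add: mats_def)

locale op_space =
  fixes N :: "'a::complex_vector mnorm"
  assumes operator_space: "operator_space N"
begin

lemma norm: "norm_on (mats n n) (N n)"
  and extensional: "N n \<in> extensional (mats n n)"
  and norm_direct_sum: "x \<in> mats m m \<Longrightarrow> y \<in> mats n n \<Longrightarrow> N (m + n) (direct_sum m x y) = max (N m x) (N n y)"
  and norm_sandwich: "\<alpha> \<in> mats m m \<Longrightarrow> x \<in> mats m m \<Longrightarrow> \<beta> \<in> mats m m \<Longrightarrow>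
    N m (sandwich m \<alpha> x \<beta>) \<le> scalar_mnorm m \<alpha> * N m x * scalar_mnorm m \<beta>"
  using operator_space unfolding operator_space_def by blast+

lemmas N_nonneg = norm_onD(1)[OF norm]
  and N_eq_0 = norm_onD(2)[OF norm]
  and N_add = norm_onD(3)[OF norm]
  and N_scale = norm_onD(4)[OF norm]

lemma N_zero [simp]: "N n 0 = 0"
  using N_eq_0[OF zero_mats] by simp

text \<open>Padding leaves the family unchanged and is the direct sum with a zero block.\<close>

lemma norm_pad:
  assumes "x \<in> mats n n" "n \<le> m" shows "N m x = N n x"
proof -
  have "N (n + (m - n)) (direct_sum n x 0) = max (N n x) (N (m - n) 0)"
    by (rule norm_direct_sum[OF assms(1) zero_mats])
  then show ?thesis using assms N_nonneg[OF assms(1)] by (simp add: direct_sum_zero max_def)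
qed

text \<open>\<open>mat_unit a n\<close> is an \<open>n\<close>-fold direct sum of copies of
  \<open>a\<close>. For \<open>n = 0\<close> it is zero, hence no equality.\<close>

lemma norm_diagonal: "N n (mat_unit a n) \<le> N 1 (mat1 a)"
proof (induction n)
  case 0
  have "mat_unit a 0 = 0" by (simp add: mat_unit_def fun_eq_iff)
  show ?case unfolding \<open>mat_unit a 0 = 0\<close> N_zero by (rule N_nonneg[OF mat1_mats])
next
  case (Suc n)
  have "mat_unit a (Suc n) = direct_sum n (mat_unit a n) (mat1 a)"
  proof (intro ext)
    fix i j
    show "mat_unit a (Suc n) i j = direct_sum n (mat_unit a n) (mat1 a) i j"
      by (rule less_or_add_cases[of i n]; rule less_or_add_cases[of j n])
        (simp_all add: mat_unit_def mat1_def direct_sum_simps)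
  qed
  moreover have "N (n + 1) (direct_sum n (mat_unit a n) (mat1 a)) = max (N n (mat_unit a n)) (N 1 (mat1 a))"
    by (rule norm_direct_sum[OF mat_unit_mats mat1_mats])
  ultimately show ?case using Suc by (simp only: Suc_eq_plus1 max_def split: if_split) simp
qed

end

section \<open>Norms of scalar matrices and of their tensors with a fixed element\<close>

lemma scalar_mnorm_least:
  assumes "\<alpha> \<in> mats n n"
    "\<And>\<xi>. L2_set (\<lambda>j. cmod (\<xi> j)) {..<n} \<le> 1 \<Longrightarrow> L2_set (\<lambda>i. cmod (\<Sum>j<n. \<alpha> i j * \<xi> j)) {..<n} \<le> M"
  shows "scalar_mnorm n \<alpha> \<le> M"
proof -
  have "(\<lambda>_. 0) \<in> {\<xi> :: nat \<Rightarrow> complex. L2_set (\<lambda>j. cmod (\<xi> j)) {..<n} \<le> 1}" by (simp add: L2_set_def)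
  then have "{\<xi> :: nat \<Rightarrow> complex. L2_set (\<lambda>j. cmod (\<xi> j)) {..<n} \<le> 1} \<noteq> {}"
    by (rule ex_in_conv[THEN iffD1, OF exI])
  then show ?thesis
    unfolding scalar_mnorm_def restrict_apply if_P[OF assms(1)]
    by (rule cSUP_least) (drule CollectD, erule assms(2))
qed

lemma scalar_mnorm_nonneg: "\<alpha> \<in> mats n n \<Longrightarrow> 0 \<le> scalar_mnorm n \<alpha>"
  using cstar_alg.norm_nonneg[OF scalar_cstar] .

lemma scalar_mnorm_star: "\<alpha> \<in> mats n n \<Longrightarrow> scalar_mnorm n (mat_star cnj \<alpha>) = scalar_mnorm n \<alpha>"
  using cstar_alg.norm_star[OF scalar_cstar] .

text \<open>Cauchy-Schwarz. The row is placed in a square matrix, as \<open>norm_sandwich\<close>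
  requires; columns are obtained by passing to the adjoint.\<close>

lemma scalar_mnorm_row:
  assumes "L2_set (\<lambda>j. cmod (v j)) {..<n} \<le> 1"
  shows "scalar_mnorm n (\<lambda>i j. if i = 0 \<and> j < n then v j else 0) \<le> 1"
proof (cases "n = 0")
  case False
  show ?thesis
  proof (rule scalar_mnorm_least)
    fix \<xi> :: "nat \<Rightarrow> complex" assume \<xi>: "L2_set (\<lambda>j. cmod (\<xi> j)) {..<n} \<le> 1"
    have "L2_set (\<lambda>i. cmod (\<Sum>j<n. (if i = 0 \<and> j < n then v j else 0) * \<xi> j)) {..<n}
        = L2_set (\<lambda>i. if i = 0 then cmod (\<Sum>j<n. v j * \<xi> j) else 0) {..<n}"
      by (intro L2_set_cong HOL.refl) auto
    also have "\<dots> = cmod (\<Sum>j<n. v j * \<xi> j)"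
      using False by (simp add: L2_set_def if_distrib[of "\<lambda>x. x\<^sup>2"] sum.delta cong: if_cong)
    also have "\<dots> \<le> (\<Sum>j<n. \<bar>cmod (v j)\<bar> * \<bar>cmod (\<xi> j)\<bar>)"
      using norm_sum[of "\<lambda>j. v j * \<xi> j" "{..<n}"] by (simp add: norm_mult)
    also have "\<dots> \<le> L2_set (\<lambda>j. cmod (v j)) {..<n} * L2_set (\<lambda>j. cmod (\<xi> j)) {..<n}"
      by (rule L2_set_mult_ineq)
    also have "\<dots> \<le> 1 * 1" using assms \<xi> by (intro mult_mono) auto
    finally show "L2_set (\<lambda>i. cmod (\<Sum>j<n. (if i = 0 \<and> j < n then v j else 0) * \<xi> j)) {..<n} \<le> 1" by simp
  qed (use False in \<open>auto simp: mats_def split: if_splits\<close>)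
next
  case True
  have z: "(\<lambda>i j. if i = 0 \<and> j < n then v j else 0) = 0" using True by (auto simp: fun_eq_iff)
  show ?thesis
    unfolding z using cstar_alg.norm_eq_0[OF scalar_cstar, of 0 n] by (simp add: zero_mats)
qed

text \<open>Upper bound: multiply the diagonal of copies of \<open>a\<close> by
  \<open>\<alpha>\<close>. Lower bound: for a vector \<open>\<xi>\<close> of length at most one,
  compress from the right by the column \<open>\<xi>\<close> and from the left by the row dual to
  \<open>\<alpha> \<xi>\<close>; the result is \<open>a\<close> scaled by the length of
  \<open>\<alpha> \<xi>\<close>. This cross norm formula will identify the complete isometries from
  \<open>\<complex>\<close> with the elements of norm one.\<close>

lemma (in op_space) norm_scalar_tensor:
  assumes \<alpha>: "\<alpha> \<in> mats n n"
  shows "N n (\<lambda>i j. \<alpha> i j *\<^sub>C a) = scalar_mnorm n \<alpha> * N 1 (mat1 a)"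
proof (rule antisym)
  let ?x = "\<lambda>i j. \<alpha> i j *\<^sub>C a"
  have x: "?x \<in> mats n n" using \<alpha> by (simp add: mats_iff)
  interpret C: cstar_alg "mats n n" "scalar_mult n" "mat_unit 1 n" "mat_star cnj" "scalar_mnorm n"
    by (rule scalar_cstar)
  have "?x = sandwich n \<alpha> (mat_unit a n) (mat_unit 1 n)"
  proof (intro ext)
    fix i j
    have "sandwich n \<alpha> (mat_unit a n) (mat_unit 1 n) i j
        = (\<Sum>k<n. \<Sum>l<n. if l = j then if k = j then \<alpha> i j *\<^sub>C a else 0 else 0)"
      unfolding sandwich_def by (intro sum.cong HOL.refl) (auto simp: mat_unit_def)
    also have "\<dots> = ?x i j" using \<alpha> by (cases "j < n") (simp_all add: sum.delta mats_outside)
    finally show "?x i j = sandwich n \<alpha> (mat_unit a n) (mat_unit 1 n) i j" by simp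
  qed
  then have "N n ?x \<le> scalar_mnorm n \<alpha> * N n (mat_unit a n) * scalar_mnorm n (mat_unit 1 n)"
    using norm_sandwich[OF \<alpha> mat_unit_mats mat_unit_mats] by simp
  also have "\<dots> \<le> scalar_mnorm n \<alpha> * N 1 (mat1 a) * 1"
    using C.norm_unit_le_1 \<alpha> N_nonneg[OF mat1_mats, of a]
    by (intro mult_mono mult_left_mono norm_diagonal) (auto simp: mat_unit_mats intro: N_nonneg)
  finally show "N n ?x \<le> scalar_mnorm n \<alpha> * N 1 (mat1 a)" by simp
  show "scalar_mnorm n \<alpha> * N 1 (mat1 a) \<le> N n ?x"
  proof (cases "N 1 (mat1 a) = 0")
    case True
    then show ?thesis using N_nonneg[OF x] by simp
  next
    case False
    then have a: "0 < N 1 (mat1 a)" using N_nonneg[OF mat1_mats, of a] by simp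
    have "scalar_mnorm n \<alpha> \<le> N n ?x / N 1 (mat1 a)"
    proof (rule scalar_mnorm_least[OF \<alpha>])
      fix \<xi> :: "nat \<Rightarrow> complex" assume \<xi>: "L2_set (\<lambda>j. cmod (\<xi> j)) {..<n} \<le> 1"
      define \<eta> where "\<eta> i = (\<Sum>j<n. \<alpha> i j * \<xi> j)" for i
      define L where "L = L2_set (\<lambda>i. cmod (\<eta> i)) {..<n}"
      show "L2_set (\<lambda>i. cmod (\<Sum>j<n. \<alpha> i j * \<xi> j)) {..<n} \<le> N n ?x / N 1 (mat1 a)"
      proof (cases "L = 0")
        case True
        then show ?thesis using N_nonneg[OF x] a by (simp add: L_def \<eta>_def)
      next
        case False
        then have L: "0 < L" by (simp add: L_def less_le)
        then have n: "0 < n" by (auto simp: L_def intro: gr0I)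
        \<comment> \<open>The normalized conjugate of \<open>\<eta> = \<alpha> \<xi>\<close>, so
          that this row times \<open>\<eta>\<close> is \<open>L\<close>.\<close>
        define \<rho> where "\<rho> i j = (if i = 0 \<and> j < n then cnj (\<eta> j) / of_real L else 0)" for i j :: nat
        define \<kappa> where "\<kappa> i j = (if j = 0 \<and> i < n then \<xi> i else 0)" for i j :: nat
        have \<rho>M: "\<rho> \<in> mats n n" and \<kappa>M: "\<kappa> \<in> mats n n"
          using n by (auto simp: \<rho>_def \<kappa>_def mats_def split: if_splits)
        have "L2_set (\<lambda>j. cmod (cnj (\<eta> j) / of_real L)) {..<n} = 1"
        proof -
          have "L2_set (\<lambda>j. cmod (cnj (\<eta> j) / of_real L)) {..<n} = L2_set (\<lambda>j. cmod (\<eta> j) * (1 / L)) {..<n}"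
            using L by (simp add: norm_divide)
          also have "\<dots> = L * (1 / L)"
            using L unfolding L_def by (intro L2_set_left_distrib[symmetric]) simp
          finally show ?thesis using L by simp
        qed
        then have \<rho>: "scalar_mnorm n \<rho> \<le> 1"
          unfolding \<rho>_def using scalar_mnorm_row[of "\<lambda>j. cnj (\<eta> j) / of_real L"] by simp
        have "mat_star cnj \<kappa> = (\<lambda>i j. if i = 0 \<and> j < n then cnj (\<xi> j) else 0)"
          by (auto simp: mat_star_def \<kappa>_def fun_eq_iff)
        then have \<kappa>: "scalar_mnorm n \<kappa> \<le> 1"
          using scalar_mnorm_row[of "\<lambda>j. cnj (\<xi> j)" n] scalar_mnorm_star[OF \<kappa>M] \<xi> by simp
        have "sandwich n \<rho> ?x \<kappa> = mat1 (of_real L *\<^sub>C a)"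
        proof (intro ext)
          fix i j
          show "sandwich n \<rho> ?x \<kappa> i j = mat1 (of_real L *\<^sub>C a) i j"
          proof (cases "i = 0 \<and> j = 0")
            case True
            have "sandwich n \<rho> ?x \<kappa> i j = (\<Sum>k<n. \<Sum>l<n. (cnj (\<eta> k) / of_real L * \<xi> l * \<alpha> k l) *\<^sub>C a)"
              unfolding sandwich_def using True
              by (intro sum.cong HOL.refl) (auto simp: \<rho>_def \<kappa>_def scaleC_scaleC)
            also have "\<dots> = (\<Sum>k<n. \<Sum>l<n. cnj (\<eta> k) / of_real L * \<xi> l * \<alpha> k l) *\<^sub>C a"
              by (simp add: cv.scale_sum_left)
            also have "(\<Sum>k<n. \<Sum>l<n. cnj (\<eta> k) / of_real L * \<xi> l * \<alpha> k l) = (\<Sum>k<n. \<eta> k * cnj (\<eta> k)) / of_real L"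
            proof -
              have "(\<Sum>l<n. c / of_real L * \<xi> l * \<alpha> k l) = \<eta> k * c / of_real L" for c k
                by (simp add: \<eta>_def sum_divide_distrib sum_distrib_left sum_distrib_right mult_ac)
              then show ?thesis by (simp add: sum_divide_distrib)
            qed
            also have "(\<Sum>k<n. \<eta> k * cnj (\<eta> k)) = of_real (L\<^sup>2)"
              by (simp add: L_def L2_set_def complex_norm_square sum_nonneg del: of_real_power)
            also have "of_real (L\<^sup>2) / of_real L = complex_of_real L" using L by (simp add: power2_eq_square)
            finally show ?thesis using True by (simp add: mat1_def)
          next
            case False
            then have "sandwich n \<rho> ?x \<kappa> i j = 0"
              unfolding sandwich_def by (intro sum.neutral ballI) (auto simp: \<rho>_def \<kappa>_def)
            then show ?thesis using False by (auto simp: mat1_def)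
          qed
        qed
        moreover have "mat1 (of_real L *\<^sub>C a) = of_real L *\<^sub>C mat1 a"
          by (auto simp: mat1_def scaleC_fun_def fun_eq_iff)
        moreover have "N n (of_real L *\<^sub>C mat1 a) = L * N 1 (mat1 a)"
          using N_scale[of "mat1 a" n "of_real L"] norm_pad[OF mat1_mats, of n a] n L mats_mono[OF mat1_mats, of n n a]
          by simp
        ultimately have "L * N 1 (mat1 a) \<le> scalar_mnorm n \<rho> * N n ?x * scalar_mnorm n \<kappa>"
          using norm_sandwich[OF \<rho>M x \<kappa>M] by simp
        also have "\<dots> \<le> 1 * N n ?x * 1"
          using \<rho> \<kappa> N_nonneg[OF x] scalar_mnorm_nonneg[OF \<rho>M] scalar_mnorm_nonneg[OF \<kappa>M]
          by (intro mult_mono) auto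
        finally show ?thesis using a by (simp add: L_def \<eta>_def field_simps)
      qed
    qed
    then show ?thesis using a by (simp add: field_simps)
  qed
qed

lemma norm_on_subset: "norm_on V \<nu> \<Longrightarrow> W \<subseteq> V \<Longrightarrow> norm_on W \<nu>"
  by (auto simp: norm_on_def subset_iff)

section \<open>The canonical operator space structure\<close>

lemma sum_lessThan_add: "(\<Sum>k<m + n. f k) = (\<Sum>k<m. f k) + (\<Sum>k<n. f (m + k))"
  for f :: "nat \<Rightarrow> 'a::comm_monoid_add"
  by (induction n) (simp_all add: add.assoc)

context full_star_alg
begin

lemma mat_mult_pad:
  assumes "x \<in> mats n n" "y \<in> mats n n" "n \<le> m"
  shows "mat_mult mul m x y = mat_mult mul n x y"
proof (intro ext)
  fix i j
  show "mat_mult mul m x y i j = mat_mult mul n x y i j"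
    unfolding mat_mult_def
    by (rule sum.mono_neutral_right) (use assms in \<open>auto simp: mats_iff\<close>)
qed

lemma mat_mult_direct_sum:
  "mat_mult mul (m + n) (direct_sum m x y) (direct_sum m x' y')
    = direct_sum m (mat_mult mul m x x') (mat_mult mul n y y')"
proof (intro ext)
  fix i j
  show "mat_mult mul (m + n) (direct_sum m x y) (direct_sum m x' y') i j
    = direct_sum m (mat_mult mul m x x') (mat_mult mul n y y') i j"
    by (rule less_or_add_cases[of i m]; rule less_or_add_cases[of j m])
      (simp_all add: mat_mult_def sum_lessThan_add direct_sum_simps cong: sum.cong_simp)
qed

lemma mat_star_direct_sum: "mat_star star (direct_sum m x y) = direct_sum m (mat_star star x) (mat_star star y)"
proof (intro ext)
  fix i j
  show "mat_star star (direct_sum m x y) i j = direct_sum m (mat_star star x) (mat_star star y) i j"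
    by (rule less_or_add_cases[of i m]; rule less_or_add_cases[of j m])
      (simp_all add: mat_star_def direct_sum_simps)
qed

definition scalars :: "complex matrix \<Rightarrow> 'a matrix"
  where "scalars \<alpha> = (\<lambda>i j. \<alpha> i j *\<^sub>C e)"

lemma scalars_mats [simp]: "\<alpha> \<in> mats n r \<Longrightarrow> scalars \<alpha> \<in> mats n r"
  by (simp add: scalars_def mats_iff)

lemma scalars_mult: "mat_mult mul n (scalars \<alpha>) (scalars \<beta>) = scalars (scalar_mult n \<alpha> \<beta>)"
  by (simp add: scalars_def mat_mult_def mul_scale_left mul_scale_right scaleC_scaleC cv.scale_sum_left mult.commute)

lemma scalars_star: "mat_star star (scalars \<alpha>) = scalars (mat_star cnj \<alpha>)"
  by (simp add: scalars_def mat_star_def star_scale)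

text \<open>Turns the bimodule axiom of operator spaces into submultiplicativity of the algebra
  norm, once scalar matrices are known to embed contractively.\<close>

lemma sandwich_eq: "sandwich m \<alpha> x \<beta> = mat_mult mul m (mat_mult mul m (scalars \<alpha>) x) (scalars \<beta>)"
proof (intro ext)
  fix i j
  have "mat_mult mul m (mat_mult mul m (scalars \<alpha>) x) (scalars \<beta>) i j
      = (\<Sum>l<m. \<Sum>k<m. (\<alpha> i k * \<beta> l j) *\<^sub>C x k l)"
    by (simp add: mat_mult_def scalars_def mul_scale_left mul_scale_right mul_sum_left cv.scale_sum_right
        scaleC_scaleC mult.commute)
  then show "sandwich m \<alpha> x \<beta> i j = mat_mult mul m (mat_mult mul m (scalars \<alpha>) x) (scalars \<beta>) i j"
    unfolding sandwich_def by (subst sum.swap) simp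
qed

end

text \<open>The levels \<open>N n\<close> are C*-norms independently of each other, and none is tied
  to \<open>\<nu>\<close> except through the algebra. All compatibility between them, which is what
  an operator space asks for, is derived from uniqueness of C*-norms and contractivity of star
  homomorphisms.\<close>

locale cstar_matrices = full_star_alg mul e star for mul and e :: "'a::complex_vector" and star +
  fixes \<nu> :: "'a \<Rightarrow> real" and N :: "'a mnorm"
  assumes base: "cstar_alg UNIV mul e star \<nu>"
    and mats_cstar: "cstar_alg (mats n n) (mat_mult mul n) (mat_unit e n) (mat_star star) (N n)"
    and mats_extensional: "N n \<in> extensional (mats n n)"
begin

sublocale M: cstar_alg "mats n n" "mat_mult mul n" "mat_unit e n" "mat_star star" "N n" for n
  by (rule mats_cstar)

text \<open>The \<open>n \<times> n\<close> corner is closed under products and adjoints of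
  \<open>m \<times> m\<close> matrices, so \<open>N m\<close> restricts to a C*-norm on it, and
  uniqueness applies.\<close>

lemma pad:
  assumes x: "x \<in> mats n n" and nm: "n \<le> m"
  shows "N m x = N n x"
proof (rule cstar_norm_unique[OF _ mats_cstar x])
  have mono: "x \<in> mats n n \<Longrightarrow> x \<in> mats m m" for x :: "'a matrix" using mats_mono nm by blast
  show "cstar_alg (mats n n) (mat_mult mul n) (mat_unit e n) (mat_star star) (N m)"
  proof
    show "norm_on (mats n n) (N m)"
      using norm_on_subset[OF M.norm[of m]] mono by blast
    fix a b :: "'a matrix" assume a: "a \<in> mats n n"
    show "N m (mat_mult mul n (mat_star star a) a) = (N m a)\<^sup>2"
      using mat_mult_pad[OF M.star_closed[OF a] a nm] M.norm_star_mul[OF mono[OF a]] by simp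
    assume b: "b \<in> mats n n"
    show "N m (mat_mult mul n a b) \<le> N m a * N m b"
      using mat_mult_pad[OF a b nm] M.norm_mul[OF mono[OF a] mono[OF b]] by simp
  qed
qed

lemma norm_mat1: "N 1 (mat1 a) = \<nu> a"
proof (rule cstar_norm_unique[OF _ base UNIV_I])
  have mult: "mat_mult mul 1 (mat1 a) (mat1 b) = mat1 (mul a b)" for a b
    by (auto simp: mat_mult_def mat1_def fun_eq_iff)
  have star: "mat_star star (mat1 a) = mat1 (star a)" for a
    by (auto simp: mat_star_def mat1_def fun_eq_iff)
  have lin: "mat1 (a + b) = mat1 a + mat1 b" "mat1 (c *\<^sub>C a) = c *\<^sub>C mat1 a" "mat1 0 = 0" for a b :: 'a and c
    by (auto simp: mat1_def fun_eq_iff scaleC_fun_def)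
  have inj: "mat1 a = 0 \<longleftrightarrow> a = 0" for a :: 'a
    by (auto simp: mat1_def fun_eq_iff)
  show "cstar_alg UNIV mul e star (\<lambda>a. N 1 (mat1 a))"
  proof
    show "norm_on UNIV (\<lambda>a. N 1 (mat1 a))"
      unfolding norm_on_def
      using M.norm_nonneg[OF mat1_mats] M.norm_eq_0[OF mat1_mats] M.norm_scale[OF mat1_mats] M.norm_add[OF mat1_mats mat1_mats]
      by (simp add: lin inj)
    fix a b :: 'a
    show "N 1 (mat1 (mul a b)) \<le> N 1 (mat1 a) * N 1 (mat1 b)"
      using M.norm_mul[OF mat1_mats mat1_mats, of a b] unfolding mult .
    show "N 1 (mat1 (mul (star a) a)) = (N 1 (mat1 a))\<^sup>2"
      using M.norm_star_mul[OF mat1_mats, of a] unfolding mult star .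
  qed
qed

text \<open>As for the upper corner: \<open>y \<mapsto> 0 \<oplus> y\<close> is an injective star
  homomorphism, so it pulls \<open>N (m + n)\<close> back to a C*-norm.\<close>

lemma direct_sum_corner:
  assumes y: "y \<in> mats n n"
  shows "N (m + n) (direct_sum m 0 y) = N n y"
proof (rule cstar_norm_unique[OF _ mats_cstar y])
  have M: "y \<in> mats n n \<Longrightarrow> direct_sum m 0 y \<in> mats (m + n) (m + n)" for y :: "'a matrix"
    by (rule direct_sum_mats[OF zero_mats])
  have lin: "direct_sum m 0 (a + b) = direct_sum m 0 a + direct_sum m 0 b"
    "direct_sum m 0 (c *\<^sub>C a) = c *\<^sub>C direct_sum m 0 a" for a b :: "'a matrix" and c
    by (auto simp: direct_sum_def fun_eq_iff scaleC_fun_def)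
  have inj: "a = 0" if "direct_sum m 0 a = 0" for a :: "'a matrix"
  proof (intro ext)
    fix i j
    show "a i j = 0 i j" using fun_cong[OF fun_cong[OF that, of "i + m"], of "j + m"] by (simp add: direct_sum_def)
  qed
  have z: "direct_sum m (0 :: 'a matrix) 0 = 0" by (simp add: direct_sum_def fun_eq_iff)
  have mult: "direct_sum m 0 (mat_mult mul n a b) = mat_mult mul (m + n) (direct_sum m 0 a) (direct_sum m 0 b)" for a b
  proof -
    have "mat_mult mul m 0 0 = 0" by (simp add: mat_mult_def fun_eq_iff)
    then show ?thesis by (simp only: mat_mult_direct_sum)
  qed
  have star: "direct_sum m 0 (mat_star star a) = mat_star star (direct_sum m 0 a)" for a
  proof -
    have "mat_star star 0 = 0" by (simp add: mat_star_def fun_eq_iff)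
    then show ?thesis by (simp only: mat_star_direct_sum)
  qed
  show "cstar_alg (mats n n) (mat_mult mul n) (mat_unit e n) (mat_star star) (\<lambda>y. N (m + n) (direct_sum m 0 y))"
  proof
    show "norm_on (mats n n) (\<lambda>y. N (m + n) (direct_sum m 0 y))"
      unfolding norm_on_def lin using M.norm_nonneg M.norm_eq_0 M.norm_add M.norm_scale M inj z by metis
    fix a b :: "'a matrix" assume a: "a \<in> mats n n"
    show "N (m + n) (direct_sum m 0 (mat_mult mul n (mat_star star a) a)) = (N (m + n) (direct_sum m 0 a))\<^sup>2"
      unfolding mult star by (rule M.norm_star_mul[OF M[OF a]])
    assume b: "b \<in> mats n n"
    show "N (m + n) (direct_sum m 0 (mat_mult mul n a b)) \<le> N (m + n) (direct_sum m 0 a) * N (m + n) (direct_sum m 0 b)"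
      unfolding mult by (rule M.norm_mul[OF M[OF a] M[OF b]])
  qed
qed

text \<open>\<open>(x, y) \<mapsto> x \<oplus> y\<close> is a star homomorphism on pairs with the
  maximum norm, hence contractive; pairs enter only as a semigroup with star, the generality in
  which the iteration argument is stated. Conversely \<open>x\<close> and
  \<open>0 \<oplus> y\<close> arise from \<open>x \<oplus> y\<close> by multiplication with
  projections.\<close>

lemma norm_direct_sum:
  assumes x: "x \<in> mats m m" and y: "y \<in> mats n n"
  shows "N (m + n) (direct_sum m x y) = max (N m x) (N n y)"
proof (rule antisym)
  let ?D = "mats m m \<times> mats n n :: ('a matrix \<times> 'a matrix) set"
  let ?s = "\<lambda>(x, y). N (m + n) (direct_sum m x y)"
  let ?\<nu> = "\<lambda>(x, y). max (N m x) (N n y)"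
  have split: "direct_sum m x y = x + direct_sum m 0 y" if "x \<in> mats m m" for x y :: "'a matrix"
    using that by (intro ext) (auto simp: direct_sum_def mats_iff)
  have "?s (x, y) \<le> ?\<nu> (x, y)"
  proof (rule star_semigroup_norm_le[where D = ?D and C = 2
        and mul = "\<lambda>(x, y) (x', y'). (mat_mult mul m x x', mat_mult mul n y y')"
        and star = "\<lambda>(x, y). (mat_star star x, mat_star star y)"], goal_cases)
    \<comment> \<open>The numbers refer to the hypotheses of the iteration lemma: 3 is the
      C*-identity, 5 submultiplicativity, and 7 the bound with \<open>C = 2\<close>, which comes
      from the triangle inequality for \<open>x + (0 \<oplus> y)\<close>.\<close>
    case (3 p)
    then show ?case
      by (auto simp: mat_mult_direct_sum[symmetric] mat_star_direct_sum[symmetric] direct_sum_mats M.norm_star_mul)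
  next
    case (5 p q)
    then obtain a b c d where pq: "p = (a, b)" "q = (c, d)" and
      M: "a \<in> mats m m" "b \<in> mats n n" "c \<in> mats m m" "d \<in> mats n n" by auto
    have "N m (mat_mult mul m a c) \<le> N m a * N m c" "N n (mat_mult mul n b d) \<le> N n b * N n d"
      using M by (auto intro: M.norm_mul)
    moreover have "N m a * N m c \<le> max (N m a) (N n b) * max (N m c) (N n d)"
      "N n b * N n d \<le> max (N m a) (N n b) * max (N m c) (N n d)"
      using M by (auto intro!: mult_mono simp: le_max_iff_disj)
    ultimately show ?case by (simp add: pq)
  next
    case (7 p)
    then obtain a b where p: "p = (a, b)" and M: "a \<in> mats m m" "b \<in> mats n n" by auto
    have "N (m + n) (direct_sum m a b) \<le> N (m + n) a + N (m + n) (direct_sum m 0 b)"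
      unfolding split[OF M(1)]
      using mats_mono[OF M(1), of "m + n" "m + n"] direct_sum_mats[OF zero_mats M(2), of m] by (intro M.norm_add) auto
    also have "\<dots> = N m a + N n b" using pad[OF M(1), of "m + n"] direct_sum_corner[OF M(2), of m] by simp
    finally show ?case by (simp add: p)
  qed (use x y in \<open>auto simp: le_max_iff_disj\<close>)
  then show "N (m + n) (direct_sum m x y) \<le> max (N m x) (N n y)" by simp
  let ?p = "mat_unit e m" and ?q = "direct_sum m 0 (mat_unit e n)" and ?d = "direct_sum m x y"
  have d: "?d \<in> mats (m + n) (m + n)" using x y by (rule direct_sum_mats)
  have m0: "mat_mult mul k 0 z = 0" for k z by (simp add: mat_mult_def fun_eq_iff)
  have p: "?p \<in> mats (m + n) (m + n)" by (rule mats_mono[OF mat_unit_mats]) auto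
  have q: "?q \<in> mats (m + n) (m + n)" by (rule direct_sum_mats[OF zero_mats mat_unit_mats])
  have p1: "N (m + n) ?p \<le> 1" using pad[OF mat_unit_mats, of m "m + n" e] M.norm_unit_le_1[of m] by simp
  have q1: "N (m + n) ?q \<le> 1" using direct_sum_corner[OF mat_unit_mats] M.norm_unit_le_1 by simp
  have "x = mat_mult mul (m + n) (direct_sum m ?p 0) ?d"
    unfolding mat_mult_direct_sum m0 using x by (simp add: mat_unit_mult direct_sum_zero)
  then have "x = mat_mult mul (m + n) ?p ?d" by (simp add: direct_sum_zero mat_unit_mats)
  then have "N (m + n) x \<le> N (m + n) ?p * N (m + n) ?d" using M.norm_mul[OF p d] by simp
  then have "N m x \<le> N (m + n) ?d"
    using p1 M.norm_nonneg[OF d] mult_right_mono[OF p1 M.norm_nonneg[OF d]] pad[OF x, of "m + n"] by simp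
  moreover have "direct_sum m 0 y = mat_mult mul (m + n) ?q ?d"
    unfolding mat_mult_direct_sum m0 using y by (simp add: mat_unit_mult)
  then have "N (m + n) (direct_sum m 0 y) \<le> N (m + n) ?q * N (m + n) ?d" using M.norm_mul[OF q d] by simp
  then have "N n y \<le> N (m + n) ?d"
    using q1 M.norm_nonneg[OF d] mult_right_mono[OF q1 M.norm_nonneg[OF d]] direct_sum_corner[OF y] by simp
  ultimately show "max (N m x) (N n y) \<le> N (m + n) (direct_sum m x y)" by simp
qed

text \<open>\<open>scalars\<close> is a star homomorphism, so the pullback of \<open>N n\<close> is
  a C*-seminorm. It need not be definite, since \<open>e\<close> is \<open>0\<close> in the zero
  algebra.\<close>

lemma norm_scalars_le:
  assumes "\<alpha> \<in> mats n n"
  shows "N n (scalars \<alpha>) \<le> scalar_mnorm n \<alpha>"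
proof -
  interpret C: cstar_alg "mats n n" "scalar_mult n" "mat_unit 1 n" "mat_star cnj" "scalar_mnorm n"
    by (rule scalar_cstar)
  have lin: "scalars (x + y) = scalars x + scalars y" "scalars (c *\<^sub>C x) = c *\<^sub>C scalars x" for x y c
    by (simp_all add: scalars_def fun_eq_iff scaleC_add_left scaleC_fun_def scaleC_complex_def scaleC_scaleC)
  show ?thesis
    by (rule C.cstar_seminorm_le[of "\<lambda>\<alpha>. N n (scalars \<alpha>)", OF _ _ _ assms])
      (simp_all add: lin M.norm_add M.norm_scale scalars_mult[symmetric] scalars_star[symmetric] M.norm_star_mul)
qed

lemma norm_sandwich:
  assumes "\<alpha> \<in> mats m m" "x \<in> mats m m" "\<beta> \<in> mats m m"
  shows "N m (sandwich m \<alpha> x \<beta>) \<le> scalar_mnorm m \<alpha> * N m x * scalar_mnorm m \<beta>"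
proof -
  have "N m (sandwich m \<alpha> x \<beta>) \<le> N m (mat_mult mul m (scalars \<alpha>) x) * N m (scalars \<beta>)"
    unfolding sandwich_eq using assms by (intro M.norm_mul) auto
  also have "\<dots> \<le> (N m (scalars \<alpha>) * N m x) * N m (scalars \<beta>)"
    using assms by (intro mult_right_mono M.norm_mul) auto
  also have "\<dots> \<le> scalar_mnorm m \<alpha> * N m x * scalar_mnorm m \<beta>"
    using assms by (intro mult_mono norm_scalars_le) (auto simp: scalar_mnorm_nonneg)
  finally show ?thesis .
qed

theorem operator_space: "operator_space N"
proof -
  have fd: "fin_dim (UNIV :: 'a set)" by (rule fin_dim)
  have "norm_on UNIV \<nu>" using base by (rule cstar_alg.norm)
  then have "Metric_space.mcomplete UNIV (\<lambda>a b. N 1 (mat1 (a - b)))"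
    unfolding norm_mat1 by (rule mcomplete_fin_dim[OF fd])
  then show ?thesis
    unfolding operator_space_def using M.norm mats_extensional norm_direct_sum norm_sandwich by blast
qed

end

section \<open>Operator spaces with a contractive product\<close>

text \<open>Abstracts what a categorical algebra provides: \<open>N\<close> is the given operator
  space structure and \<open>K\<close> the family of C*-norms. \<open>N\<close> is C* at level one,
  and at higher levels only compatible with product, scalars and star. The goal is
  \<open>N n x = K n x\<close> on matrices.\<close>

locale operator_star_alg = O: op_space N + cstar_matrices mul e star "\<lambda>a. N 1 (mat1 a)" K
  for N :: "'a::complex_vector mnorm" and mul e star and K :: "'a mnorm" +
  assumes N_mult: "x \<in> mats n n \<Longrightarrow> y \<in> mats n n \<Longrightarrow> N n (mat_mult mul n x y) \<le> N n x * N n y"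
    and N_scalars: "\<alpha> \<in> mats n n \<Longrightarrow> N n (scalars \<alpha>) \<le> scalar_mnorm n \<alpha>"
    and N_star: "x \<in> mats n n \<Longrightarrow> N n (mat_star star x) \<le> N n x"
begin

lemma K_le_N:
  assumes "x \<in> mats n n" shows "K n x \<le> N n x"
proof -
  obtain C where C: "0 \<le> C" "\<And>x. x \<in> mats n n \<Longrightarrow> K n x \<le> C * N n x"
    using seminorm_bound[where s = "K n", OF M.fin_dim O.norm[of n] M.norm_add M.norm_scale] by metis
  show ?thesis
    by (rule star_semigroup_norm_le[where D = "mats n n" and mul = "mat_mult mul n" and star = "mat_star star" and C = C])
      (use C assms in \<open>simp_all add: M.norm_star_mul N_mult N_star O.N_nonneg\<close>)
qed

lemma N_unit_le_1: "N n (mat_unit e n) \<le> 1"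
proof -
  have "mat_unit e n = scalars (mat_unit 1 n)"
    by (simp add: scalars_def mat_unit_def fun_eq_iff scaleC_one)
  then have "N n (mat_unit e n) \<le> scalar_mnorm n (mat_unit 1 n)"
    using N_scalars[OF mat_unit_mats, of n 1] by simp
  then show ?thesis using cstar_alg.norm_unit_le_1[OF scalar_cstar, of n] by linarith
qed

lemma N_sum_le: "(\<And>i. i \<in> I \<Longrightarrow> f i \<in> mats n n) \<Longrightarrow> finite I \<Longrightarrow> N n (\<Sum>i\<in>I. f i) \<le> (\<Sum>i\<in>I. N n (f i))"
  by (rule seminorm_sum_le[where s = "N n", OF subspace_mats _ _ O.N_zero O.N_add])

text \<open>Vidav's notion of a hermitian element, with \<open>O(t\<^sup>2)\<close> in place of \<open>o(t)\<close>.\<close>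

definition herm :: "nat \<Rightarrow> 'a matrix \<Rightarrow> bool"
  where "herm n H \<longleftrightarrow> H \<in> mats n n \<and>
    (\<exists>C\<ge>0. \<forall>t::real. N n (mat_unit e n + (\<i> * of_real t) *\<^sub>C H) \<le> 1 + C * t\<^sup>2)"

text \<open>For \<open>\<bar>t\<bar> > 1\<close> the triangle inequality gives
  \<open>1 + \<bar>t\<bar> N(H)\<close>, which is at most \<open>1 + N(H) t\<^sup>2\<close>. Hence
  the constant \<open>C + N(H)\<close> for all \<open>t\<close>.\<close>

lemma hermI:
  assumes H: "H \<in> mats n n" and C: "0 \<le> C"
    "\<And>t::real. \<bar>t\<bar> \<le> 1 \<Longrightarrow> N n (mat_unit e n + (\<i> * of_real t) *\<^sub>C H) \<le> 1 + C * t\<^sup>2"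
  shows "herm n H"
  unfolding herm_def
proof (intro conjI exI[of _ "C + N n H"] allI)
  fix t :: real
  show "N n (mat_unit e n + (\<i> * of_real t) *\<^sub>C H) \<le> 1 + (C + N n H) * t\<^sup>2"
  proof (cases "\<bar>t\<bar> \<le> 1")
    case True
    have "0 \<le> N n H * t\<^sup>2" using O.N_nonneg[OF H] by simp
    then show ?thesis using C(2)[OF True] by (simp add: distrib_right)
  next
    case False
    have "N n (mat_unit e n + (\<i> * of_real t) *\<^sub>C H) \<le> N n (mat_unit e n) + N n ((\<i> * of_real t) *\<^sub>C H)"
      using H by (intro O.N_add) simp_all
    also have "\<dots> \<le> 1 + \<bar>t\<bar> * N n H"
      using N_unit_le_1 O.N_scale[OF H] by (simp add: norm_mult)
    also have "\<dots> \<le> 1 + t\<^sup>2 * N n H"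
    proof -
      have "\<bar>t\<bar> * 1 \<le> \<bar>t\<bar> * \<bar>t\<bar>" using False by (intro mult_left_mono) auto
      then have "\<bar>t\<bar> \<le> t\<^sup>2" by (simp add: power2_eq_square)
      then show ?thesis using O.N_nonneg[OF H] by (simp add: mult_right_mono)
    qed
    also have "\<dots> \<le> 1 + (C + N n H) * t\<^sup>2"
      using C(1) by (simp add: algebra_simps)
    finally show ?thesis .
  qed
qed (use H C O.N_nonneg[OF H] in auto)

lemma herm_zero: "herm n 0"
  by (rule hermI[of _ _ 0]) (simp_all add: cv.scale_zero_right N_unit_le_1)

lemma herm_scale:
  assumes "herm n H" shows "herm n (complex_of_real c *\<^sub>C H)"
proof -
  from assms obtain C where C: "H \<in> mats n n" "0 \<le> C"
    "\<And>t::real. N n (mat_unit e n + (\<i> * of_real t) *\<^sub>C H) \<le> 1 + C * t\<^sup>2"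
    unfolding herm_def by auto
  show ?thesis
    unfolding herm_def
  proof (intro conjI exI[of _ "C * c\<^sup>2"] allI)
    fix t :: real
    show "N n (mat_unit e n + (\<i> * of_real t) *\<^sub>C complex_of_real c *\<^sub>C H) \<le> 1 + C * c\<^sup>2 * t\<^sup>2"
      using C(3)[of "t * c"] by (simp add: scaleC_scaleC power_mult_distrib mult_ac)
  qed (use C in auto)
qed

text \<open>\<open>(1 + i t H) (1 + i t L)\<close> differs from \<open>1 + i t (H + L)\<close> by
  \<open>t\<^sup>2 H L\<close>, so submultiplicativity gives the estimate; \<open>N n P\<close> in
  the constant accounts for this error. For \<open>\<bar>t\<bar> \<le> 1\<close> the term
  \<open>C D t\<^sup>4\<close> is at most \<open>C D t\<^sup>2\<close>.\<close>

lemma herm_add: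
  assumes "herm n H" "herm n L" shows "herm n (H + L)"
proof -
  from assms obtain C D where C: "H \<in> mats n n" "0 \<le> C"
    "\<And>t::real. N n (mat_unit e n + (\<i> * of_real t) *\<^sub>C H) \<le> 1 + C * t\<^sup>2"
    and D: "L \<in> mats n n" "0 \<le> D"
    "\<And>t::real. N n (mat_unit e n + (\<i> * of_real t) *\<^sub>C L) \<le> 1 + D * t\<^sup>2"
    unfolding herm_def by auto
  define P where "P = mat_mult mul n H L"
  have P: "P \<in> mats n n" using C(1) D(1) by (simp add: P_def)
  show ?thesis
  proof (rule hermI[of _ _ "C + D + C * D + N n P"])
    show "H + L \<in> mats n n" using C(1) D(1) by simp
    show "0 \<le> C + D + C * D + N n P" using C(2) D(2) O.N_nonneg[OF P] by simp
    fix t :: real assume t: "\<bar>t\<bar> \<le> 1"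
    let ?z = "\<i> * complex_of_real t"
    let ?U = "mat_unit e n + ?z *\<^sub>C H" and ?V = "mat_unit e n + ?z *\<^sub>C L"
    define Y where "Y = mat_unit e n + ?z *\<^sub>C (H + L)"
    have UV: "?U \<in> mats n n" "?V \<in> mats n n" using C(1) D(1) by simp_all
    have z2: "?z * ?z = - (of_real (t\<^sup>2))" by (simp add: complex_eq_iff power2_eq_square)
    have "mat_mult mul n ?U ?V = mat_unit e n + ?z *\<^sub>C (H + L) + (?z * ?z) *\<^sub>C P"
      using C(1) D(1) by (simp add: M.mul_add_left M.mul_add_right M.mul_scale_left M.mul_scale_right
          scaleC_add_right scaleC_scaleC P_def del: mult_minus_left)
    then have "Y = mat_mult mul n ?U ?V + complex_of_real (t\<^sup>2) *\<^sub>C P"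
      unfolding z2 Y_def by (simp add: cv.scale_minus_left)
    then have "N n Y \<le> N n (mat_mult mul n ?U ?V) + N n (complex_of_real (t\<^sup>2) *\<^sub>C P)"
      using UV P by (simp only:) (intro O.N_add, simp_all)
    also have "N n (complex_of_real (t\<^sup>2) *\<^sub>C P) = t\<^sup>2 * N n P"
      using O.N_scale[OF P, of "complex_of_real (t\<^sup>2)"] by (simp del: of_real_power)
    also have "N n (mat_mult mul n ?U ?V) \<le> N n ?U * N n ?V" using UV by (rule N_mult)
    also have "\<dots> \<le> (1 + C * t\<^sup>2) * (1 + D * t\<^sup>2)"
      using C D O.N_nonneg[OF UV(1)] O.N_nonneg[OF UV(2)] by (intro mult_mono) auto
    also have "\<dots> \<le> 1 + (C + D + C * D) * t\<^sup>2"
    proof -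
      have "t\<^sup>2 \<le> 1" using t by (simp add: abs_square_le_1)
      then have "t\<^sup>2 * t\<^sup>2 \<le> t\<^sup>2 * 1" by (intro mult_left_mono) auto
      then have "(C * D) * (t\<^sup>2 * t\<^sup>2) \<le> (C * D) * t\<^sup>2" using C(2) D(2) by (intro mult_left_mono) auto
      then show ?thesis by (simp add: algebra_simps)
    qed
    finally show "N n (mat_unit e n + ?z *\<^sub>C (H + L)) \<le> 1 + (C + D + C * D + N n P) * t\<^sup>2"
      unfolding Y_def[symmetric] by (simp add: algebra_simps)
  qed
qed

lemma herm_diff: "herm n H \<Longrightarrow> herm n L \<Longrightarrow> herm n (H - L)"
  using herm_add[of n H "complex_of_real (-1) *\<^sub>C L"] herm_scale[of n L "-1"] by (simp add: scaleC_minus1)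

lemma herm_sum: "finite I \<Longrightarrow> (\<And>i. i \<in> I \<Longrightarrow> herm n (f i)) \<Longrightarrow> herm n (\<Sum>i\<in>I. f i)"
  by (induction I rule: finite_induct) (simp_all add: herm_zero herm_add)

text \<open>The element \<open>v v\<^sup>* \<otimes> h\<close>, whose scalar factor is a multiple of
  a rank-one projection.\<close>

definition rank_one :: "nat \<Rightarrow> (nat \<Rightarrow> complex) \<Rightarrow> 'a \<Rightarrow> 'a matrix"
  where "rank_one n v h = (\<lambda>i j. if i < n \<and> j < n then (v i * cnj (v j)) *\<^sub>C h else 0)"

text \<open>\<open>(1 + i t h)\<^sup>* (1 + i t h) = 1 + t\<^sup>2 h\<^sup>2\<close>, and the
  C*-identity is available at level one. The square root is avoided by
  \<open>1 + c \<le> (1 + c)\<^sup>2\<close>.\<close>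

lemma norm_unit_plus:
  assumes "star h = h"
  shows "N 1 (mat1 (e + (\<i> * complex_of_real t) *\<^sub>C h)) \<le> 1 + (N 1 (mat1 h))\<^sup>2 * t\<^sup>2"
proof -
  interpret A: cstar_alg UNIV mul e star "\<lambda>a. N 1 (mat1 a)" by (rule base)
  define \<nu> where "\<nu> a = N 1 (mat1 a)" for a
  let ?z = "\<i> * complex_of_real t" and ?c = "(\<nu> h)\<^sup>2 * t\<^sup>2"
  have "star (e + ?z *\<^sub>C h) = e + (- ?z) *\<^sub>C h" using assms by (simp add: star_add star_scale)
  then have "mul (star (e + ?z *\<^sub>C h)) (e + ?z *\<^sub>C h) = e + (- ?z * ?z) *\<^sub>C mul h h"
    by (simp add: mul_add_left mul_add_right mul_scale_left mul_scale_right scaleC_scaleC cv.scale_minus_left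
        mul_diff cv.scale_right_diff_distrib)
  also have "- ?z * ?z = complex_of_real (t\<^sup>2)" by (simp add: complex_eq_iff power2_eq_square)
  finally have eq: "mul (star (e + ?z *\<^sub>C h)) (e + ?z *\<^sub>C h) = e + complex_of_real (t\<^sup>2) *\<^sub>C mul h h" .
  have "(\<nu> (e + ?z *\<^sub>C h))\<^sup>2 = \<nu> (e + complex_of_real (t\<^sup>2) *\<^sub>C mul h h)"
    using A.norm_star_mul[of "e + ?z *\<^sub>C h"] unfolding eq \<nu>_def by simp
  also have "\<dots> \<le> \<nu> e + \<nu> (complex_of_real (t\<^sup>2) *\<^sub>C mul h h)"
    unfolding \<nu>_def by (rule A.norm_add) simp_all
  also have "\<dots> \<le> 1 + t\<^sup>2 * (\<nu> h * \<nu> h)"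
    using A.norm_unit_le_1 A.norm_scale[of "mul h h" "complex_of_real (t\<^sup>2)"] A.norm_mul[of h h]
    unfolding \<nu>_def by (intro add_mono) (simp_all add: mult_left_mono del: of_real_power)
  also have "\<dots> = 1 + ?c" by (simp add: power2_eq_square)
  also have "\<dots> \<le> (1 + ?c)\<^sup>2" by (rule self_le_power) simp_all
  finally have "\<nu> (e + ?z *\<^sub>C h) \<le> 1 + ?c" by (rule power2_le_imp_le) simp
  then show ?thesis by (simp add: \<nu>_def)
qed

text \<open>With \<open>p = v v\<^sup>*\<close> and \<open>\<alpha> = [1 - p, v]\<close>, a co-isometry, \<open>1 + i t p \<otimes> h\<close> equals
  \<open>\<alpha> (1 \<oplus> (1 + i t h)) \<alpha>\<^sup>*\<close>.\<close>

lemma herm_rank_one_unit: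
  assumes v: "(\<Sum>k<n. v k * cnj (v k)) = 1" and h: "star h = h"
  shows "herm n (rank_one n v h)"
proof -
  interpret C: cstar_alg "mats (Suc n) (Suc n)" "scalar_mult (Suc n)" "mat_unit 1 (Suc n)" "mat_star cnj" "scalar_mnorm (Suc n)"
    by (rule scalar_cstar)
  interpret F: full_star_alg "(*) :: complex \<Rightarrow> complex \<Rightarrow> complex" 1 cnj by (rule full_star_alg_complex)
  \<comment> \<open>The \<open>n \<times> (n + 1)\<close> matrix \<open>[1 - p, v]\<close>, written
    as a square matrix of size \<open>n + 1\<close> with last row zero.\<close>
  define \<alpha> where "\<alpha> i j = (if i < n \<and> j < n then (if i = j then 1 else 0) - v i * cnj (v j)
      else if i < n \<and> j = n then v i else 0)" for i j
  have \<alpha>M: "\<alpha> \<in> mats (Suc n) (Suc n)" by (auto simp: \<alpha>_def mats_def split: if_splits)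
  \<comment> \<open>\<open>1 - p\<close> is self-adjoint and idempotent because \<open>v\<close> has
    length one.\<close>
  have S: "(\<Sum>k<n. \<alpha> i k * cnj (\<alpha> j k)) = (if i = j then 1 else 0) - v i * cnj (v j)" if "i < n" "j < n" for i j
  proof -
    have "(\<Sum>k<n. \<alpha> i k * cnj (\<alpha> j k)) = (\<Sum>k<n. (if k = i then (if i = j then 1 else 0) else 0)
        - (if k = i then v i * cnj (v j) else 0) - (if k = j then v i * cnj (v j) else 0)
        + v i * cnj (v j) * (v k * cnj (v k)))"
      by (rule sum.cong) (use that in \<open>auto simp: \<alpha>_def algebra_simps\<close>)
    also have "\<dots> = (if i = j then 1 else 0) - v i * cnj (v j) - v i * cnj (v j)
        + v i * cnj (v j) * (\<Sum>k<n. v k * cnj (v k))"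
      using that by (simp add: sum.distrib sum_subtractf sum.delta sum_distrib_left)
    finally show ?thesis unfolding v by simp
  qed
  have \<alpha>0: "\<alpha> i k = 0" if "\<not> i < n" for i k using that by (simp add: \<alpha>_def)
  have \<alpha>n: "\<alpha> i n = v i" if "i < n" for i using that by (simp add: \<alpha>_def)
  \<comment> \<open>\<open>\<alpha> \<alpha>\<^sup>* = (1 - p) + p\<close> is the unit of the
    \<open>n \<times> n\<close> corner. In size \<open>n + 1\<close> this is a projection, so its
    norm is at most one.\<close>
  have "scalar_mult (Suc n) (mat_star cnj (mat_star cnj \<alpha>)) (mat_star cnj \<alpha>) = mat_unit 1 n"
  proof (intro ext)
    fix i j
    show "scalar_mult (Suc n) (mat_star cnj (mat_star cnj \<alpha>)) (mat_star cnj \<alpha>) i j = mat_unit 1 n i j"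
      by (cases "i < n"; cases "j < n") (simp_all add: mat_mult_def mat_star_def S \<alpha>0 \<alpha>n mat_unit_def)
  qed
  then have "(scalar_mnorm (Suc n) (mat_star cnj \<alpha>))\<^sup>2 = scalar_mnorm (Suc n) (mat_unit 1 n)"
    using C.norm_star_mul[OF C.star_closed[OF \<alpha>M]] by simp
  also have "\<dots> \<le> 1"
  proof (rule C.norm_projection_le_1)
    show "mat_unit 1 n \<in> mats (Suc n) (Suc n)" by (rule mats_mono[OF mat_unit_mats]) auto
    show "mat_star cnj (mat_unit 1 n) = mat_unit 1 n" by (auto simp: mat_star_def mat_unit_def fun_eq_iff)
    show "scalar_mult (Suc n) (mat_unit 1 n) (mat_unit 1 n) = mat_unit 1 n"
      using F.mat_mult_pad[OF mat_unit_mats mat_unit_mats, of n "Suc n" 1 1] F.mat_unit_mult[OF mat_unit_mats, of n 1] by simp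
  qed
  finally have s1: "scalar_mnorm (Suc n) (mat_star cnj \<alpha>) \<le> 1"
    using power2_le_imp_le[of "scalar_mnorm (Suc n) (mat_star cnj \<alpha>)" 1] by simp
  then have s2: "scalar_mnorm (Suc n) \<alpha> \<le> 1" using C.norm_star[OF \<alpha>M] by simp
  have RM: "rank_one n v h \<in> mats n n" by (auto simp: rank_one_def mats_def split: if_splits)
  show ?thesis
  proof (rule hermI[OF RM])
    show "0 \<le> (N 1 (mat1 h))\<^sup>2" by simp
    fix t :: real
    let ?z = "\<i> * complex_of_real t"
    let ?Z = "mat_unit e n + ?z *\<^sub>C rank_one n v h"
    let ?W = "direct_sum n (mat_unit e n) (mat1 (e + ?z *\<^sub>C h))"
    have ZM: "?Z \<in> mats n n" using RM by simp
    have WM: "?W \<in> mats (Suc n) (Suc n)" using direct_sum_mats[OF mat_unit_mats[of e n] mat1_mats[of "e + ?z *\<^sub>C h"]] by simp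
    have WN: "N (Suc n) ?W = max (N n (mat_unit e n)) (N 1 (mat1 (e + ?z *\<^sub>C h)))"
      using O.norm_direct_sum[OF mat_unit_mats[of e n] mat1_mats[of "e + ?z *\<^sub>C h"]] by simp
    have W: "?W k l = (if k = l then e else 0)" "?W k n = 0" "?W n k = 0" "?W n n = e + ?z *\<^sub>C h"
      if "k < n" "l < n" for k l
      using that by (simp_all add: direct_sum_def mat_unit_def mat1_def)
    have "?Z = sandwich (Suc n) \<alpha> ?W (mat_star cnj \<alpha>)"
    proof (intro ext)
      fix i j
      show "?Z i j = sandwich (Suc n) \<alpha> ?W (mat_star cnj \<alpha>) i j"
      proof (cases "i < n \<and> j < n")
        case True
        then have ij: "i < n" "j < n" by auto
        have "sandwich (Suc n) \<alpha> ?W (mat_star cnj \<alpha>) i j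
            = (\<Sum>k<n. \<Sum>l<n. if l = k then (\<alpha> i k * cnj (\<alpha> j k)) *\<^sub>C e else 0) + (v i * cnj (v j)) *\<^sub>C (e + ?z *\<^sub>C h)"
        proof -
          have "(\<Sum>l<Suc n. (\<alpha> i k * mat_star cnj \<alpha> l j) *\<^sub>C ?W k l)
              = (\<Sum>l<n. if l = k then (\<alpha> i k * cnj (\<alpha> j k)) *\<^sub>C e else 0)" if "k < n" for k
          proof -
            have "(\<Sum>l<n. (\<alpha> i k * mat_star cnj \<alpha> l j) *\<^sub>C ?W k l)
                = (\<Sum>l<n. if l = k then (\<alpha> i k * cnj (\<alpha> j k)) *\<^sub>C e else 0)"
              by (rule sum.cong) (use that in \<open>auto simp: W mat_star_def cv.scale_zero_right\<close>)
            then show ?thesis unfolding sum.lessThan_Suc W(2)[OF that that] cv.scale_zero_right by simp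
          qed
          moreover have "(\<Sum>l<Suc n. (\<alpha> i n * mat_star cnj \<alpha> l j) *\<^sub>C ?W n l) = (v i * cnj (v j)) *\<^sub>C (e + ?z *\<^sub>C h)"
            unfolding sum.lessThan_Suc using ij by (simp add: W cv.scale_zero_right \<alpha>n mat_star_def)
          ultimately show ?thesis unfolding sandwich_def by (simp add: sum.lessThan_Suc[of _ n] del: sum.lessThan_Suc)
        qed
        also have "(\<Sum>k<n. \<Sum>l<n. if l = k then (\<alpha> i k * cnj (\<alpha> j k)) *\<^sub>C e else 0)
            = (\<Sum>k<n. \<alpha> i k * cnj (\<alpha> j k)) *\<^sub>C e"
          by (simp add: sum.delta cv.scale_sum_left)
        also have "\<dots> = ((if i = j then 1 else 0) - v i * cnj (v j)) *\<^sub>C e" by (simp add: S[OF ij])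
        finally show ?thesis
          using ij by (simp add: mat_unit_def rank_one_def scaleC_fun_def cv.scale_left_diff_distrib scaleC_add_right
              scaleC_scaleC scaleC_one mult_ac)
      next
        case False
        then have "sandwich (Suc n) \<alpha> ?W (mat_star cnj \<alpha>) i j = 0"
          unfolding sandwich_def mat_star_def by (intro sum.neutral ballI) (auto simp: \<alpha>0)
        then show ?thesis using mats_outside[OF ZM False] by simp
      qed
    qed
    then have "N (Suc n) ?Z \<le> scalar_mnorm (Suc n) \<alpha> * N (Suc n) ?W * scalar_mnorm (Suc n) (mat_star cnj \<alpha>)"
      using O.norm_sandwich[OF \<alpha>M WM C.star_closed[OF \<alpha>M]] by simp
    also have "\<dots> \<le> 1 * N (Suc n) ?W * 1"
      using s1 s2 \<alpha>M O.N_nonneg[OF WM] by (intro mult_mono) auto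
    also have "\<dots> \<le> 1 + (N 1 (mat1 h))\<^sup>2 * t\<^sup>2"
      unfolding WN mult_1 mult_1_right
      by (intro max.boundedI order_trans[OF N_unit_le_1] norm_unit_plus[OF h]) simp
    finally show "N n ?Z \<le> 1 + (N 1 (mat1 h))\<^sup>2 * t\<^sup>2" using O.norm_pad[OF ZM, of "Suc n"] by simp
  qed
qed

section \<open>From rank-one elements to self-adjoint matrices\<close>

lemma herm_rank_one:
  assumes h: "star h = h" shows "herm n (rank_one n v h)"
proof -
  define s where "s = (\<Sum>k<n. (cmod (v k))\<^sup>2)"
  have s: "(\<Sum>k<n. v k * cnj (v k)) = complex_of_real s"
    by (simp add: s_def complex_norm_square del: of_real_power)
  show ?thesis
  proof (cases "s = 0")
    case True
    then have "v k = 0" if "k < n" for k using that by (simp add: s_def sum_nonneg_eq_0_iff)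
    then have "rank_one n v h = 0" by (simp add: rank_one_def fun_eq_iff)
    then show ?thesis by (simp only: herm_zero)
  next
    case False
    then have s0: "0 < s" by (simp add: s_def less_le sum_nonneg)
    let ?v = "\<lambda>k. v k / of_real (sqrt s)"
    have q: "complex_of_real (sqrt s) * complex_of_real (sqrt s) = of_real s"
      using s0 by (simp add: of_real_mult[symmetric] del: of_real_mult)
    have "(\<Sum>k<n. ?v k * cnj (?v k)) = (\<Sum>k<n. v k * cnj (v k)) / of_real s"
      by (simp add: q sum_divide_distrib)
    also have "\<dots> = 1" unfolding s using s0 by simp
    finally have "herm n (complex_of_real s *\<^sub>C rank_one n ?v h)"
      by (intro herm_scale herm_rank_one_unit h)
    moreover have "complex_of_real s *\<^sub>C rank_one n ?v h = rank_one n v h"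
      using s0 by (simp add: rank_one_def scaleC_fun_def fun_eq_iff scaleC_scaleC q cv.scale_zero_right)
    ultimately show ?thesis by simp
  qed
qed

text \<open>Polarization. With \<open>a = b + \<i> c\<close>, the vector
  \<open>e\<^sub>i + e\<^sub>j\<close> yields the part with \<open>b\<close> and
  \<open>e\<^sub>i - \<i> e\<^sub>j\<close> the part with \<open>c\<close>, after subtracting the
  diagonal terms. The formula includes \<open>i = j\<close>, where the vectors become
  \<open>2 e\<^sub>i\<close> and \<open>(1 - \<i>) e\<^sub>i\<close>; their squared lengths
  \<open>4\<close> and \<open>2\<close> leave \<open>2 b\<close>, which is \<open>a\<close> plus its
  adjoint.\<close>

lemma herm_entry_pair:
  assumes ij: "i < n" "j < n"
  shows "herm n (mat_entry i j a + mat_entry j i (star a))"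
proof -
  obtain b c where bc: "star b = b" "star c = c" "a = b + \<i> *\<^sub>C c" "star a = b - \<i> *\<^sub>C c"
    by (rule cartesian_decomposition[of a]) auto
  let ?u = "\<lambda>\<zeta> k. (if k = i then 1 else 0) + (if k = j then \<zeta> else 0)" and ?x = "\<lambda>i k. if k = i then 1 else 0"
  let ?R = "\<lambda>v h. rank_one n v h"
  have two: "2 *\<^sub>C y = y + y" and four: "4 *\<^sub>C y = y + y + y + y" for y :: 'a
    using scaleC_add_left[of 1 1 y] scaleC_add_left[of 2 2 y] by (simp_all add: scaleC_one add.assoc)
  have i2: "(1 - \<i>) * (1 + \<i>) = 2" by (simp add: complex_eq_iff)
  have "mat_entry i j a + mat_entry j i (star a)
    = (?R (?u 1) b - ?R (?x i) b - ?R (?x j) b) + (?R (?u (- \<i>)) c - ?R (?x i) c - ?R (?x j) c)"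
  proof (intro ext)
    fix k l
    show "(mat_entry i j a + mat_entry j i (star a)) k l
      = ((?R (?u 1) b - ?R (?x i) b - ?R (?x j) b) + (?R (?u (- \<i>)) c - ?R (?x i) c - ?R (?x j) c)) k l"
      unfolding bc(4) unfolding bc(3) using ij
      by (cases "k = i"; cases "k = j"; cases "l = i"; cases "l = j")
        (simp_all add: mat_entry_def rank_one_def fun_diff_def scaleC_one cv.scale_minus_left scaleC_add_left i2 two four)
  qed
  moreover have "herm n \<dots>" by (intro herm_add herm_diff herm_rank_one bc)
  ultimately show ?thesis by simp
qed

text \<open>Summing the pairs over all \<open>i\<close> and \<open>j\<close> counts every entry
  twice and gives \<open>H + H\<close>, which avoids choosing an upper triangle.\<close>

lemma herm_self_adjoint:
  assumes H: "H \<in> mats n n" "mat_star star H = H"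
  shows "herm n H"
proof -
  have st: "star (H i j) = H j i" for i j using fun_cong[OF fun_cong[OF H(2)], of j i] by (simp add: mat_star_def)
  have "herm n (\<Sum>i<n. \<Sum>j<n. mat_entry i j (H i j) + mat_entry j i (star (H i j)))"
    by (intro herm_sum herm_entry_pair) auto
  also have "(\<Sum>i<n. \<Sum>j<n. mat_entry i j (H i j) + mat_entry j i (star (H i j))) = H + H"
  proof -
    have "(\<Sum>i<n. \<Sum>j<n. mat_entry j i (H j i)) = H"
      by (subst sum.swap) (rule mats_expand[OF H(1), symmetric])
    then show ?thesis using mats_expand[OF H(1)] by (simp add: sum.distrib st)
  qed
  finally have "herm n (complex_of_real (1/2) *\<^sub>C (H + H))" by (rule herm_scale)
  moreover have "complex_of_real (1/2) *\<^sub>C (H + H) = H"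
    by (simp add: scaleC_add_right scaleC_add_left[symmetric] scaleC_one)
  ultimately show ?thesis by simp
qed

text \<open>After scaling, \<open>H = (U + U\<^sup>*) / 2\<close> with \<open>U = exp (i L)\<close>; then \<open>N U \<le> N (exp (i L / m)) ^ m\<close>, where
  \<open>N (exp (i L / m)) \<le> 1 + O (1 / m\<^sup>2)\<close> because \<open>L\<close> is hermitian.\<close>

lemma N_self_adjoint_le:
  assumes H: "H \<in> mats n n" "mat_star star H = H"
  shows "N n H \<le> K n H"
proof (cases "K n H = 0")
  case True
  then have "H = 0" using M.norm_eq_0[OF H(1)] by blast
  then show ?thesis using O.N_zero M.norm_nonneg[OF H(1)] by simp
next
  case False
  then have K0: "0 < K n H" using M.norm_nonneg[OF H(1)] by linarith
  obtain \<Lambda> P where P: "finite \<Lambda>" "\<And>t. t \<in> \<Lambda> \<Longrightarrow> P t \<in> mats n n"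
    "\<And>t. t \<in> \<Lambda> \<Longrightarrow> mat_star star (P t) = P t"
    "\<And>t u. t \<in> \<Lambda> \<Longrightarrow> u \<in> \<Lambda> \<Longrightarrow> mat_mult mul n (P t) (P u) = (if t = u then P t else 0)"
    "mat_unit e n = (\<Sum>t\<in>\<Lambda>. P t)" "H = (\<Sum>t\<in>\<Lambda>. of_real t *\<^sub>C P t)" "\<And>t. t \<in> \<Lambda> \<Longrightarrow> \<bar>t\<bar> \<le> K n H"
    by (rule M.spectral_decomposition[OF H]) blast
  \<comment> \<open>Functional calculus of \<open>H\<close>: multiplicative, additive and unital in
    \<open>z\<close>.\<close>
  define E where "E z = (\<Sum>t\<in>\<Lambda>. z t *\<^sub>C P t)" for z :: "real \<Rightarrow> complex"
  have EM [simp]: "E z \<in> mats n n" for z unfolding E_def using P(2) by simp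
  have E_mult: "mat_mult mul n (E z) (E w) = E (\<lambda>t. z t * w t)" for z w
  proof -
    have "mat_mult mul n (E z) (E w) = (\<Sum>u\<in>\<Lambda>. \<Sum>t\<in>\<Lambda>. mat_mult mul n (z t *\<^sub>C P t) (w u *\<^sub>C P u))"
      unfolding E_def using P(1,2) by (simp add: M.mul_sum_left M.mul_sum_right)
    also have "\<dots> = (\<Sum>u\<in>\<Lambda>. \<Sum>t\<in>\<Lambda>. if t = u then (z u * w u) *\<^sub>C P u else 0)"
      using P(2) by (intro sum.cong) (auto simp: M.mul_scale_left M.mul_scale_right P(4) scaleC_scaleC mult.commute)
    also have "\<dots> = E (\<lambda>t. z t * w t)" using P(1) by (simp add: E_def)
    finally show ?thesis .
  qed
  have E_1: "E (\<lambda>_. 1) = mat_unit e n" by (simp add: E_def P(5) scaleC_one)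
  have E_add: "E z + E w = E (\<lambda>t. z t + w t)" and E_scale: "c *\<^sub>C E z = E (\<lambda>t. c * z t)" for z w c
    by (simp_all add: E_def sum.distrib scaleC_add_left cv.scale_sum_right scaleC_scaleC)
  have N_pow: "N n (E (\<lambda>t. z t ^ m)) \<le> N n (E z) ^ m" for z m
  proof (induction m)
    case 0
    then show ?case using N_unit_le_1 by (simp add: E_1)
  next
    case (Suc m)
    have "N n (E (\<lambda>t. z t ^ Suc m)) = N n (mat_mult mul n (E z) (E (\<lambda>t. z t ^ m)))" by (simp add: E_mult)
    also have "\<dots> \<le> N n (E z) * N n (E (\<lambda>t. z t ^ m))" by (rule N_mult) simp_all
    also have "\<dots> \<le> N n (E z) * N n (E z) ^ m" using Suc O.N_nonneg[OF EM] by (intro mult_left_mono) auto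
    finally show ?case by simp
  qed
  \<comment> \<open>The spectrum of \<open>H / K n H\<close> lies in \<open>[-1, 1]\<close>, so
    \<open>L\<close> below is an angle with \<open>cos L = H / K n H\<close>.\<close>
  define \<theta> where "\<theta> t = arccos (t / K n H)" for t
  define L where "L = E (\<lambda>t. of_real (\<theta> t))"
  have "mat_star star L = L"
    unfolding L_def E_def using P(1,2,3) by (simp add: M.star_sum[where n = n] M.star_scale[where n = n])
  then have "herm n L" by (intro herm_self_adjoint) (simp_all add: L_def)
  then obtain C where C: "0 \<le> C" "\<And>t::real. N n (mat_unit e n + (\<i> * of_real t) *\<^sub>C L) \<le> 1 + C * t\<^sup>2"
    unfolding herm_def by auto
  \<comment> \<open>\<open>C\<close> comes from \<open>L\<close> being hermitian, the sum from the
    Taylor remainders on the spectral projections.\<close>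
  define D where "D = C + (\<Sum>t\<in>\<Lambda>. (\<theta> t)\<^sup>2 * N n (P t))"
  have D0: "0 \<le> D" unfolding D_def using C(1) P(2) by (auto intro!: add_nonneg_nonneg sum_nonneg mult_nonneg_nonneg O.N_nonneg)
  have small: "N n (E (\<lambda>t. exp (\<i> * of_real (s * \<theta> t)))) \<le> 1 + D * s\<^sup>2" for s :: real
  proof -
    let ?r = "\<lambda>t. exp (\<i> * complex_of_real (s * \<theta> t)) - 1 - \<i> * of_real (s * \<theta> t)"
    \<comment> \<open>The exponent is purely imaginary, so the remainder after the linear term is at
      most the square of its modulus.\<close>
    have r: "cmod (?r t) \<le> s\<^sup>2 * (\<theta> t)\<^sup>2" for t
      using Taylor_exp[of "\<i> * complex_of_real (s * \<theta> t)" 1]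
      by (simp add: norm_mult power_mult_distrib power2_eq_square abs_mult algebra_simps)
    have "E (\<lambda>t. exp (\<i> * of_real (s * \<theta> t))) = (mat_unit e n + (\<i> * of_real s) *\<^sub>C L) + E ?r"
      unfolding L_def E_1[symmetric] E_scale E_add by (rule arg_cong[of _ _ E]) (simp add: fun_eq_iff)
    then have h1: "N n (E (\<lambda>t. exp (\<i> * of_real (s * \<theta> t)))) \<le> N n (mat_unit e n + (\<i> * of_real s) *\<^sub>C L) + N n (E ?r)"
      by (simp only:) (intro O.N_add, simp_all add: L_def)
    have "N n (E ?r) \<le> (\<Sum>t\<in>\<Lambda>. N n (?r t *\<^sub>C P t))" unfolding E_def by (rule N_sum_le) (use P in simp_all)
    also have "\<dots> \<le> (\<Sum>t\<in>\<Lambda>. (s\<^sup>2 * (\<theta> t)\<^sup>2) * N n (P t))"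
      by (rule sum_mono) (use P(2) r in \<open>simp add: O.N_scale mult_right_mono O.N_nonneg\<close>)
    also have "\<dots> = s\<^sup>2 * (\<Sum>t\<in>\<Lambda>. (\<theta> t)\<^sup>2 * N n (P t))" by (simp add: sum_distrib_left mult.assoc)
    finally have "N n (E ?r) \<le> s\<^sup>2 * (\<Sum>t\<in>\<Lambda>. (\<theta> t)\<^sup>2 * N n (P t))" .
    moreover have "D * s\<^sup>2 = C * s\<^sup>2 + s\<^sup>2 * (\<Sum>t\<in>\<Lambda>. (\<theta> t)\<^sup>2 * N n (P t))"
      by (simp add: D_def algebra_simps)
    ultimately show ?thesis using h1 C(2)[of s] by linarith
  qed
  have unitary: "N n (E (\<lambda>t. exp (\<i> * of_real (s * \<theta> t)))) \<le> 1" for s :: real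
  proof -
    let ?U = "\<lambda>s. E (\<lambda>t. exp (\<i> * complex_of_real (s * \<theta> t)))"
    have "N n (?U s) \<le> exp (D * s\<^sup>2 / real (Suc m))" for m
    proof -
      let ?m = "Suc m"
      have "N n (?U s) = N n (E (\<lambda>t. exp (\<i> * complex_of_real (s / ?m * \<theta> t)) ^ ?m))"
      proof -
        have "complex_of_real r * (\<i> * complex_of_real (s / r * \<theta> t)) = \<i> * complex_of_real (s * \<theta> t)"
          if "r \<noteq> 0" for t r
        proof -
          have "complex_of_real r * (\<i> * complex_of_real (s / r * \<theta> t)) = \<i> * complex_of_real (r * (s / r * \<theta> t))"
            by (simp only: of_real_mult mult.left_commute)
          then show ?thesis using that by simp
        qed
        from this[of "real ?m"]
        have "of_nat ?m * (\<i> * complex_of_real (s / ?m * \<theta> t)) = \<i> * complex_of_real (s * \<theta> t)" for t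
          unfolding of_real_of_nat_eq by simp
        then have "exp (\<i> * complex_of_real (s / ?m * \<theta> t)) ^ ?m = exp (\<i> * complex_of_real (s * \<theta> t))" for t
          using exp_of_nat_mult[of ?m "\<i> * complex_of_real (s / ?m * \<theta> t)"] by metis
        then show ?thesis by (simp only:)
      qed
      also have "\<dots> \<le> N n (?U (s / ?m)) ^ ?m" by (rule N_pow)
      also have "\<dots> \<le> (1 + D * (s / ?m)\<^sup>2) ^ ?m"
        by (rule power_mono[OF small O.N_nonneg[OF EM]])
      also have "\<dots> \<le> exp (D * (s / ?m)\<^sup>2) ^ ?m"
      proof -
        have "0 \<le> 1 + D * (s / ?m)\<^sup>2" using D0 by (intro add_nonneg_nonneg mult_nonneg_nonneg) simp_all
        then show ?thesis by (rule power_mono[OF exp_ge_add_one_self])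
      qed
      also have "\<dots> = exp (D * s\<^sup>2 / real ?m)"
      proof -
        have "r * (D * (s / r)\<^sup>2) = D * s\<^sup>2 / r" if "r \<noteq> 0" for r
          using that by (simp add: power2_eq_square)
        from this[of "real ?m"] have "real ?m * (D * (s / ?m)\<^sup>2) = D * s\<^sup>2 / real ?m" by simp
        then show ?thesis using exp_of_nat_mult[of ?m "D * (s / ?m)\<^sup>2"] by (simp only:)
      qed
      finally show ?thesis .
    qed
    moreover have "(\<lambda>m. exp (D * s\<^sup>2 / real (Suc m))) \<longlonglongrightarrow> exp 0"
      by (intro tendsto_exp LIMSEQ_Suc lim_const_over_n)
    ultimately show ?thesis
      by (intro LIMSEQ_le_const[of "\<lambda>m. exp (D * s\<^sup>2 / real (Suc m))" 1]) auto
  qed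
  \<comment> \<open>The values \<open>1\<close> and \<open>-1\<close> of \<open>s\<close> give
    \<open>exp (i L)\<close> and its adjoint; the factor \<open>1\<close> is kept so that
    \<open>unitary\<close> applies to both summands.\<close>
  have "H = of_real (K n H / 2) *\<^sub>C (E (\<lambda>t. exp (\<i> * of_real (1 * \<theta> t))) + E (\<lambda>t. exp (\<i> * of_real ((-1) * \<theta> t))))"
  proof -
    have "of_real (K n H / 2) * (exp (\<i> * of_real (1 * \<theta> t)) + exp (\<i> * of_real ((-1) * \<theta> t))) = complex_of_real t"
      if "t \<in> \<Lambda>" for t
    proof -
      have "exp (\<i> * of_real (1 * \<theta> t)) + exp (\<i> * of_real ((-1) * \<theta> t)) = complex_of_real (2 * cos (\<theta> t))"
        by (simp add: complex_eq_iff Re_exp Im_exp)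
      also have "cos (\<theta> t) = t / K n H"
        unfolding \<theta>_def using P(7)[OF that] K0 by (intro cos_arccos_abs) (simp add: abs_divide)
      finally show ?thesis using K0 by simp
    qed
    then show ?thesis
      unfolding E_def cv.scale_sum_right sum.distrib[symmetric] scaleC_scaleC scaleC_add_left[symmetric]
      by (subst P(6)) (intro sum.cong, simp_all)
  qed
  then have "N n H = K n H / 2 * N n (E (\<lambda>t. exp (\<i> * of_real (1 * \<theta> t))) + E (\<lambda>t. exp (\<i> * of_real ((-1) * \<theta> t))))"
    using O.N_scale[of "E (\<lambda>t. exp (\<i> * of_real (1 * \<theta> t))) + E (\<lambda>t. exp (\<i> * of_real ((-1) * \<theta> t)))" n "of_real (K n H / 2)"] K0
    by (metis EM M.closed(2) norm_of_real abs_of_pos half_gt_zero)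
  also have "\<dots> \<le> K n H / 2 * (N n (E (\<lambda>t. exp (\<i> * of_real (1 * \<theta> t)))) + N n (E (\<lambda>t. exp (\<i> * of_real ((-1) * \<theta> t)))))"
    using K0 by (intro mult_left_mono O.N_add) simp_all
  also have "\<dots> \<le> K n H / 2 * (1 + 1)"
    using K0 by (intro mult_left_mono add_mono unitary) simp_all
  finally show ?thesis by simp
qed

text \<open>For \<open>D = x \<oplus> x\<^sup>*\<close> and the flip \<open>W\<close> of the two
  blocks, \<open>X = D W\<close> is self-adjoint with \<open>x\<close> and its adjoint off the
  diagonal, and \<open>D = X W\<close>. As \<open>W\<close> is a contraction for both norms,
  \<open>N x \<le> N D \<le> N X \<le> K X \<le> K D = K x\<close>.\<close>

theorem N_eq_K:
  assumes x: "x \<in> mats n n"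
  shows "N n x = K n x"
proof (rule antisym)
  show "K n x \<le> N n x" using x by (rule K_le_N)
  interpret C: cstar_alg "mats (n + n) (n + n)" "scalar_mult (n + n)" "mat_unit 1 (n + n)" "mat_star cnj" "scalar_mnorm (n + n)"
    by (rule scalar_cstar)
  define \<sigma> where "\<sigma> j = (if j < n then n + j else j - n)" for j
  define W where "W k j = (if j < n + n \<and> k = \<sigma> j then 1 else 0 :: complex)" for k j
  have \<sigma>: "\<sigma> j < n + n" "\<sigma> (\<sigma> j) = j" if "j < n + n" for j using that by (auto simp: \<sigma>_def)
  have WM: "W \<in> mats (n + n) (n + n)" using \<sigma> by (auto simp: W_def mats_def split: if_splits)
  have "mat_star cnj W = W" by (auto simp: mat_star_def W_def fun_eq_iff \<sigma>)
  moreover have "scalar_mult (n + n) W W = mat_unit 1 (n + n)"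
  proof (intro ext)
    fix i j
    have "scalar_mult (n + n) W W i j = (\<Sum>k<n+n. if k = \<sigma> j then (if j < n + n \<and> i = j then 1 else 0) else 0)"
      unfolding mat_mult_def by (rule sum.cong) (auto simp: W_def \<sigma>)
    then show "scalar_mult (n + n) W W i j = mat_unit 1 (n + n) i j" using \<sigma> by (auto simp: mat_unit_def)
  qed
  ultimately have "(scalar_mnorm (n + n) W)\<^sup>2 = scalar_mnorm (n + n) (mat_unit 1 (n + n))"
    using C.norm_star_mul[OF WM] by simp
  also have "\<dots> \<le> 1" by (rule C.norm_unit_le_1)
  finally have W1: "scalar_mnorm (n + n) W \<le> 1"
    using power2_le_imp_le[of "scalar_mnorm (n + n) W" 1] by simp
  let ?D = "direct_sum n x (mat_star star x)"
  have sx: "mat_star star x \<in> mats n n" using x by simp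
  have DM: "?D \<in> mats (n + n) (n + n)" using x sx by (rule direct_sum_mats)
  define X where "X i j = (if j < n + n then ?D i (\<sigma> j) else 0)" for i j
  have XM: "X \<in> mats (n + n) (n + n)"
    unfolding mats_iff X_def using mats_outside[OF DM] by auto
  have mW: "mat_mult mul (n + n) Y (scalars W) i j = (if j < n + n then Y i (\<sigma> j) else 0)" for Y i j
  proof -
    have "mat_mult mul (n + n) Y (scalars W) i j = (\<Sum>k<n+n. if k = \<sigma> j then (if j < n + n then Y i (\<sigma> j) else 0) else 0)"
      unfolding mat_mult_def scalars_def
      by (rule sum.cong) (auto simp: W_def mul_scale_right scaleC_one)
    then show ?thesis using \<sigma> by auto
  qed
  have DW: "mat_mult mul (n + n) ?D (scalars W) = X" by (intro ext) (simp add: mW X_def)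
  have XW: "mat_mult mul (n + n) X (scalars W) = ?D"
  proof (intro ext)
    fix i j
    show "mat_mult mul (n + n) X (scalars W) i j = ?D i j"
      using mats_outside[OF DM, of i j] by (auto simp: mW X_def \<sigma>)
  qed
  have "mat_star star X = X"
  proof (rule mats_eqI[OF M.star_closed[OF XM] XM])
    fix i j assume "i < n + n" "j < n + n"
    then show "mat_star star X i j = X i j"
      by (rule_tac less_or_add_cases[of i n]; rule_tac less_or_add_cases[of j n])
        (simp_all add: mat_star_def X_def \<sigma>_def direct_sum_simps)
  qed
  then have NX: "N (n + n) X \<le> K (n + n) X" using XM by (intro N_self_adjoint_le)
  have "N n x \<le> N (n + n) ?D" using O.norm_direct_sum[OF x sx] by simp
  also have "\<dots> \<le> N (n + n) X * N (n + n) (scalars W)"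
    using N_mult[OF XM scalars_mats[OF WM]] by (simp add: XW)
  also have "\<dots> \<le> N (n + n) X * 1"
    using N_scalars[OF WM] W1 O.N_nonneg[OF XM] by (intro mult_left_mono) auto
  also have "\<dots> \<le> K (n + n) ?D * K (n + n) (scalars W)"
    using NX M.norm_mul[OF DM scalars_mats[OF WM]] by (simp add: DW)
  also have "\<dots> \<le> K (n + n) ?D * 1"
    using norm_scalars_le[OF WM] W1 M.norm_nonneg[OF DM] by (intro mult_left_mono) auto
  also have "\<dots> = K n x" using norm_direct_sum[OF x sx] M.norm_star[OF x] by simp
  finally show "N n x \<le> K n x" .
qed

end

section \<open>Tensors\<close>

lemma clinearI:
  "(\<And>x y. f (x + y) = f x + f y) \<Longrightarrow> (\<And>c x. f (c *\<^sub>C x) = c *\<^sub>C f x) \<Longrightarrow> clinear f"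
  by (simp add: clinear_iff)

lemma clinear_comp: "clinear f \<Longrightarrow> clinear g \<Longrightarrow> clinear (f \<circ> g)"
  by (simp add: clinear_iff)

lemma clinear_id: "clinear id"
  by (simp add: clinear_iff)

lemma clinear_sum: "clinear f \<Longrightarrow> f (\<Sum>i\<in>I. g i) = (\<Sum>i\<in>I. f (g i))"
  by (induction I rule: infinite_finite_induct) (simp_all add: clinearD)

lemma tensor_zero [simp]: "0 \<otimes> y = 0" "x \<otimes> 0 = 0"
  using tensor_simps(3)[of 0 0 y] tensor_simps(4)[of x 0 0] by simp_all

lemma tensor_ext:
  assumes "clinear f" "clinear g" "\<And>x y. f (x \<otimes> y) = g (x \<otimes> y)"
  shows "f = g"
proof
  fix t show "f t = g t"
    by (induction t rule: tensor_induct) (simp_all add: clinearD[OF assms(1)] clinearD[OF assms(2)] assms(3))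
qed

lemma clinear_tensor_map: "clinear f \<Longrightarrow> clinear g \<Longrightarrow> clinear (tensor_map f g)"
  unfolding tensor_map_def
  by (rule linear_tensor_lift) (simp add: cbilinear_def clinear_iff tensor_simps)

lemma clinear_tensor_flip: "clinear tensor_flip"
  unfolding tensor_flip_def
  by (rule linear_tensor_lift) (simp add: cbilinear_def clinear_iff tensor_simps)

lemma cbilinear_scaleC: "cbilinear (\<lambda>c x. c *\<^sub>C x)" "cbilinear (\<lambda>x c. c *\<^sub>C x)"
  by (simp_all add: cbilinear_def clinear_iff scaleC_complex_def scaleC_add_left scaleC_add_right scaleC_scaleC mult.commute)

lemma clinear_tensor_lunit: "clinear tensor_lunit" and clinear_tensor_runit: "clinear tensor_runit"
  unfolding tensor_lunit_def tensor_runit_def by (rule linear_tensor_lift cbilinear_scaleC)+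

lemma tensor_lunit_tensor: "tensor_lunit (c \<otimes> x) = c *\<^sub>C x"
  and tensor_runit_tensor: "tensor_runit (x \<otimes> c) = c *\<^sub>C x"
  unfolding tensor_lunit_def tensor_runit_def by (rule tensor_lift_tensor cbilinear_scaleC)+

lemma clinear_tensor_assoc:
  "clinear (tensor_assoc :: (('a::complex_vector, 'b::complex_vector) tensor, 'c::complex_vector) tensor \<Rightarrow> _)"
proof -
  have bil: "cbilinear (\<lambda>x y. x \<otimes> (y \<otimes> z))" for z :: 'c and x :: 'a and y :: 'b
    by (simp add: cbilinear_def clinear_iff tensor_simps)
  define g :: "('a, 'b) tensor \<Rightarrow> 'c \<Rightarrow> ('a, ('b, 'c) tensor) tensor"
    where "g t z = tensor_lift (\<lambda>x y. x \<otimes> (y \<otimes> z)) t" for t z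
  have lin: "clinear (\<lambda>t. g t z)" for z
    unfolding g_def using linear_tensor_lift[OF bil] .
  have g: "g (x \<otimes> y) z = x \<otimes> (y \<otimes> z)" for x y z
    unfolding g_def by (rule tensor_lift_tensor[OF bil])
  \<comment> \<open>\<open>tensor_lift\<close> gives linearity in \<open>t\<close> for fixed
    \<open>z\<close>; linearity in \<open>z\<close> has to be checked on elementary tensors.\<close>
  have "g t (z + z') = g t z + g t z'" for t z z'
    by (induction t rule: tensor_induct) (simp_all add: g clinearD[OF lin] tensor_simps)
  moreover have "g t (c *\<^sub>C z) = c *\<^sub>C g t z" for t c z
    by (induction t rule: tensor_induct)
      (simp_all add: g clinearD[OF lin] tensor_simps scaleC_add_right cv.scale_zero_right)
  ultimately have "cbilinear g"
    using lin by (simp add: cbilinear_def clinear_iff)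
  then show ?thesis unfolding tensor_assoc_def g_def by (rule linear_tensor_lift)
qed

lemma clinear_tensor_conj: "clinear tensor_conj"
  unfolding tensor_conj_def
  by (rule linear_tensor_lift)
    (simp add: cbilinear_def clinear_iff tensor_simps plus_conj.rep_eq scaleC_conj.rep_eq
      plus_conj.abs_eq scaleC_conj.abs_eq)

lemma clinear_conj_map: "clinear f \<Longrightarrow> clinear (conj_map f)"
  by (simp add: conj_map_def clinear_iff plus_conj.rep_eq scaleC_conj.rep_eq plus_conj.abs_eq scaleC_conj.abs_eq)

lemmas conj_inverse [simp] = to_conj_inverse[OF UNIV_I] of_conj_inverse

section \<open>The Haagerup norm\<close>

lemma odot_mats: "x \<in> mats n r \<Longrightarrow> y \<in> mats r m \<Longrightarrow> odot r x y \<in> mats n m"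
  by (auto simp: mats_iff odot_def)

text \<open>A row of blocks times a column of blocks: \<open>[x, x']\<close> and
  \<open>[y; y']\<close>.\<close>

lemma odot_add:
  "odot r x y + odot s x' y' = odot (r + s) (\<lambda>i k. if k < r then x i k else x' i (k - r))
    (\<lambda>k j. if k < r then y k j else y' (k - r) j)"
  by (intro ext) (simp add: odot_def sum_lessThan_add)

text \<open>Makes the infimum in \<open>haagerup\<close> one over a nonempty set. Matrices of the
  form \<open>x \<odot> y\<close> are closed under sums by \<open>odot_add\<close>, and a matrix
  unit tensored with \<open>a \<otimes> b\<close> is a column with the single entry \<open>a\<close>
  times a row with the single entry \<open>b\<close>.\<close>

lemma odot_surj:
  assumes "v \<in> mats n m"
  shows "\<exists>r x y. x \<in> mats n r \<and> y \<in> mats r m \<and> v = odot r x y"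
proof -
  define dec where "dec v \<longleftrightarrow> (\<exists>r x y. x \<in> mats n r \<and> y \<in> mats r m \<and> v = odot r x y)"
    for v :: "('a, 'b) tensor matrix"
  have zero: "dec 0"
    unfolding dec_def by (intro exI[of _ 0] exI) (auto intro: zero_mats simp: odot_def fun_eq_iff)
  have dec_add: "dec (v + w)" if vw: "dec v" "dec w" for v w
  proof -
    obtain r x y s x' y' where v: "x \<in> mats n r" "y \<in> mats r m" "v = odot r x y"
      and w: "x' \<in> mats n s" "y' \<in> mats s m" "w = odot s x' y'"
      using vw unfolding dec_def by blast
    have "(\<lambda>i k. if k < r then x i k else x' i (k - r)) \<in> mats n (r + s)"
      "(\<lambda>k j. if k < r then y k j else y' (k - r) j) \<in> mats (r + s) m"
    proof -
      have "x' i (j - r) = 0" "y' (j - r) i = 0" if "\<not> j < r + s" for i j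
        using that by (auto intro: mats_outside[OF w(1)] mats_outside[OF w(2)])
      then show "(\<lambda>i k. if k < r then x i k else x' i (k - r)) \<in> mats n (r + s)"
        "(\<lambda>k j. if k < r then y k j else y' (k - r) j) \<in> mats (r + s) m"
        using v(1,2) w(1,2) by (auto simp: mats_iff)
    qed
    then show ?thesis unfolding dec_def v(3) w(3) odot_add by blast
  qed
  have entry: "dec (mat_entry i j t)" if ij: "i < n" "j < m" for i j and t :: "('a, 'b) tensor"
  proof (induction t rule: tensor_induct)
    case zero
    have "mat_entry i j (0 :: ('a, 'b) tensor) = 0" by (auto simp: mat_entry_def fun_eq_iff)
    then show ?case using \<open>dec 0\<close> by (simp only:)
  next
    case (add a b t)
    have "mat_entry i 0 a \<in> mats n 1" "mat_entry 0 j b \<in> mats 1 m"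
      using ij by (auto simp: mat_entry_def mats_def split: if_splits)
    moreover have "mat_entry i j (a \<otimes> b) = odot 1 (mat_entry i 0 a) (mat_entry 0 j b)"
      by (auto simp: mat_entry_def odot_def fun_eq_iff)
    ultimately have "dec (mat_entry i j (a \<otimes> b))" unfolding dec_def by blast
    moreover have "mat_entry i j (a \<otimes> b + t) = mat_entry i j (a \<otimes> b) + mat_entry i j t"
      by (auto simp: mat_entry_def fun_eq_iff)
    ultimately show ?case using dec_add[OF _ add] by (simp only:)
  qed
  have sum: "dec (\<Sum>i\<in>I. f i)" if "finite I" "\<And>i. i \<in> I \<Longrightarrow> dec (f i)" for I :: "nat set" and f
    using that
  proof (induction I rule: finite_induct)
    case empty
    show ?case unfolding sum.empty by (rule zero)
  next
    case (insert i I)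
    show ?case unfolding sum.insert[OF insert.hyps] by (rule dec_add) (use insert in blast)+
  qed
  have "dec (\<Sum>i<n. \<Sum>j<m. mat_entry i j (v i j))" by (intro sum entry) auto
  then show ?thesis using mats_expand[OF assms] unfolding dec_def by simp
qed

lemma haagerup_greatest:
  assumes "v \<in> mats n n"
    "\<And>r x y. x \<in> mats n r \<Longrightarrow> y \<in> mats r n \<Longrightarrow> v = odot r x y \<Longrightarrow> c \<le> N (max n r) x * M (max n r) y"
  shows "c \<le> haagerup N M n v"
proof -
  obtain r x y where "x \<in> mats n r" "y \<in> mats r n" "v = odot r x y" using odot_surj[OF assms(1)] by blast
  then have "{N (max n r) x * M (max n r) y | r x y. x \<in> mats n r \<and> y \<in> mats r n \<and> v = odot r x y} \<noteq> {}" by blast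
  then have "c \<le> Inf {N (max n r) x * M (max n r) y | r x y. x \<in> mats n r \<and> y \<in> mats r n \<and> v = odot r x y}"
    by (rule cInf_greatest) (use assms(2) in blast)
  then show ?thesis unfolding haagerup_def restrict_apply if_P[OF assms(1)] .
qed

text \<open>Square factors are admissible with \<open>r = n\<close>, where the padding size
  \<open>max n r\<close> is \<open>n\<close> again. Nonnegativity of the norms bounds the set below,
  so its infimum is at most this member.\<close>

lemma haagerup_le:
  assumes "op_space N" "op_space M" "x \<in> mats n n" "y \<in> mats n n"
  shows "haagerup N M n (odot n x y) \<le> N n x * M n y"
proof -
  interpret A: op_space N by fact
  interpret B: op_space M by fact
  have "Inf {N (max n r) x' * M (max n r) y' | r x' y'. x' \<in> mats n r \<and> y' \<in> mats r n \<and> odot n x y = odot r x' y'}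
      \<le> N n x * M n y"
  proof (rule cInf_lower)
    show "N n x * M n y \<in> {N (max n r) x' * M (max n r) y' | r x' y'. x' \<in> mats n r \<and> y' \<in> mats r n \<and> odot n x y = odot r x' y'}"
      by (rule CollectI, intro exI[of _ n] exI[of _ x] exI[of _ y]) (use assms in simp)
    show "bdd_below {N (max n r) x' * M (max n r) y' | r x' y'. x' \<in> mats n r \<and> y' \<in> mats r n \<and> odot n x y = odot r x' y'}"
    proof (rule bdd_belowI[of _ 0], elim CollectE exE conjE)
      fix z r and x' :: "'a matrix" and y' :: "'b matrix"
      assume z: "z = N (max n r) x' * M (max n r) y'" and "x' \<in> mats n r" "y' \<in> mats r n"
      then have "x' \<in> mats (max n r) (max n r)" "y' \<in> mats (max n r) (max n r)" by (auto intro: mats_mono)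
      then show "0 \<le> z" unfolding z by (intro mult_nonneg_nonneg A.N_nonneg B.N_nonneg)
    qed
  qed
  then show ?thesis unfolding haagerup_def restrict_apply if_P[OF odot_mats[OF assms(3,4)]] .
qed

lemma scalar_mnorm_mat1_one: "scalar_mnorm 1 (mat1 1) = 1"
proof -
  interpret C: cstar_alg "mats 1 1" "scalar_mult 1" "mat_unit 1 1" "mat_star cnj" "scalar_mnorm 1"
    by (rule scalar_cstar)
  have u: "mat1 1 = (mat_unit 1 1 :: complex matrix)" by (auto simp: mat1_def mat_unit_def fun_eq_iff)
  have "mat1 (1::complex) 0 0 \<noteq> 0" by (simp add: mat1_def)
  then have "mat1 (1::complex) \<noteq> 0" by (metis zero_fun_apply)
  then have "scalar_mnorm 1 (mat1 1) \<noteq> 0" using C.norm_eq_0[OF mat1_mats] by blast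
  moreover have "scalar_mnorm 1 (mat1 1) = (scalar_mnorm 1 (mat1 1))\<^sup>2"
    unfolding u using C.norm_star_mul[OF C.unit_closed] C.star_unit C.unit_left[OF C.unit_closed] by simp
  ultimately show ?thesis by (simp add: power2_eq_square)
qed

text \<open>\<open>a\<close> is \<open>z \<mapsto> z a(1)\<close>, and by the cross norm formula its
  amplifications multiply all norms by the norm of \<open>a(1)\<close>.\<close>

lemma complete_isometry_norm_1:
  assumes "op_space N" "clinear a"
  shows "complete_isometry scalar_mnorm N a \<longleftrightarrow> N 1 (mat1 (a 1)) = 1"
proof -
  interpret op_space N by fact
  have a: "a z = z *\<^sub>C a 1" for z using clinearD(2)[OF assms(2), of z 1] by (simp add: scaleC_complex_def)
  have eq: "N n (amplify a x) = scalar_mnorm n x * N 1 (mat1 (a 1))" if "x \<in> mats n n" for n x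
  proof -
    have "amplify a x = (\<lambda>i j. x i j *\<^sub>C a 1)" unfolding amplify_def using a by blast
    then show ?thesis using norm_scalar_tensor[OF that, of "a 1"] by simp
  qed
  show ?thesis
  proof
    assume "complete_isometry scalar_mnorm N a"
    then have iso: "N 1 (amplify a x) = scalar_mnorm 1 x" if "x \<in> mats 1 1" for x
      using that unfolding complete_isometry_def by blast
    show "N 1 (mat1 (a 1)) = 1" using scalar_mnorm_mat1_one iso[OF mat1_mats, of 1] eq[OF mat1_mats, of 1] by simp
  next
    assume "N 1 (mat1 (a 1)) = 1"
    then show "complete_isometry scalar_mnorm N a" using eq assms(2) by (simp add: complete_isometry_def)
  qed
qed

text \<open>The isometry condition has target \<open>A\<^sub>o\<close>, whose norms are those of
  transposes. Transposition reverses products, but it is the adjoint followed by entrywise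
  conjugation, and the latter is an antilinear star homomorphism, contractive by the iteration
  argument.\<close>

lemma scalar_mnorm_transpose:
  assumes "\<alpha> \<in> mats n n" shows "scalar_mnorm n (\<lambda>i j. \<alpha> j i) = scalar_mnorm n \<alpha>"
proof -
  interpret C: cstar_alg "mats n n" "scalar_mult n" "mat_unit 1 n" "mat_star cnj" "scalar_mnorm n"
    by (rule scalar_cstar)
  let ?c = "\<lambda>\<beta> :: complex matrix. \<lambda>i j. cnj (\<beta> i j)"
  have cM: "?c \<beta> \<in> mats n n" if "\<beta> \<in> mats n n" for \<beta> using that by (simp add: mats_iff)
  have c: "?c (x + y) = ?c x + ?c y" "?c (z *\<^sub>C x) = cnj z *\<^sub>C ?c x"
    "?c (scalar_mult n (mat_star cnj x) x) = scalar_mult n (mat_star cnj (?c x)) (?c x)" for x y z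
    by (simp_all add: fun_eq_iff scaleC_fun_def scaleC_complex_def mat_mult_def mat_star_def)
  have le: "scalar_mnorm n (?c \<beta>) \<le> scalar_mnorm n \<beta>" if \<beta>: "\<beta> \<in> mats n n" for \<beta>
  proof (rule C.cstar_seminorm_le[of "\<lambda>\<beta>. scalar_mnorm n (?c \<beta>)", OF _ _ _ \<beta>])
    fix x :: "complex matrix" assume x: "x \<in> mats n n"
    show "scalar_mnorm n (?c (z *\<^sub>C x)) = cmod z * scalar_mnorm n (?c x)" for z
      unfolding c using C.norm_scale[OF cM[OF x], of "cnj z"] by simp
    show "scalar_mnorm n (?c (scalar_mult n (mat_star cnj x) x)) = (scalar_mnorm n (?c x))\<^sup>2"
      unfolding c by (rule C.norm_star_mul[OF cM[OF x]])
    show "scalar_mnorm n (?c (x + y)) \<le> scalar_mnorm n (?c x) + scalar_mnorm n (?c y)" if "y \<in> mats n n" for y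
      unfolding c by (rule C.norm_add[OF cM[OF x] cM[OF that]])
  qed
  have "(\<lambda>i j. \<alpha> j i) = ?c (mat_star cnj \<alpha>)" by (simp add: mat_star_def)
  moreover have "scalar_mnorm n (?c \<beta>) = scalar_mnorm n \<beta>" if "\<beta> \<in> mats n n" for \<beta>
    using le[OF that] le[OF cM[OF that]] by simp
  ultimately show ?thesis using C.norm_star[OF assms] C.star_closed[OF assms] by simp
qed

section \<open>From standard to categorical data\<close>

lemma cstar_matrices_canonical:
  assumes "std_vN_algebra S"
  shows "cstar_matrices (std_mult S) (std_unit S) (std_star S) (std_norm S) (canonical_mnorm S)"
proof -
  have A: "cstar_alg UNIV (std_mult S) (std_unit S) (std_star S) (std_norm S)"
    using assms by (simp add: std_vN_algebra_def vN_algebra_on_iff)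
  then interpret A: cstar_alg UNIV "std_mult S" "std_unit S" "std_star S" "std_norm S" .
  interpret A: full_star_alg "std_mult S" "std_unit S" "std_star S" ..
  show ?thesis
    by (intro cstar_matrices.intro cstar_matrices_axioms.intro A.full_star_alg_axioms A canonical_mnorm[OF assms])
qed

context cstar_matrices
begin

lemma cbilinear_mul: "cbilinear mul"
  by (simp add: cbilinear_def clinear_iff mul_add_left mul_add_right mul_scale_left mul_scale_right)

abbreviation \<mu> :: "('a, 'a) tensor \<Rightarrow> 'a" where "\<mu> \<equiv> tensor_lift mul"
abbreviation \<eta> :: "complex \<Rightarrow> 'a" where "\<eta> \<equiv> \<lambda>z. z *\<^sub>C e"
abbreviation \<iota> :: "'a conj \<Rightarrow> 'a" where "\<iota> \<equiv> \<lambda>x. star (of_conj x)"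

lemma clinear_maps: "clinear \<mu>" "clinear \<eta>" "clinear \<iota>"
  using linear_tensor_lift[OF cbilinear_mul]
  by (simp_all add: clinear_iff scaleC_add_left scaleC_complex_def scaleC_scaleC star_add star_scale
      plus_conj.rep_eq scaleC_conj.rep_eq)

lemma \<mu>_tensor: "\<mu> (a \<otimes> b) = mul a b"
  by (rule tensor_lift_tensor[OF cbilinear_mul])

lemma monoid_object: "monoid_object N \<eta> \<mu>"
proof -
  interpret O: op_space N by unfold_locales (rule operator_space)
  have "complete_contraction (haagerup N N) N \<mu>"
    unfolding complete_contraction_def
  proof (intro conjI clinear_maps allI ballI)
    fix n and v :: "('a, 'a) tensor matrix" assume v: "v \<in> mats n n"
    show "N n (amplify \<mu> v) \<le> haagerup N N n v"
    proof (rule haagerup_greatest[OF v])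
      fix r and x y :: "'a matrix" assume x: "x \<in> mats n r" and y: "y \<in> mats r n" and eq: "v = odot r x y"
      \<comment> \<open>Both factors are padded to squares of size \<open>max n r\<close>, at which
        \<open>haagerup\<close> measures them; their product lies in the \<open>n \<times> n\<close>
        corner, where \<open>pad\<close> applies.\<close>
      let ?m = "max n r"
      have xm: "x \<in> mats ?m ?m" and ym: "y \<in> mats ?m ?m" using x y by (auto intro: mats_mono)
      have "amplify \<mu> v = mat_mult mul ?m x y"
      proof (intro ext)
        fix i j
        have "amplify \<mu> v i j = (\<Sum>k<r. mul (x i k) (y k j))"
          unfolding amplify_def eq odot_def clinear_sum[OF clinear_maps(1)] \<mu>_tensor ..
        also have "\<dots> = (\<Sum>k<?m. mul (x i k) (y k j))"
          by (rule sum.mono_neutral_left) (use x in \<open>auto simp: mats_iff\<close>)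
        finally show "amplify \<mu> v i j = mat_mult mul ?m x y i j" by (simp add: mat_mult_def)
      qed
      moreover have "amplify \<mu> v \<in> mats n n"
        using v clinearD(3)[OF clinear_maps(1)] by (simp add: mats_iff amplify_def)
      then have "N n (amplify \<mu> v) = N ?m (amplify \<mu> v)" using pad[of "amplify \<mu> v" n ?m] by simp
      ultimately show "N n (amplify \<mu> v) \<le> N ?m x * N ?m y" using M.norm_mul[OF xm ym] by simp
    qed
  qed
  moreover have "complete_contraction scalar_mnorm N \<eta>"
    unfolding complete_contraction_def
  proof (intro conjI clinear_maps allI ballI)
    fix n and x :: "complex matrix" assume x: "x \<in> mats n n"
    have "amplify \<eta> x = scalars x" by (simp add: amplify_def scalars_def)
    then show "N n (amplify \<eta> x) \<le> scalar_mnorm n x" using norm_scalars_le[OF x] by simp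
  qed
  moreover have "\<mu> \<circ> tensor_map \<mu> id = \<mu> \<circ> tensor_map id \<mu> \<circ> tensor_assoc"
  proof (rule tensor_ext)
    fix t and z :: 'a
    \<comment> \<open>The first factor \<open>t\<close> is itself a tensor, so it is reduced to
      elementary tensors by a second use of \<open>tensor_ext\<close>.\<close>
    have "(\<lambda>t. (\<mu> \<circ> tensor_map \<mu> id) (t \<otimes> z)) = (\<lambda>t. (\<mu> \<circ> tensor_map id \<mu> \<circ> tensor_assoc) (t \<otimes> z))"
    proof (rule tensor_ext)
      have z: "clinear (\<lambda>t. t \<otimes> z)" for z :: 'a by (rule clinearI) (simp_all add: tensor_simps)
      show "clinear (\<lambda>t. (\<mu> \<circ> tensor_map \<mu> id) (t \<otimes> z))"
        using clinear_comp[OF clinear_comp[OF clinear_maps(1) clinear_tensor_map[OF clinear_maps(1) clinear_id]] z]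
        by (simp add: comp_def)
      show "clinear (\<lambda>t. (\<mu> \<circ> tensor_map id \<mu> \<circ> tensor_assoc) (t \<otimes> z))"
        using clinear_comp[OF clinear_comp[OF clinear_comp[OF clinear_maps(1)
          clinear_tensor_map[OF clinear_id clinear_maps(1)]] clinear_tensor_assoc] z]
        by (simp add: comp_def)
      show "(\<mu> \<circ> tensor_map \<mu> id) ((x \<otimes> y) \<otimes> z) = (\<mu> \<circ> tensor_map id \<mu> \<circ> tensor_assoc) ((x \<otimes> y) \<otimes> z)" for x y
        by (simp add: tensor_map_tensor clinear_maps clinear_id \<mu>_tensor tensor_assoc_tensor mul_assoc)
    qed
    then show "(\<mu> \<circ> tensor_map \<mu> id) (t \<otimes> z) = (\<mu> \<circ> tensor_map id \<mu> \<circ> tensor_assoc) (t \<otimes> z)"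
      by (rule fun_cong)
  qed (intro clinear_comp clinear_maps clinear_tensor_map clinear_id clinear_tensor_assoc)+
  moreover have "\<mu> \<circ> tensor_map \<eta> id = tensor_lunit"
    by (rule tensor_ext, (intro clinear_comp clinear_maps clinear_tensor_map clinear_id clinear_tensor_lunit)+)
      (simp add: tensor_map_tensor clinear_maps clinear_id \<mu>_tensor tensor_lunit_tensor mul_scale_left)
  moreover have "\<mu> \<circ> tensor_map id \<eta> = tensor_runit"
    by (rule tensor_ext, (intro clinear_comp clinear_maps clinear_tensor_map clinear_id clinear_tensor_runit)+)
      (simp add: tensor_map_tensor clinear_maps clinear_id \<mu>_tensor tensor_runit_tensor mul_scale_right)
  ultimately show ?thesis unfolding monoid_object_def by blast
qed

lemma involution_contraction: "complete_contraction (conj_mnorm N) (op_mnorm N) \<iota>"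
  unfolding complete_contraction_def
proof (intro conjI clinear_maps allI ballI)
  fix n and x :: "'a conj matrix" assume x: "x \<in> mats n n"
  have "amplify of_conj x \<in> mats n n" using x by (simp add: mats_iff amplify_def zero_conj.rep_eq)
  moreover have "(\<lambda>i j. amplify \<iota> x j i) = mat_star star (amplify of_conj x)"
    by (simp add: amplify_def mat_star_def)
  ultimately show "op_mnorm N n (amplify \<iota> x) \<le> conj_mnorm N n x"
    by (simp add: op_mnorm_def conj_mnorm_def M.norm_star)
qed

lemma involution_antimultiplicative: "\<iota> \<circ> conj_map \<mu> \<circ> tensor_conj = \<mu> \<circ> tensor_flip \<circ> tensor_map \<iota> \<iota>"
  by (rule tensor_ext, (intro clinear_comp clinear_maps clinear_conj_map clinear_tensor_map
        clinear_tensor_flip clinear_tensor_conj)+)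
    (simp add: tensor_conj_tensor conj_map_def \<mu>_tensor tensor_map_tensor clinear_maps tensor_flip_tensor star_mul)

text \<open>The composite is \<open>z \<mapsto> z a(1)\<^sup>* a(1)\<close>; by the C*-identity this
  element has norm one, and the cross norm formula lifts that to all levels.\<close>

lemma isometry_condition:
  assumes a: "complete_isometry scalar_mnorm N a"
  shows "complete_isometry scalar_mnorm (op_mnorm N)
    (\<mu> \<circ> tensor_flip \<circ> tensor_map id \<iota> \<circ> tensor_map a (conj_map a) \<circ> (\<lambda>z. z \<otimes> to_conj 1))"
    (is "complete_isometry _ _ ?T")
proof -
  interpret O: op_space N by unfold_locales (rule operator_space)
  interpret A: cstar_alg UNIV mul e star \<nu> by (rule base)
  let ?b = "mul (star (a 1)) (a 1)"
  have lin: "clinear a" using a by (simp add: complete_isometry_def)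
  have az: "a z = z *\<^sub>C a 1" for z using clinearD(2)[OF lin, of z 1] by (simp add: scaleC_complex_def)
  have "\<nu> (a 1) = 1" using a unfolding complete_isometry_norm_1[OF O.op_space_axioms lin] norm_mat1 .
  then have b: "\<nu> ?b = 1" using A.norm_star_mul[of "a 1"] by simp
  have "?T z = z *\<^sub>C ?b" for z
  proof -
    have "?T z = mul (star (a 1)) (a z)"
      by (simp add: tensor_map_tensor lin clinear_conj_map clinear_id clinear_maps tensor_flip_tensor \<mu>_tensor conj_map_def)
    then show ?thesis using az[of z] by (simp add: mul_scale_right)
  qed
  then have eq: "?T = (\<lambda>z. z *\<^sub>C ?b)"
    by (rule ext)
  show ?thesis
    unfolding eq complete_isometry_def
  proof (intro conjI allI ballI)
    show "clinear (\<lambda>z. z *\<^sub>C ?b)" by (rule clinearI) (simp_all add: scaleC_add_left scaleC_complex_def scaleC_scaleC)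
    fix n and x :: "complex matrix" assume x: "x \<in> mats n n"
    then have xt: "(\<lambda>i j. x j i) \<in> mats n n" by (auto simp: mats_iff)
    show "op_mnorm N n (amplify (\<lambda>z. z *\<^sub>C ?b) x) = scalar_mnorm n x"
      using O.norm_scalar_tensor[OF xt, of ?b, unfolded norm_mat1 b] scalar_mnorm_transpose[OF x]
      by (simp add: op_mnorm_def amplify_def)
  qed
qed

end

lemma std_to_cat_correct:
  fixes S :: "'a::complex_vector std_data"
  assumes "std_vN_algebra S"
  shows "cat_vN_algebra (std_to_cat S)" "cat_to_std (std_to_cat S) = S"
proof -
  interpret C: cstar_matrices "std_mult S" "std_unit S" "std_star S" "std_norm S" "canonical_mnorm S"
    by (rule cstar_matrices_canonical[OF assms])
  have "C.\<iota> \<circ> conj_map C.\<iota> \<circ> (to_conj \<circ> to_conj) = id"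
    by (simp add: fun_eq_iff conj_map_def)
  then show "cat_vN_algebra (std_to_cat S)"
    unfolding cat_vN_algebra_def Let_def std_to_cat_def cat_data.simps
    using C.fin_dim C.operator_space C.monoid_object C.involution_contraction
      C.involution_antimultiplicative C.isometry_condition by blast
  show "cat_to_std (std_to_cat S) = S"
    by (simp add: cat_to_std_def std_to_cat_def C.\<mu>_tensor C.norm_mat1 scaleC_one del: One_nat_def)
qed

section \<open>From categorical to standard data\<close>

text \<open>Each axiom of a star algebra is an equation between linear maps evaluated at an
  elementary tensor; antimultiplicativity of the star, for example, is \<open>anti\<close> at
  \<open>to_conj a \<otimes> to_conj b\<close>.\<close>

lemma cat_star_alg:
  fixes C :: "'a::complex_vector cat_data"
  assumes C: "cat_vN_algebra C"
  defines "S \<equiv> cat_to_std C"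
  shows "star_alg UNIV (std_mult S) (std_unit S) (std_star S)"
proof -
  let ?N = "cat_mnorm C" and ?\<mu> = "cat_mult C" and ?\<eta> = "cat_unit C" and ?\<iota> = "cat_inv C"
  have fd: "fin_dim (UNIV :: 'a set)" and mon: "monoid_object ?N ?\<eta> ?\<mu>"
    and inv: "complete_contraction (conj_mnorm ?N) (op_mnorm ?N) ?\<iota>"
    and invol: "?\<iota> \<circ> conj_map ?\<iota> \<circ> (to_conj \<circ> to_conj) = id"
    and anti: "?\<iota> \<circ> conj_map ?\<mu> \<circ> tensor_conj = ?\<mu> \<circ> tensor_flip \<circ> tensor_map ?\<iota> ?\<iota>"
    using C unfolding cat_vN_algebra_def Let_def by blast+
  have lin: "clinear ?\<mu>" "clinear ?\<eta>" "clinear ?\<iota>"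
    using mon inv unfolding monoid_object_def complete_contraction_def by blast+
  have assoc: "?\<mu> \<circ> tensor_map ?\<mu> id = ?\<mu> \<circ> tensor_map id ?\<mu> \<circ> tensor_assoc"
    and unit: "?\<mu> \<circ> tensor_map ?\<eta> id = tensor_lunit" "?\<mu> \<circ> tensor_map id ?\<eta> = tensor_runit"
    using mon unfolding monoid_object_def by blast+
  have S: "std_mult S = (\<lambda>a b. ?\<mu> (a \<otimes> b))" "std_unit S = ?\<eta> 1" "std_star S = (\<lambda>a. ?\<iota> (to_conj a))"
    by (simp_all add: S_def cat_to_std_def)
  show ?thesis
    unfolding S
  proof
    fix a b c :: 'a and z :: complex
    show "?\<mu> ((a + b) \<otimes> c) = ?\<mu> (a \<otimes> c) + ?\<mu> (b \<otimes> c)" "?\<mu> (a \<otimes> (b + c)) = ?\<mu> (a \<otimes> b) + ?\<mu> (a \<otimes> c)"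
      "?\<mu> ((z *\<^sub>C a) \<otimes> b) = z *\<^sub>C ?\<mu> (a \<otimes> b)" "?\<mu> (a \<otimes> (z *\<^sub>C b)) = z *\<^sub>C ?\<mu> (a \<otimes> b)"
      by (simp_all add: tensor_simps clinearD[OF lin(1)])
    show "?\<mu> (a \<otimes> ?\<mu> (b \<otimes> c)) = ?\<mu> (?\<mu> (a \<otimes> b) \<otimes> c)"
      using fun_cong[OF assoc, of "a \<otimes> b \<otimes> c"] by (simp add: tensor_map_tensor lin clinear_id tensor_assoc_tensor)
    show "?\<mu> (?\<eta> 1 \<otimes> a) = a" "?\<mu> (a \<otimes> ?\<eta> 1) = a"
      using fun_cong[OF unit(1), of "1 \<otimes> a"] fun_cong[OF unit(2), of "a \<otimes> 1"]
      by (simp_all add: tensor_map_tensor lin clinear_id tensor_lunit_tensor tensor_runit_tensor scaleC_one)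
    show "?\<iota> (to_conj (a + b)) = ?\<iota> (to_conj a) + ?\<iota> (to_conj b)"
      using clinearD(1)[OF lin(3), of "to_conj a" "to_conj b"] by (simp add: plus_conj.abs_eq)
    show "?\<iota> (to_conj (z *\<^sub>C a)) = cnj z *\<^sub>C ?\<iota> (to_conj a)"
      using clinearD(2)[OF lin(3), of "cnj z" "to_conj a"] by (simp add: scaleC_conj.abs_eq)
    show "?\<iota> (to_conj (?\<iota> (to_conj a))) = a"
      using fun_cong[OF invol, of a] by (simp add: conj_map_def)
    show "?\<iota> (to_conj (?\<mu> (a \<otimes> b))) = ?\<mu> (?\<iota> (to_conj b) \<otimes> ?\<iota> (to_conj a))"
      using fun_cong[OF anti, of "to_conj a \<otimes> to_conj b"]
      by (simp add: tensor_conj_tensor conj_map_def tensor_map_tensor lin tensor_flip_tensor)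
  qed (use fd in simp_all)
qed

text \<open>The Haagerup norm of \<open>x \<odot> y\<close> is at most the product of the norms, so
  contractivity of the multiplication map gives submultiplicativity at every level. The C*-identity
  is read off from the isometry condition on the unit sphere of \<open>A\<close> and extended by
  homogeneity.\<close>

lemma cat_std_vN_algebra:
  fixes C :: "'a::complex_vector cat_data"
  assumes C: "cat_vN_algebra C"
  defines "S \<equiv> cat_to_std C"
  shows "cstar_alg UNIV (std_mult S) (std_unit S) (std_star S) (std_norm S)"
    and "x \<in> mats n n \<Longrightarrow> y \<in> mats n n \<Longrightarrow>
      cat_mnorm C n (mat_mult (std_mult S) n x y) \<le> cat_mnorm C n x * cat_mnorm C n y"
proof -
  let ?N = "cat_mnorm C" and ?\<mu> = "cat_mult C" and ?\<iota> = "cat_inv C"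
  let ?T = "\<lambda>a. ?\<mu> \<circ> tensor_flip \<circ> tensor_map id ?\<iota> \<circ> tensor_map a (conj_map a) \<circ> (\<lambda>z. z \<otimes> to_conj 1)"
  interpret A: star_alg UNIV "std_mult S" "std_unit S" "std_star S"
    unfolding S_def by (rule cat_star_alg[OF C])
  interpret O: op_space ?N
    by unfold_locales (use C in \<open>simp add: cat_vN_algebra_def Let_def\<close>)
  have cc: "complete_contraction (haagerup ?N ?N) ?N ?\<mu>"
    and inv: "complete_contraction (conj_mnorm ?N) (op_mnorm ?N) ?\<iota>"
    and iso: "\<And>a. complete_isometry scalar_mnorm ?N a \<Longrightarrow> complete_isometry scalar_mnorm (op_mnorm ?N) (?T a)"
    using C unfolding cat_vN_algebra_def monoid_object_def Let_def by blast+
  have lin: "clinear ?\<mu>" "clinear ?\<iota>" using cc inv unfolding complete_contraction_def by blast+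
  have S: "std_mult S = (\<lambda>a b. ?\<mu> (a \<otimes> b))" "std_star S = (\<lambda>a. ?\<iota> (to_conj a))"
    "std_norm S = (\<lambda>a. ?N 1 (mat1 a))"
    by (simp_all add: S_def cat_to_std_def)
  show mult: "?N n (mat_mult (std_mult S) n x y) \<le> ?N n x * ?N n y" if xy: "x \<in> mats n n" "y \<in> mats n n" for n x y
  proof -
    have "mat_mult (std_mult S) n x y = amplify ?\<mu> (odot n x y)"
      unfolding amplify_def odot_def mat_mult_def clinear_sum[OF lin(1)] S ..
    then have "?N n (mat_mult (std_mult S) n x y) \<le> haagerup ?N ?N n (odot n x y)"
      using cc odot_mats[OF xy] unfolding complete_contraction_def by simp
    also have "\<dots> \<le> ?N n x * ?N n y" by (rule haagerup_le[OF O.op_space_axioms O.op_space_axioms xy])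
    finally show ?thesis .
  qed
  define \<nu> where "\<nu> a = ?N 1 (mat1 a)" for a
  have lin1: "mat1 (a + b) = mat1 a + mat1 b" "mat1 (c *\<^sub>C a) = c *\<^sub>C mat1 a" "mat1 a = 0 \<longleftrightarrow> a = 0" for a b :: 'a and c
    by (auto simp: mat1_def fun_eq_iff scaleC_fun_def)
  have norm: "norm_on UNIV \<nu>"
    unfolding norm_on_def \<nu>_def lin1
    using O.N_nonneg[OF mat1_mats] O.N_eq_0[OF mat1_mats] O.N_add[OF mat1_mats mat1_mats] O.N_scale[OF mat1_mats]
    by (simp only: lin1) simp
  have unit_sphere: "\<nu> (std_mult S (std_star S a) a) = 1" if a: "\<nu> a = 1" for a
  proof -
    let ?a = "\<lambda>z. z *\<^sub>C a"
    have la: "clinear ?a" by (rule clinearI) (simp_all add: scaleC_add_left scaleC_complex_def scaleC_scaleC)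
    have "complete_isometry scalar_mnorm ?N ?a"
      using complete_isometry_norm_1[OF O.op_space_axioms la] a by (simp add: \<nu>_def scaleC_one)
    from iso[OF this] have isoc: "complete_isometry scalar_mnorm (op_mnorm ?N) (?T ?a)" .
    have eq: "(?T ?a) z = std_mult S (std_star S a) (z *\<^sub>C a)" for z
      by (simp add: tensor_map_tensor la clinear_conj_map clinear_id lin tensor_flip_tensor conj_map_def S scaleC_one)
    have "op_mnorm ?N 1 (amplify (?T ?a) (mat1 1)) = scalar_mnorm 1 (mat1 1)"
      using isoc mat1_mats[of "1::complex"] unfolding complete_isometry_def by blast
    moreover have "(\<lambda>i j. amplify (?T ?a) (mat1 1) j i) = mat1 (std_mult S (std_star S a) a)"
      unfolding amplify_def eq by (auto simp: mat1_def fun_eq_iff scaleC_one)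
    ultimately show ?thesis by (simp only: op_mnorm_def \<nu>_def scalar_mnorm_mat1_one)
  qed
  have scale: "\<nu> (c *\<^sub>C a) = cmod c * \<nu> a" for c a using norm_onD(4)[OF norm] by simp
  show "cstar_alg UNIV (std_mult S) (std_unit S) (std_star S) (std_norm S)"
  proof
    have N: "std_norm S = \<nu>" by (simp add: S(3) \<nu>_def[abs_def])
    show "norm_on UNIV (std_norm S)" unfolding N by (rule norm)
    fix a b :: 'a
    have "mat_mult (std_mult S) 1 (mat1 a) (mat1 b) = mat1 (std_mult S a b)"
      by (auto simp: mat_mult_def mat1_def fun_eq_iff)
    then show "std_norm S (std_mult S a b) \<le> std_norm S a * std_norm S b"
      using mult[OF mat1_mats mat1_mats, of a b] by (simp add: S(3) del: One_nat_def)
    show "std_norm S (std_mult S (std_star S a) a) = (std_norm S a)\<^sup>2"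
      unfolding N
    proof (cases "a = 0")
      case True
      moreover have "\<nu> 0 = 0" using norm_onD(2)[OF norm UNIV_I] by blast
      ultimately show "\<nu> (std_mult S (std_star S a) a) = (\<nu> a)\<^sup>2" by simp
    next
      case False
      then have p: "0 < \<nu> a" using norm_onD(1,2)[OF norm, of a] by (simp add: less_le)
      let ?c = "complex_of_real (1 / \<nu> a)"
      have cc: "cmod (?c * ?c) = (1 / \<nu> a) * (1 / \<nu> a)" using p by (simp add: norm_mult norm_divide)
      have "\<nu> (?c *\<^sub>C a) = 1" using p by (simp add: scale norm_divide)
      then have "\<nu> (std_mult S (std_star S (?c *\<^sub>C a)) (?c *\<^sub>C a)) = 1" by (rule unit_sphere)
      also have "std_mult S (std_star S (?c *\<^sub>C a)) (?c *\<^sub>C a) = (?c * ?c) *\<^sub>C std_mult S (std_star S a) a"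
        by (simp add: A.star_scale A.mul_scale_left A.mul_scale_right scaleC_scaleC)
      finally have eq: "(1 / \<nu> a) * (1 / \<nu> a) * \<nu> (std_mult S (std_star S a) a) = 1"
        unfolding scale cc .
      have "\<nu> (std_mult S (std_star S a) a)
          = (\<nu> a)\<^sup>2 * ((1 / \<nu> a) * (1 / \<nu> a) * \<nu> (std_mult S (std_star S a) a))"
        using p by (simp add: power2_eq_square)
      then show "\<nu> (std_mult S (std_star S a) a) = (\<nu> a)\<^sup>2" unfolding eq by simp
    qed
  qed
qed

lemma cat_to_std_correct:
  fixes C :: "'a::complex_vector cat_data"
  assumes C: "cat_vN_algebra C"
  shows "std_vN_algebra (cat_to_std C)" "std_to_cat (cat_to_std C) = C"
proof -
  let ?S = "cat_to_std C" and ?N = "cat_mnorm C" and ?\<mu> = "cat_mult C" and ?\<eta> = "cat_unit C" and ?\<iota> = "cat_inv C"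
  show std: "std_vN_algebra ?S"
    unfolding std_vN_algebra_def vN_algebra_on_iff by (rule cat_std_vN_algebra[OF C])
  have Sn: "std_norm ?S = (\<lambda>a. ?N 1 (mat1 a))" by (simp add: cat_to_std_def)
  interpret M: cstar_matrices "std_mult ?S" "std_unit ?S" "std_star ?S" "\<lambda>a. ?N 1 (mat1 a)" "canonical_mnorm ?S"
    using cstar_matrices_canonical[OF std] unfolding Sn .
  interpret O: op_space ?N
    by unfold_locales (use C in \<open>simp add: cat_vN_algebra_def Let_def\<close>)
  have cc: "clinear ?\<mu>" "complete_contraction scalar_mnorm ?N ?\<eta>"
    and inv: "complete_contraction (conj_mnorm ?N) (op_mnorm ?N) ?\<iota>"
    using C unfolding cat_vN_algebra_def monoid_object_def complete_contraction_def[of "haagerup ?N ?N"] Let_def by blast+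
  have \<eta>: "?\<eta> z = z *\<^sub>C ?\<eta> 1" for z
    using cc(2) clinearD(2)[of ?\<eta> z 1] unfolding complete_contraction_def by (simp add: scaleC_complex_def)
  \<comment> \<open>Here \<open>K\<close> is the canonical structure of the algebra just obtained
    and \<open>N\<close> the given one; their equality is the substance of this round trip.\<close>
  interpret operator_star_alg ?N "std_mult ?S" "std_unit ?S" "std_star ?S" "canonical_mnorm ?S"
  proof
    fix n and x y :: "'a matrix" and \<alpha> :: "complex matrix"
    show "?N n (mat_mult (std_mult ?S) n x y) \<le> ?N n x * ?N n y" if "x \<in> mats n n" "y \<in> mats n n"
      using that by (rule cat_std_vN_algebra(2)[OF C])
    show "?N n (M.scalars \<alpha>) \<le> scalar_mnorm n \<alpha>" if "\<alpha> \<in> mats n n"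
    proof -
      have "amplify ?\<eta> \<alpha> = M.scalars \<alpha>"
        unfolding amplify_def M.scalars_def by (intro ext) (simp add: cat_to_std_def \<eta>[symmetric])
      then show ?thesis using cc(2) that unfolding complete_contraction_def by metis
    qed
    show "?N n (mat_star (std_star ?S) x) \<le> ?N n x" if x: "x \<in> mats n n"
    proof -
      have "amplify to_conj x \<in> mats n n" using x by (simp add: mats_iff amplify_def zero_conj.abs_eq)
      then have "op_mnorm ?N n (amplify ?\<iota> (amplify to_conj x)) \<le> conj_mnorm ?N n (amplify to_conj x)"
        using inv unfolding complete_contraction_def by blast
      then show ?thesis by (simp add: op_mnorm_def conj_mnorm_def amplify_def mat_star_def cat_to_std_def)
    qed
  qed
  have "canonical_mnorm ?S = ?N"
  proof
    fix n show "canonical_mnorm ?S n = ?N n"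
      by (rule extensionalityI[of _ "mats n n"]) (simp_all add: M.mats_extensional O.extensional N_eq_K)
  qed
  moreover have "tensor_lift (std_mult ?S) = ?\<mu>"
    by (rule tensor_ext[OF M.clinear_maps(1) cc(1)]) (simp add: M.\<mu>_tensor, simp add: cat_to_std_def)
  moreover have "(\<lambda>z. z *\<^sub>C std_unit ?S) = ?\<eta>" by (intro ext) (simp add: cat_to_std_def \<eta>[symmetric])
  moreover have "(\<lambda>x. std_star ?S (of_conj x)) = ?\<iota>" by (simp add: cat_to_std_def)
  ultimately show "std_to_cat ?S = C" by (simp add: std_to_cat_def)
qed

text \<open>Existence and uniqueness of the matrix norms is part of the claim because
  \<open>canonical_mnorm\<close> is a definite description, meaningful only then. Determination of
  either data by the other is expressed by two explicit, mutually inverse translations.\<close>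

theorem theorem30:
  shows "(\<forall>S :: 'a::complex_vector std_data. std_vN_algebra S \<longrightarrow>
            (\<forall>n. \<exists>!\<nu>. vN_matrix_norm S n \<nu>) \<and>
            cat_vN_algebra (std_to_cat S) \<and> cat_to_std (std_to_cat S) = S) \<and>
         (\<forall>C :: 'a cat_data. cat_vN_algebra C \<longrightarrow>
            std_vN_algebra (cat_to_std C) \<and> std_to_cat (cat_to_std C) = C)"
  using ex1_vN_matrix_norm std_to_cat_correct cat_to_std_correct by blast

end
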